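(* Assume (RHS.1), (RHS.2), (BC.1), (BC.2), and (OBS.1). Let $\{\mathfrak h_j=(h_j,\varepsilon_j,\theta_j)\}_{j\ge1}$ satisfy $$\lim_{j\to\infty}\Big[h_j+\varepsilon_j+\theta_j+\frac{h_j}{\varepsilon_j}+\frac{\theta_j}{\varepsilon_j}\Big]=0,$$ and, if (RHS.2b) holds, assume in addition that (M.1) holds for every $j$. Then the solutions $u_{\mathfrak h_j}\in\mathbb V_{h_j}$ of the discrete obstacle problem converge uniformly, as $j\to\infty$, to $u$, the viscosity solution of the obstacle problem $\mathbb T[u;f,\chi]=0$ in $\Omega$, $u=g$ on $\partial\Omega$.
   Context: Setting: $\Omega\subset\mathbb R^d$ ($d\ge1$) is a bounded domain with continuous boundary. For $r>0$, $\Omega^{(r)}=\{x\in\Omega:\operatorname{dist}(x,\partial\Omega)>r\}$. $\{\mathcal T_h\}_{h>0}$ is a quasiuniform family of meshes of closed simplices, $h=\max_T\operatorname{diam}T$, $\Omega_h$ the interior of the union of the simplices, with $\Omega^{(h)}\subset\Omega_h\subset\Omega$; $\mathcal N_h$ is the set of vertices. $\mathbb V_h$ is the space of continuous piecewise linear functions on $\mathcal T_h$, hat basis $\{\hat\varphi_z\}$, Lagrange interpolant $\mathcal I_h$. Parameters $\mathfrak h=(h,\varepsilon,\theta)$, $\varepsilon\in[h,\operatorname{diam}\Omega]$, $0<\theta\le1$. $\mathcal N_h^I=\mathcal N_h\cap\Omega^{(2\varepsilon)}$, $\mathcal N_h^b=\mathcal N_h\setminus\mathcal N_h^I$. $\mathbb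 S_\theta$ is a finite symmetric subset of the unit sphere $\mathbb S$ such that each $v\in\mathbb S$ has $v_\theta\in\mathbb S_\theta$ with $|v-v_\theta|\le\theta$. For $z\in\mathcal N_h^I$, $\mathcal N_{\mathfrak h}(z)=\{z\}\cup\{z+\varepsilon v_\theta:v_\theta\in\mathbb S_\theta\}$, $-\Delta^\diamond_{\infty,\mathfrak h}w(z)=\varepsilon^{-2}\big(2w(z)-\max_{x\in\mathcal N_{\mathfrak h}(z)}\mathcal I_hw(x)-\min_{x\in\mathcal N_{\mathfrak h}(z)}\mathcal I_hw(x)\big)$, $\widetilde{\mathcal N}_{\mathfrak h}(z)=\{z\}\cup\{z'\in\mathcal N_h:\exists v_\theta\in\mathbb S_\theta,\ \hat\varphi_{z'}(z+\varepsilon v_\theta)>0\}$. Assumptions: (RHS.1) $f\in C(\Omega)\cap L^\infty(\Omega)$. (RHS.2) either (RHS.2a) $\sup_\Omega f<0$ or $\inf_\Omega f>0$, or (RHS.2b) $f\equiv0$. (BC.1) $g\in C(\partial\Omega)$. (BC.2) for every $\varepsilon>0$ a function $\tilde g_\varepsilon\in C(\overline\Omega)$ is given such that, if $g\in C^{0,\alpha}(\partial\Omega)$ for some $\alpha\in[0,1]$, then $\tilde g_\varepsilon\in C^{0,\alpha}(\overline\Omega)$ and $\|g-\tilde g_\varepsilon\|_{L^\infty(\partial\Omega)}\le C\varepsilon^\alpha$. (OBS.1) $\chi\in C(\overline\Omega)$, $\chi<g$ on $\partial\Omega$. (M.1) for every nonempty $S\subset\mathcal N_h^I$ there are $z\in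 S$, $z'\in\mathcal N_h\setminus S$ with $z'\in\widetilde{\mathcal N}_{\mathfrak h}(z)$. Discrete obstacle problem: find $u_{\mathfrak h}\in\mathbb V_h$ with $\min\{-\Delta^\diamond_{\infty,\mathfrak h}u_{\mathfrak h}(z)-f(z),\,u_{\mathfrak h}(z)-\chi(z)\}=0$ for $z\in\mathcal N_h^I$ and $u_{\mathfrak h}(z)=\tilde g_\varepsilon(z)$ for $z\in\mathcal N_h^b$ (it has a unique solution). Continuous obstacle problem: with $\Delta^\diamond_\infty\varphi=|D\varphi|^{-2}D\varphi^\intercal D^2\varphi D\varphi$ where $D\varphi\ne0$ and $\Delta^\pm_\infty\varphi(x)$ equal to this if $D\varphi(x)\ne0$ and to $\lambda_{\max}$, resp. $\lambda_{\min}$, of $D^2\varphi(x)$ otherwise, a viscosity solution is $u\in C(\overline\Omega)$ with $u=g$ on $\partial\Omega$ such that for all $x_0\in\Omega$, $\varphi\in C^2$: if $u-\varphi$ has a local max at $x_0$ then $\min\{-\Delta^+_\infty\varphi(x_0)-f(x_0),u(x_0)-\chi(x_0)\}\le0$; if $u-\varphi$ has a local min at $x_0$ then $\min\{-\Delta^-_\infty\varphi(x_0)-f(x_0),u(x_0)-\chi(x_0)\}\ge0$. It exists and is unique under these assumptions.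
   Formalization: (BC.2) is strengthened: the Hölder bounds on g̃_ε are uniform in ε, and all g̃_ε share a modulus of continuity ω on the closure of Ω with |g−g̃_ε| ≤ ω(ε) on ∂Ω; as written, merely continuous g would allow g̃_ε = g+1 and the claim would fail. *)

theory Defs
  imports "HOL-Analysis.Analysis"
begin

definition inner_set :: "(real^'n) set \<Rightarrow> real \<Rightarrow> (real^'n) set" where
  "inner_set \<Omega> r = {x \<in> \<Omega>. infdist x (frontier \<Omega>) > r}"

definition continuous_boundary :: "(real^'n) set \<Rightarrow> bool" where
  "continuous_boundary \<Omega> \<longleftrightarrow>
     (\<forall>x0\<in>frontier \<Omega>. \<exists>e r \<psi>. norm e = 1 \<and> r > 0 \<and>
        continuous_on {y. y \<bullet> e = 0} \<psi> \<and>
        \<Omega> \<inter> ball x0 r = {y \<in> ball x0 r. y \<bullet> e < \<psi> (y - (y \<bullet> e) *\<^sub>R e)})"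

definition bounded_domain_cont_bdry :: "(real^'n) set \<Rightarrow> bool" where
  "bounded_domain_cont_bdry \<Omega> \<longleftrightarrow> open \<Omega> \<and> connected \<Omega> \<and> \<Omega> \<noteq> {} \<and> bounded \<Omega>
     \<and> continuous_boundary \<Omega>"

definition is_mesh :: "(real^'n) set set \<Rightarrow> bool" where
  "is_mesh Th \<longleftrightarrow> finite Th \<and> Th \<noteq> {} \<and>
     (\<forall>T\<in>Th. (int CARD('n)) simplex T) \<and>
     (\<forall>T1\<in>Th. \<forall>T2\<in>Th. (T1 \<inter> T2) face_of T1 \<and> (T1 \<inter> T2) face_of T2)"

definition meshsize :: "(real^'n) set set \<Rightarrow> real" where
  "meshsize Th = Max (diameter ` Th)"

definition mesh_domain :: "(real^'n) set set \<Rightarrow> (real^'n) set" where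
  "mesh_domain Th = interior (\<Union>Th)"

definition nodes :: "(real^'n) set set \<Rightarrow> (real^'n) set" where
  "nodes Th = (\<Union>T\<in>Th. {x. x extreme_point_of T})"

definition Vh :: "(real^'n) set set \<Rightarrow> (real^'n \<Rightarrow> real) set" where
  "Vh Th = {w. continuous_on (\<Union>Th) w \<and>
              (\<forall>T\<in>Th. \<exists>a b. \<forall>x\<in>T. w x = a \<bullet> x + b) \<and>
              (\<forall>x. x \<notin> \<Union>Th \<longrightarrow> w x = 0)}"

definition hat :: "(real^'n) set set \<Rightarrow> real^'n \<Rightarrow> real^'n \<Rightarrow> real" where
  "hat Th z = (THE w. w \<in> Vh Th \<and> (\<forall>z'\<in>nodes Th. w z' = (if z' = z then 1 else 0)))"

definition interp :: "(real^'n) set set \<Rightarrow> (real^'n \<Rightarrow> real) \<Rightarrow> real^'n \<Rightarrow> real" where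
  "interp Th w x = (\<Sum>z\<in>nodes Th. w z * hat Th z x)"

definition interior_nodes :: "(real^'n) set \<Rightarrow> (real^'n) set set \<Rightarrow> real \<Rightarrow> (real^'n) set" where
  "interior_nodes \<Omega> Th \<epsilon> = nodes Th \<inter> inner_set \<Omega> (2 * \<epsilon>)"

definition boundary_nodes :: "(real^'n) set \<Rightarrow> (real^'n) set set \<Rightarrow> real \<Rightarrow> (real^'n) set" where
  "boundary_nodes \<Omega> Th \<epsilon> = nodes Th - interior_nodes \<Omega> Th \<epsilon>"

definition admissible_dirs :: "real \<Rightarrow> (real^'n) set \<Rightarrow> bool" where
  "admissible_dirs \<theta> S \<longleftrightarrow> finite S \<and> S \<subseteq> sphere 0 1 \<and> (\<forall>v\<in>S. - v \<in> S) \<and>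
     (\<forall>v\<in>sphere 0 1. \<exists>w\<in>S. norm (v - w) \<le> \<theta>)"

definition stencil :: "(real^'n) set \<Rightarrow> real \<Rightarrow> real^'n \<Rightarrow> (real^'n) set" where
  "stencil S \<epsilon> z = insert z ((\<lambda>v. z + \<epsilon> *\<^sub>R v) ` S)"

definition minus_disc_inf_lap ::
  "(real^'n) set set \<Rightarrow> (real^'n) set \<Rightarrow> real \<Rightarrow> (real^'n \<Rightarrow> real) \<Rightarrow> real^'n \<Rightarrow> real" where
  "minus_disc_inf_lap Th S \<epsilon> w z =
     (2 * w z - Max (interp Th w ` stencil S \<epsilon> z) - Min (interp Th w ` stencil S \<epsilon> z)) / \<epsilon>^2"

definition ext_stencil :: "(real^'n) set set \<Rightarrow> (real^'n) set \<Rightarrow> real \<Rightarrow> real^'n \<Rightarrow> (real^'n) set" where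
  "ext_stencil Th S \<epsilon> z = insert z {z' \<in> nodes Th. \<exists>v\<in>S. hat Th z' (z + \<epsilon> *\<^sub>R v) > 0}"

definition cond_M1 :: "(real^'n) set \<Rightarrow> (real^'n) set set \<Rightarrow> (real^'n) set \<Rightarrow> real \<Rightarrow> bool" where
  "cond_M1 \<Omega> Th S \<epsilon> \<longleftrightarrow>
     (\<forall>S'. S' \<noteq> {} \<and> S' \<subseteq> interior_nodes \<Omega> Th \<epsilon> \<longrightarrow>
        (\<exists>z\<in>S'. \<exists>z'\<in>nodes Th - S'. z' \<in> ext_stencil Th S \<epsilon> z))"

definition discrete_obstacle_solution ::
  "(real^'n) set \<Rightarrow> (real^'n) set set \<Rightarrow> (real^'n) set \<Rightarrow> real \<Rightarrow>
   (real^'n \<Rightarrow> real) \<Rightarrow> (real^'n \<Rightarrow> real) \<Rightarrow> (real^'n \<Rightarrow> real) \<Rightarrow> (real^'n \<Rightarrow> real) \<Rightarrow> bool" where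
  "discrete_obstacle_solution \<Omega> Th S \<epsilon> f obs gt u \<longleftrightarrow>
     u \<in> Vh Th \<and>
     (\<forall>z\<in>interior_nodes \<Omega> Th \<epsilon>. min (minus_disc_inf_lap Th S \<epsilon> u z - f z) (u z - obs z) = 0) \<and>
     (\<forall>z\<in>boundary_nodes \<Omega> Th \<epsilon>. u z = gt z)"

definition grad :: "(real^'n \<Rightarrow> real) \<Rightarrow> real^'n \<Rightarrow> real^'n" where
  "grad \<phi> x = (\<chi> i. frechet_derivative \<phi> (at x) (axis i 1))"

definition hess :: "(real^'n \<Rightarrow> real) \<Rightarrow> real^'n \<Rightarrow> real^'n^'n" where
  "hess \<phi> x = (\<chi> i j. frechet_derivative (\<lambda>y. frechet_derivative \<phi> (at y) (axis j 1)) (at x) (axis i 1))"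

definition C2 :: "(real^'n \<Rightarrow> real) \<Rightarrow> bool" where
  "C2 \<phi> \<longleftrightarrow> (\<forall>x. \<phi> differentiable (at x)) \<and>
     (\<forall>j x. (\<lambda>y. frechet_derivative \<phi> (at y) (axis j 1)) differentiable (at x)) \<and>
     (\<forall>i j. continuous_on UNIV (\<lambda>x. hess \<phi> x $ i $ j))"

definition eigenvalues :: "real^'n^'n \<Rightarrow> real set" where
  "eigenvalues A = {c. \<exists>v. v \<noteq> 0 \<and> A *v v = c *\<^sub>R v}"

definition inf_lap_plus :: "(real^'n \<Rightarrow> real) \<Rightarrow> real^'n \<Rightarrow> real" where
  "inf_lap_plus \<phi> x =
     (if grad \<phi> x \<noteq> 0 then (grad \<phi> x \<bullet> (hess \<phi> x *v grad \<phi> x)) / (norm (grad \<phi> x))^2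
      else Max (eigenvalues (hess \<phi> x)))"

definition inf_lap_minus :: "(real^'n \<Rightarrow> real) \<Rightarrow> real^'n \<Rightarrow> real" where
  "inf_lap_minus \<phi> x =
     (if grad \<phi> x \<noteq> 0 then (grad \<phi> x \<bullet> (hess \<phi> x *v grad \<phi> x)) / (norm (grad \<phi> x))^2
      else Min (eigenvalues (hess \<phi> x)))"

definition viscosity_obstacle_solution ::
  "(real^'n) set \<Rightarrow> (real^'n \<Rightarrow> real) \<Rightarrow> (real^'n \<Rightarrow> real) \<Rightarrow> (real^'n \<Rightarrow> real) \<Rightarrow> (real^'n \<Rightarrow> real) \<Rightarrow> bool" where
  "viscosity_obstacle_solution \<Omega> f obs g u \<longleftrightarrow>
     continuous_on (closure \<Omega>) u \<and> (\<forall>x\<in>frontier \<Omega>. u x = g x) \<and>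
     (\<forall>x0\<in>\<Omega>. \<forall>\<phi>. C2 \<phi> \<longrightarrow>
        ((\<exists>r>0. \<forall>y\<in>\<Omega> \<inter> ball x0 r. u y - \<phi> y \<le> u x0 - \<phi> x0) \<longrightarrow>
            min (- inf_lap_plus \<phi> x0 - f x0) (u x0 - obs x0) \<le> 0) \<and>
        ((\<exists>r>0. \<forall>y\<in>\<Omega> \<inter> ball x0 r. u y - \<phi> y \<ge> u x0 - \<phi> x0) \<longrightarrow>
            min (- inf_lap_minus \<phi> x0 - f x0) (u x0 - obs x0) \<ge> 0))"

definition holder_on :: "real \<Rightarrow> real \<Rightarrow> (real^'n) set \<Rightarrow> (real^'n \<Rightarrow> real) \<Rightarrow> bool" where
  "holder_on \<alpha> C S w \<longleftrightarrow> (\<forall>x\<in>S. \<forall>y\<in>S. \<bar>w x - w y\<bar> \<le> C * dist x y powr \<alpha>)"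

definition cond_BC2 :: "(real^'n) set \<Rightarrow> (real^'n \<Rightarrow> real) \<Rightarrow> (real \<Rightarrow> real^'n \<Rightarrow> real) \<Rightarrow> bool" where
  "cond_BC2 \<Omega> g gt \<longleftrightarrow>
     (\<forall>\<epsilon>>0. continuous_on (closure \<Omega>) (gt \<epsilon>)) \<and>
     (\<forall>\<alpha>\<in>{0..1}. (\<exists>C. holder_on \<alpha> C (frontier \<Omega>) g) \<longrightarrow>
        (\<exists>C. \<forall>\<epsilon>>0. holder_on \<alpha> C (closure \<Omega>) (gt \<epsilon>) \<and>
                   (\<forall>x\<in>frontier \<Omega>. \<bar>g x - gt \<epsilon> x\<bar> \<le> C * \<epsilon> powr \<alpha>))) \<and>
     (\<exists>\<omega>::real \<Rightarrow> real. (\<omega> \<longlongrightarrow> 0) (at_right 0) \<and>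
        (\<forall>\<epsilon>>0. (\<forall>x\<in>closure \<Omega>. \<forall>y\<in>closure \<Omega>. \<bar>gt \<epsilon> x - gt \<epsilon> y\<bar> \<le> \<omega> (dist x y)) \<and>
                (\<forall>x\<in>frontier \<Omega>. \<bar>g x - gt \<epsilon> x\<bar> \<le> \<omega> \<epsilon>)))"

end

theory Submission
  imports Defs
begin

text \<open>
  The argument follows Barles and Souganidis. The upper relaxed limit \<open>u\<close> of the discrete solutions and
  the upper relaxed limit \<open>w\<close> of their negatives are upper semicontinuous viscosity subsolutions for
  the right-hand sides \<open>f\<close> (off the contact set) and \<open>- f\<close>. Since the scheme is monotone and exact up
  to \<open>O(h\<^sup>2)\<close> on quadratic polynomials, it suffices to touch by quadratics. Strict discrete
  supersolutions of the form \<open>c + A |x - x0|^(1/2)\<close> with \<open>x0\<close> on the boundary give \<open>u \<le> g\<close> and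
  \<open>w \<le> - g\<close> there.

  What remains is the comparison \<open>u + w \<le> 0\<close>, because it forces \<open>u = - w\<close> to be continuous and all
  limit points of the scheme to lie on its graph. As in Armstrong and Smart, comparison with radial
  quadratics turns the viscosity inequality into a finite difference inequality for the maxima of
  a subsolution over small balls. One then maximises \<open>u y + w y'\<close> over \<open>dist y y' \<le> 2 * s\<close>; adding the
  two finite difference inequalities at a maximising pair leads to a contradiction, after \<open>w\<close> has
  been multiplied by a constant near 1 if \<open>f\<close> has a sign.
\<close>

section \<open>Simplicial meshes and nodal interpolation\<close>

text \<open>The comparison has to cope with functions that are merely semicontinuous and with an
  operator that is discontinuous where the gradient vanishes. Radial quadratics
  \<open>\<beta> + \<alpha> * r - \<gamma> * r^2 / 2\<close> meet both difficulties: on them the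
  operator is the constant \<gamma>, their gradient is nonzero between centre and rim, and the value
  at the centre is prescribed instead of derived. The comparison can therefore live with weak
  information at critical points; the full inequality there is recovered only for the finished
  limit. The obstacle enters asymmetrically: the discrete solutions are subsolutions off the contact
  set, their negatives are subsolutions everywhere, and for the latter the obstacle survives only as
  the bound \<open>w x \<le> - ob x\<close>. The two ratios have separate tasks:
  \<open>h / \<epsilon>\<close> makes interpolation errors of order h^2 negligible against second
  differences of order \<epsilon>^2, and \<open>\<theta> / \<epsilon>\<close> does the same for the
  error \<epsilon> \<theta> made by the best available direction in the barrier. No viscosity
  solution is presupposed: it is produced as the limit.\<close>

lemma affine_on_convex_combination:
  fixes a :: "'a::real_inner"
  assumes "sum \<mu> C = 1"
  shows "a \<bullet> (\<Sum>v\<in>C. \<mu> v *\<^sub>R v) + b = (\<Sum>v\<in>C. \<mu> v * (a \<bullet> v + b))"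
  using assms by (simp add: inner_sum_right distrib_left sum.distrib flip: sum_distrib_right)

lemma affine_eq_on_convex_hull:
  fixes a :: "'a::real_inner"
  assumes "finite C" "\<And>v. v \<in> C \<Longrightarrow> a \<bullet> v + b = a' \<bullet> v + b'" "x \<in> convex hull C"
  shows "a \<bullet> x + b = a' \<bullet> x + b'"
proof -
  obtain \<mu> where \<mu>: "sum \<mu> C = 1" "(\<Sum>v\<in>C. \<mu> v *\<^sub>R v) = x"
    using assms(3) unfolding convex_hull_finite[OF assms(1)] by blast
  have "a \<bullet> x + b = (\<Sum>v\<in>C. \<mu> v * (a \<bullet> v + b))"
    unfolding \<mu>(2)[symmetric] using \<mu>(1) by (rule affine_on_convex_combination)
  also have "\<dots> = (\<Sum>v\<in>C. \<mu> v * (a' \<bullet> v + b'))" using assms(2) by (intro sum.cong) auto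
  also have "\<dots> = a' \<bullet> x + b'"
    unfolding \<mu>(2)[symmetric] using \<mu>(1) by (rule affine_on_convex_combination[symmetric])
  finally show ?thesis .
qed

lemma affine_interpolation:
  fixes C :: "'a::euclidean_space set"
  assumes "\<not> affine_dependent C"
  shows "\<exists>a b. \<forall>v\<in>C. a \<bullet> v + b = \<phi> v"
proof (cases "C = {}")
  case False
  then obtain v0 where v0: "v0 \<in> C" by blast
  then have "independent ((\<lambda>x. - v0 + x) ` (C - {v0}))"
    using assms affine_dependent_iff_dependent2 by blast
  from linear_independent_extend[OF this, of "\<lambda>y. \<phi> (v0 + y) - \<phi> v0"]
  obtain g :: "'a \<Rightarrow> real" where g: "linear g" "\<forall>x\<in>(\<lambda>x. - v0 + x) ` (C - {v0}). g x = \<phi> (v0 + x) - \<phi> v0"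
    by blast
  \<comment> \<open>\<open>adjoint g 1\<close> is the vector that represents the functional
    \<open>g\<close>.\<close>
  have ga: "adjoint g 1 \<bullet> x = g x" for x
    using adjoint_works[OF g(1), of x 1] by (simp add: inner_commute)
  have "adjoint g 1 \<bullet> v + (\<phi> v0 - g v0) = \<phi> v" if "v \<in> C" for v
  proof (cases "v = v0")
    case False
    then have "g (- v0 + v) = \<phi> v - \<phi> v0" using g(2) that by auto
    then show ?thesis by (simp add: ga linear_diff[OF g(1)])
  qed (simp add: ga)
  then show ?thesis by blast
qed simp

definition vertices :: "'a::euclidean_space set \<Rightarrow> 'a set" where
  "vertices T = {x. x extreme_point_of T}"

lemma mesh_simplex:
  fixes T :: "(real^'n) set"
  assumes "is_mesh Th" "T \<in> Th"
  shows "\<not> affine_dependent (vertices T)" "finite (vertices T)" "T = convex hull vertices T"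
    "card (vertices T) = CARD('n) + 1" "compact T" "convex T" "interior T \<noteq> {}"
proof -
  have sx: "(int CARD('n)) simplex T" using assms by (auto simp: is_mesh_def)
  then obtain C where C: "\<not> affine_dependent C" "int (card C) = int CARD('n) + 1" "T = convex hull C"
    unfolding simplex_def by blast
  have "vertices T = C" unfolding vertices_def C(3)
    using extreme_point_of_convex_hull_affine_independent[OF C(1)] by blast
  then show ai: "\<not> affine_dependent (vertices T)" and "finite (vertices T)" 
    and T: "T = convex hull vertices T" and card: "card (vertices T) = CARD('n) + 1"
    using C by (auto simp: aff_independent_finite)
  show "compact T" "convex T" using sx compact_simplex convex_simplex by auto
  show "interior T \<noteq> {}"
    using interior_convex_hull_eq_empty[of "vertices T"] card ai T by simp
qed

lemma nodes_eq: "nodes Th = (\<Union>T\<in>Th. vertices T)"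
  by (simp add: nodes_def vertices_def)

lemma finite_nodes: "is_mesh Th \<Longrightarrow> finite (nodes Th)"
  unfolding nodes_eq using mesh_simplex(2) by (auto simp: is_mesh_def)

lemma vertices_subset: "vertices T \<subseteq> T"
  by (auto simp: vertices_def extreme_point_of_def)

text \<open>The barycentric coordinate of the vertex \<open>z\<close>, extended affinely to the
  whole space; if \<open>z\<close> is not a vertex of \<open>T\<close>, it vanishes at all
  vertices.\<close>

definition vertex_fun :: "'a::euclidean_space \<Rightarrow> 'a set \<Rightarrow> 'a \<Rightarrow> real" where
  "vertex_fun z T = (SOME h. \<exists>a b. (\<forall>x. h x = a \<bullet> x + b) \<and> (\<forall>v\<in>vertices T. h v = (if v = z then 1 else 0)))"

lemma vertex_fun:
  assumes "is_mesh Th" "T \<in> Th"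
  shows "\<exists>a b. (\<forall>x. vertex_fun z T x = a \<bullet> x + b) \<and> (\<forall>v\<in>vertices T. vertex_fun z T v = (if v = z then 1 else 0))"
proof -
  obtain a b where "\<forall>v\<in>vertices T. a \<bullet> v + b = (if v = z then 1 else 0)"
    using affine_interpolation[OF mesh_simplex(1)[OF assms], of "\<lambda>v. if v = z then 1 else 0"] by blast
  then have "\<exists>h a b. (\<forall>x. h x = a \<bullet> x + b) \<and> (\<forall>v\<in>vertices T. h v = (if v = z then 1 else (0::real)))"
    by (intro exI[of _ "\<lambda>x. a \<bullet> x + b"] exI[of _ a] exI[of _ b]) simp
  then show ?thesis unfolding vertex_fun_def by (rule someI_ex)
qed

text \<open>Conformity of the mesh: the intersection is a face of both simplices, hence the hull of
  vertices common to both, and there the two affine functions have the same values.\<close>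

lemma vertex_fun_agree:
  assumes m: "is_mesh Th" and T: "T1 \<in> Th" "T2 \<in> Th" and x: "x \<in> T1" "x \<in> T2"
  shows "vertex_fun z T1 x = vertex_fun z T2 x"
proof -
  have f: "(T1 \<inter> T2) face_of T1" "(T1 \<inter> T2) face_of T2" using m T by (auto simp: is_mesh_def)
  have "(T1 \<inter> T2) face_of (convex hull vertices T1)"
    using f(1) mesh_simplex(3)[OF m T(1)] by simp
  then obtain c where c: "c \<subseteq> vertices T1" "T1 \<inter> T2 = convex hull c"
    using face_of_convex_hull_affine_independent[OF mesh_simplex(1)[OF m T(1)]] by blast
  have ci: "\<not> affine_dependent c"
    using affine_independent_subset[OF mesh_simplex(1)[OF m T(1)] c(1)] .
  have c2: "c \<subseteq> vertices T2"
  proof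
    fix v assume "v \<in> c"
    then have "v extreme_point_of (T1 \<inter> T2)"
      unfolding c(2) using extreme_point_of_convex_hull_affine_independent[OF ci] by blast
    then show "v \<in> vertices T2" unfolding vertices_def using extreme_point_of_face[OF f(2)] by blast
  qed
  obtain a b where a: "\<And>x. vertex_fun z T1 x = a \<bullet> x + b"
     "\<And>v. v \<in> vertices T1 \<Longrightarrow> vertex_fun z T1 v = (if v = z then 1 else 0)"
    using vertex_fun[OF m T(1), of z] by blast
  obtain a' b' where a': "\<And>x. vertex_fun z T2 x = a' \<bullet> x + b'"
     "\<And>v. v \<in> vertices T2 \<Longrightarrow> vertex_fun z T2 v = (if v = z then 1 else 0)"
    using vertex_fun[OF m T(2), of z] by blast
  have "a \<bullet> x + b = a' \<bullet> x + b'"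
  proof (rule affine_eq_on_convex_hull)
    show "finite c" using ci by (rule aff_independent_finite)
    show "x \<in> convex hull c" using x c(2) by blast
    show "a \<bullet> v + b = a' \<bullet> v + b'" if "v \<in> c" for v
      using a(1,2)[of v] a'(1,2)[of v] that c(1) c2 by (auto simp: subset_iff)
  qed
  then show ?thesis using a(1) a'(1) by simp
qed

text \<open>Equality as functions on the whole space is what the description operator in
  \<open>hat\<close> asks for; off the mesh it rests on the convention that members of
  \<open>Vh\<close> are 0 there.\<close>

lemma Vh_unique:
  assumes m: "is_mesh Th" and w: "w1 \<in> Vh Th" "w2 \<in> Vh Th" and eq: "\<And>z. z \<in> nodes Th \<Longrightarrow> w1 z = w2 z"
  shows "w1 = w2"
proof
  fix x
  show "w1 x = w2 x"
  proof (cases "x \<in> \<Union>Th")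
    case True
    then obtain T where T: "T \<in> Th" "x \<in> T" by blast
    obtain a b where a: "\<And>x. x \<in> T \<Longrightarrow> w1 x = a \<bullet> x + b" using w(1) T(1) unfolding Vh_def by blast
    obtain a' b' where a': "\<And>x. x \<in> T \<Longrightarrow> w2 x = a' \<bullet> x + b'" using w(2) T(1) unfolding Vh_def by blast
    have "a \<bullet> x + b = a' \<bullet> x + b'"
    proof (rule affine_eq_on_convex_hull[OF mesh_simplex(2)[OF m T(1)]])
      show "x \<in> convex hull vertices T" using T(2) mesh_simplex(3)[OF m T(1)] by simp
      show "a \<bullet> v + b = a' \<bullet> v + b'" if "v \<in> vertices T" for v
      proof -
        have "v \<in> T" "v \<in> nodes Th" using that vertices_subset[of T] T(1) by (auto simp: nodes_eq)
        then show ?thesis using a[of v] a'[of v] eq[of v] by simp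
      qed
    qed
    then show ?thesis using a a' T(2) by simp
  next
    case False
    then show ?thesis using w by (simp add: Vh_def)
  qed
qed

text \<open>Existence is obtained by gluing the functions \<open>vertex_fun z T\<close>: they agree
  on overlaps, and the simplices form a finite closed cover, which gives continuity.\<close>

lemma hat_props:
  assumes m: "is_mesh Th" and z: "z \<in> nodes Th"
  shows "hat Th z \<in> Vh Th" "\<And>z'. z' \<in> nodes Th \<Longrightarrow> hat Th z z' = (if z' = z then 1 else 0)"
proof -
  define h where "h x = (if x \<in> \<Union>Th then vertex_fun z (SOME T. T \<in> Th \<and> x \<in> T) x else 0)" for x
  have hT: "h x = vertex_fun z T x" if "T \<in> Th" "x \<in> T" for T x
  proof -
    define T' where "T' = (SOME T. T \<in> Th \<and> x \<in> T)"
    have "T' \<in> Th \<and> x \<in> T'"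
      unfolding T'_def by (rule someI[of _ T]) (use that in simp)
    then have "vertex_fun z T' x = vertex_fun z T x"
      using vertex_fun_agree[OF m] that by blast
    moreover have "x \<in> \<Union>Th" using that by blast
    ultimately show ?thesis by (simp add: h_def T'_def)
  qed
  have aff: "\<exists>a b. \<forall>x\<in>T. h x = a \<bullet> x + b" if T: "T \<in> Th" for T
    using vertex_fun[OF m T, of z] hT[OF T] by metis
  have cont: "continuous_on (\<Union>T\<in>Th. T) h"
  proof (rule continuous_on_closed_Union)
    show "finite Th" using m by (simp add: is_mesh_def)
    fix T assume T: "T \<in> Th"
    show "closed T" using mesh_simplex(5)[OF m T] compact_imp_closed by blast
    obtain a b where "\<And>x. x \<in> T \<Longrightarrow> h x = a \<bullet> x + b" using aff[OF T] by blast
    then show "continuous_on T h"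
      by (auto simp: continuous_on_cong[of T T h "\<lambda>x. a \<bullet> x + b"] intro!: continuous_intros)
  qed
  have "h \<in> Vh Th" using cont aff by (auto simp: Vh_def h_def)
  moreover have "h z' = (if z' = z then 1 else 0)" if z': "z' \<in> nodes Th" for z'
  proof -
    obtain T where T: "T \<in> Th" "z' \<in> vertices T" using z' by (auto simp: nodes_eq)
    then show ?thesis using hT[of T z'] vertex_fun[OF m T(1), of z] vertices_subset by fastforce
  qed
  ultimately have ex: "h \<in> Vh Th \<and> (\<forall>z'\<in>nodes Th. h z' = (if z' = z then 1 else 0))" by blast
  have "hat Th z \<in> Vh Th \<and> (\<forall>z'\<in>nodes Th. hat Th z z' = (if z' = z then 1 else 0))"
    unfolding hat_def
  proof (rule theI[where a = h])
    show "h \<in> Vh Th \<and> (\<forall>z'\<in>nodes Th. h z' = (if z' = z then 1 else 0))" by (rule ex)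
    fix w assume "w \<in> Vh Th \<and> (\<forall>z'\<in>nodes Th. w z' = (if z' = z then 1 else 0))"
    then show "w = h" using ex by (intro Vh_unique[OF m]) auto
  qed
  then show "hat Th z \<in> Vh Th" "\<And>z'. z' \<in> nodes Th \<Longrightarrow> hat Th z z' = (if z' = z then 1 else 0)" by auto
qed

text \<open>The barycentric coordinates of \<open>x\<close> in one simplex serve as weights for all
  nodal functions at once. Interpolation is thus an average over nodes within one mesh size, and the
  later monotonicity and error estimates argue with these weights instead of hat functions.\<close>

lemma interp_representation:
  assumes m: "is_mesh Th" and x: "x \<in> \<Union>Th"
  obtains \<mu> where "\<And>v. v \<in> nodes Th \<Longrightarrow> 0 \<le> \<mu> v"
    "\<And>v. v \<in> nodes Th \<Longrightarrow> \<mu> v \<noteq> 0 \<Longrightarrow> dist x v \<le> meshsize Th"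
    "sum \<mu> (nodes Th) = 1" "(\<Sum>v\<in>nodes Th. \<mu> v *\<^sub>R v) = x"
    "\<And>w. interp Th w x = (\<Sum>v\<in>nodes Th. \<mu> v * w v)"
    "\<And>w. w \<in> Vh Th \<Longrightarrow> w x = (\<Sum>v\<in>nodes Th. \<mu> v * w v)"
proof -
  obtain T where T: "T \<in> Th" "x \<in> T" using x by blast
  have fin: "finite (vertices T)" "finite (nodes Th)" using mesh_simplex(2)[OF m T(1)] finite_nodes[OF m] by auto
  have sub: "vertices T \<subseteq> nodes Th" using T by (auto simp: nodes_eq)
  have "x \<in> convex hull vertices T" using T(2) mesh_simplex(3)[OF m T(1)] by simp
  then obtain \<nu> where \<nu>: "\<And>v. v \<in> vertices T \<Longrightarrow> 0 \<le> \<nu> v" "sum \<nu> (vertices T) = 1"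
     "(\<Sum>v\<in>vertices T. \<nu> v *\<^sub>R v) = x"
    unfolding convex_hull_finite[OF fin(1)] by blast
  define \<mu> where "\<mu> v = (if v \<in> vertices T then \<nu> v else 0)" for v
  have red: "(\<Sum>v\<in>nodes Th. \<mu> v * w v) = (\<Sum>v\<in>vertices T. \<nu> v * w v)" for w :: "_ \<Rightarrow> real"
    by (rule sum.mono_neutral_cong_right) (use fin sub in \<open>auto simp: \<mu>_def\<close>)
  have Vh: "w x = (\<Sum>v\<in>nodes Th. \<mu> v * w v)" if w: "w \<in> Vh Th" for w
  proof -
    obtain a b where a: "\<And>x. x \<in> T \<Longrightarrow> w x = a \<bullet> x + b" using w T(1) unfolding Vh_def by blast
    have "w x = a \<bullet> x + b" using a T by blast
    also have "\<dots> = (\<Sum>v\<in>vertices T. \<nu> v * (a \<bullet> v + b))"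
      unfolding \<nu>(3)[symmetric] using \<nu>(2) by (rule affine_on_convex_combination)
    also have "\<dots> = (\<Sum>v\<in>vertices T. \<nu> v * w v)" using a vertices_subset[of T] by (intro sum.cong) (auto simp: subset_iff)
    finally show ?thesis by (simp add: red)
  qed
  have hat: "hat Th z x = \<mu> z" if z: "z \<in> nodes Th" for z
  proof -
    have "hat Th z x = (\<Sum>v\<in>nodes Th. \<mu> v * hat Th z v)" by (rule Vh[OF hat_props(1)[OF m z]])
    also have "\<dots> = (\<Sum>v\<in>nodes Th. if v = z then \<mu> v else 0)"
      by (intro sum.cong) (auto simp: hat_props(2)[OF m z])
    also have "\<dots> = \<mu> z" using z fin by simp
    finally show ?thesis .
  qed
  show thesis
  proof (rule that[of \<mu>])
    show "0 \<le> \<mu> v" for v using \<nu>(1) by (simp add: \<mu>_def)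
    show "dist x v \<le> meshsize Th" if "\<mu> v \<noteq> 0" for v
    proof -
      have "v \<in> T" using that vertices_subset[of T] by (auto simp: \<mu>_def split: if_splits)
      then have "dist x v \<le> diameter T"
        using diameter_bounded_bound[of T x v] T(2) compact_imp_bounded[OF mesh_simplex(5)[OF m T(1)]] by blast
      also have "\<dots> \<le> meshsize Th" using T(1) m unfolding meshsize_def is_mesh_def by (intro Max_ge) auto
      finally show ?thesis .
    qed
    show "sum \<mu> (nodes Th) = 1" using red[of "\<lambda>_. 1"] \<nu>(2) by simp
    show "(\<Sum>v\<in>nodes Th. \<mu> v *\<^sub>R v) = x" unfolding \<nu>(3)[symmetric]
      by (rule sum.mono_neutral_cong_right) (use fin sub in \<open>auto simp: \<mu>_def\<close>)
    show "interp Th w x = (\<Sum>v\<in>nodes Th. \<mu> v * w v)" for w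
      unfolding interp_def by (intro sum.cong) (auto simp: hat)
  qed (rule Vh)
qed

lemma meshsize_pos:
  assumes "is_mesh (Th :: (real^'n) set set)"
  shows "meshsize Th > 0"
proof -
  obtain T where T: "T \<in> Th" using assms by (auto simp: is_mesh_def)
  obtain x e where e: "e > 0" "ball x e \<subseteq> T" using mesh_simplex(7)[OF assms T] by (auto simp: mem_interior)
  obtain y :: "real^'n" where y: "dist x y = e / 2"
    using vector_choose_dist[of "e / 2" x] e by auto
  have "e / 2 \<le> diameter T"
    using diameter_bounded_bound[of T x y] e y compact_imp_bounded[OF mesh_simplex(5)[OF assms T]] by force
  also have "\<dots> \<le> meshsize Th" using T assms unfolding meshsize_def is_mesh_def by (intro Max_ge) auto
  finally show ?thesis using e by simp
qed

text \<open>Only the interior of the union is known to lie in \<Omega>, but each simplex is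
  contained in the closure of its own interior.\<close>

lemma mesh_subset_closure:
  assumes m: "is_mesh Th" and dom: "mesh_domain Th \<subseteq> \<Omega>"
  shows "\<Union>Th \<subseteq> closure \<Omega>"
proof
  fix x assume "x \<in> \<Union>Th"
  then obtain T where T: "T \<in> Th" "x \<in> T" by blast
  have "closure (interior T) = closure T"
    by (rule convex_closure_interior[OF mesh_simplex(6,7)[OF m T(1)]])
  then have "x \<in> closure (interior T)" using T(2) closure_subset by blast
  moreover have "interior T \<subseteq> \<Omega>" using dom T(1) interior_mono[of T "\<Union>Th"] unfolding mesh_domain_def by blast
  ultimately show "x \<in> closure \<Omega>" using closure_mono by blast
qed

lemma nodes_subset: "nodes Th \<subseteq> \<Union>Th"
  unfolding nodes_eq using vertices_subset by blast

section \<open>Viscosity subsolutions and comparison\<close>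

definition usc_on :: "'a::topological_space set \<Rightarrow> ('a \<Rightarrow> real) \<Rightarrow> bool" where
  "usc_on K u \<longleftrightarrow> (\<forall>x\<in>K. \<forall>a>u x. \<forall>\<^sub>F y in at x within K. u y < a)"

lemma usc_on_subset: "usc_on K u \<Longrightarrow> L \<subseteq> K \<Longrightarrow> usc_on L u"
  unfolding usc_on_def by (auto intro: filter_leD[OF at_le])

lemma continuous_on_imp_usc_on: "continuous_on K u \<Longrightarrow> usc_on K u"
  unfolding usc_on_def continuous_on_def using order_tendstoD(2) by blast

lemma usc_on_add:
  assumes "usc_on K u" "usc_on K v"
  shows "usc_on K (\<lambda>x. u x + v x)"
  unfolding usc_on_def
proof (intro ballI allI impI)
  fix x a assume x: "x \<in> K" and a: "u x + v x < a"
  define e where "e = (a - (u x + v x)) / 2"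
  have "e > 0" using a by (simp add: e_def)
  have "\<forall>\<^sub>F y in at x within K. u y < u x + e" "\<forall>\<^sub>F y in at x within K. v y < v x + e"
    using assms x \<open>e > 0\<close> unfolding usc_on_def by auto
  then show "\<forall>\<^sub>F y in at x within K. u y + v y < a"
    by eventually_elim (simp add: e_def field_simps)
qed

lemma usc_on_compose:
  assumes u: "usc_on K u" and c: "continuous_on L h" and im: "h ` L \<subseteq> K"
  shows "usc_on L (\<lambda>x. u (h x))"
  unfolding usc_on_def
proof (intro ballI allI impI)
  fix x a assume x: "x \<in> L" and a: "u (h x) < a"
  have "\<forall>\<^sub>F y in at (h x) within K. u y < a"
    using u a im x unfolding usc_on_def by blast
  then obtain S where S: "open S" "h x \<in> S" "\<And>y. y \<in> S \<Longrightarrow> y \<noteq> h x \<Longrightarrow> y \<in> K \<Longrightarrow> u y < a"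
    unfolding eventually_at_topological by auto
  have "\<forall>\<^sub>F y in at x within L. h y \<in> S"
    using c x S(1,2) unfolding continuous_on_def using topological_tendstoD by blast
  moreover have "\<forall>\<^sub>F y in at x within L. y \<in> L"
    by (auto simp: eventually_at_topological)
  ultimately show "\<forall>\<^sub>F y in at x within L. u (h y) < a"
  proof eventually_elim
    case (elim y)
    then show ?case using S(3)[of "h y"] a im by (cases "h y = h x") auto
  qed
qed

lemma usc_on_sequentially:
  assumes u: "usc_on K u" and x: "x \<in> K" and K: "\<And>n. y n \<in> K" and lim: "y \<longlonglongrightarrow> x" and a: "u x < a"
  shows "\<forall>\<^sub>F n in sequentially. u (y n) < a"
proof -
  have "\<forall>\<^sub>F y in at x within K. u y < a"
    using u a x unfolding usc_on_def by blast
  then obtain S where S: "open S" "x \<in> S" "\<And>y. y \<in> S \<Longrightarrow> y \<noteq> x \<Longrightarrow> y \<in> K \<Longrightarrow> u y < a"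
    unfolding eventually_at_topological by auto
  have "\<forall>\<^sub>F n in sequentially. y n \<in> S"
    using topological_tendstoD[OF lim S(1,2)] .
  then show ?thesis
  proof eventually_elim
    case (elim n)
    then show ?case using S(3)[of "y n"] a K[of n] by (cases "y n = x") auto
  qed
qed

lemma usc_on_openin_less:
  assumes "usc_on K u"
  shows "openin (top_of_set K) {x \<in> K. u x < a}"
proof (subst openin_subopen, intro ballI)
  fix x assume "x \<in> {x \<in> K. u x < a}"
  then have x: "x \<in> K" "u x < a" by auto
  have "\<forall>\<^sub>F y in at x within K. u y < a"
    using assms x unfolding usc_on_def by blast
  then obtain S where "open S" "x \<in> S" "\<And>y. y \<in> S \<Longrightarrow> y \<noteq> x \<Longrightarrow> y \<in> K \<Longrightarrow> u y < a"
    unfolding eventually_at_topological by auto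
  then show "\<exists>T. openin (top_of_set K) T \<and> x \<in> T \<and> T \<subseteq> {x \<in> K. u x < a}"
    using x by (intro exI[of _ "K \<inter> S"]) (auto simp: openin_open)
qed

text \<open>If no maximum existed, the relatively open sets where \<open>u\<close> lies below
  \<open>u y\<close> would cover \<open>K\<close>; in a finite subcover the \<open>y\<close> with
  the largest value is left uncovered.\<close>

lemma usc_on_attains_sup:
  assumes u: "usc_on K u" and K: "compact K" "K \<noteq> {}"
  obtains x where "x \<in> K" "\<And>y. y \<in> K \<Longrightarrow> u y \<le> u x"
proof (rule ccontr)
  assume "\<not> thesis"
  then have cov: "\<exists>y\<in>K. u x < u y" if "x \<in> K" for x
    using that \<open>\<And>x. x \<in> K \<Longrightarrow> (\<And>y. y \<in> K \<Longrightarrow> u y \<le> u x) \<Longrightarrow> thesis\<close> by force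
  let ?C = "(\<lambda>y. {x \<in> K. u x < u y}) ` K"
  have "\<forall>c\<in>?C. openin (top_of_set K) c" using usc_on_openin_less[OF u] by auto
  moreover have "K \<subseteq> \<Union>?C" using cov by auto
  ultimately obtain D where D: "D \<subseteq> ?C" "finite D" "K \<subseteq> \<Union>D"
    using K(1)[unfolded compact_eq_openin_cover, rule_format, of ?C] by blast
  obtain F where F: "finite F" "F \<subseteq> K" "D = (\<lambda>y. {x \<in> K. u x < u y}) ` F"
    using finite_subset_image[OF D(2,1)] by blast
  have "F \<noteq> {}" using D(3) F(3) K(2) by auto
  then have "Max (u ` F) \<in> u ` F" using F(1) by (intro Max_in) auto
  then obtain y where y: "y \<in> F" "u y = Max (u ` F)" by auto
  have ymax: "u z \<le> u y" if "z \<in> F" for z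
    unfolding y(2) using F(1) that by (intro Max_ge) auto
  have "y \<in> \<Union>D" using y(1) F(2) D(3) by auto
  then show False using ymax F(3) by fastforce
qed

lemma usc_on_compact_ge:
  assumes u: "usc_on K u" and K: "compact K"
  shows "compact {x \<in> K. a \<le> u x}"
proof -
  have "{x \<in> K. a \<le> u x} = K - {x \<in> K. u x < a}" by auto
  then have "closedin (top_of_set K) {x \<in> K. a \<le> u x}"
    using usc_on_openin_less[OF u] by (simp add: closedin_diff)
  then show ?thesis using K closedin_compact by blast
qed

text \<open>
  For \<open>p \<noteq> 0\<close> the vector \<open>w\<close> is the direction of \<open>p\<close>, as in the normalised infinity Laplacian. For
  \<open>p = 0\<close> the vector \<open>w = 0\<close> is allowed, which makes this weaker than the inequality with the largest
  eigenvalue of \<open>H\<close>: the discrete operator only yields this much at critical points, because its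
  stencil contains the centre.
\<close>

definition visc_sub :: "('a::euclidean_space \<Rightarrow> real) \<Rightarrow> 'a \<Rightarrow> real \<Rightarrow> bool" where
  "visc_sub u x c \<longleftrightarrow> (\<forall>p H. linear H \<longrightarrow>
     (\<exists>r>0. \<forall>y\<in>ball x r. u y \<le> u x + p \<bullet> (y - x) + (y - x) \<bullet> H (y - x) / 2) \<longrightarrow>
     (\<exists>w. norm w \<le> 1 \<and> p = norm p *\<^sub>R w \<and> - (w \<bullet> H w) \<le> c))"

lemma visc_sub_mono: "visc_sub u x c \<Longrightarrow> c \<le> d \<Longrightarrow> visc_sub u x d"
  unfolding visc_sub_def by (meson order_trans)

lemma visc_sub_scale:
  assumes u: "visc_sub u x c" and l: "l > 0"
  shows "visc_sub (\<lambda>y. l * u y) x (l * c)"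
  unfolding visc_sub_def
proof (intro allI impI)
  fix p H assume H: "linear H"
    and ex: "\<exists>r>0. \<forall>y\<in>ball x r. l * u y \<le> l * u x + p \<bullet> (y - x) + (y - x) \<bullet> H (y - x) / 2"
  then obtain r where r: "r > 0" "\<And>y. y \<in> ball x r \<Longrightarrow> l * u y \<le> l * u x + p \<bullet> (y - x) + (y - x) \<bullet> H (y - x) / 2"
    by blast
  define p' where "p' = (1/l) *\<^sub>R p"
  define H' where "H' = (\<lambda>v. (1/l) *\<^sub>R H v)"
  have "linear H'" unfolding H'_def using H by (rule linear_compose_scale_right)
  moreover have "u y \<le> u x + p' \<bullet> (y - x) + (y - x) \<bullet> H' (y - x) / 2" if "y \<in> ball x r" for y
  proof -
    have "u y \<le> (l * u x + p \<bullet> (y - x) + (y - x) \<bullet> H (y - x) / 2) / l"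
      using r(2)[OF that] l by (simp add: field_simps)
    then show ?thesis using l by (simp add: p'_def H'_def add_divide_distrib)
  qed
  ultimately obtain w where w: "norm w \<le> 1" "p' = norm p' *\<^sub>R w" "- (w \<bullet> H' w) \<le> c"
    using u r(1) unfolding visc_sub_def by blast
  have "p = norm p *\<^sub>R w"
  proof -
    have "p = l *\<^sub>R p'" using l by (simp add: p'_def)
    also have "\<dots> = l *\<^sub>R (norm p' *\<^sub>R w)" using w(2) by simp
    also have "\<dots> = norm p *\<^sub>R w" using l by (simp add: p'_def)
    finally show ?thesis .
  qed
  moreover have "- (w \<bullet> H w) \<le> l * c"
    using w(3) l by (simp add: H'_def field_simps)
  ultimately show "\<exists>w. norm w \<le> 1 \<and> p = norm p *\<^sub>R w \<and> - (w \<bullet> H w) \<le> l * c"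
    using w(1) by blast
qed

section \<open>Comparison with radial quadratics\<close>

text \<open>A maximum point of \<open>u\<close> minus the quadratic with positive value is neither
  the centre nor on the rim. There the quadratic has a nonzero radial gradient, so the only
  admissible direction is the radial one, and it yields \<open>\<gamma> \<le> c\<close>. The
  viscosity inequality is available only where \<open>k \<le> u\<close>; this holds at that point
  because the quadratic stays above \<open>\<beta>\<close>, which is at least
  \<open>k\<close>.\<close>

lemma radial_quadratic_comparison:
  fixes u :: "'a::euclidean_space \<Rightarrow> real"
  assumes usc: "usc_on (cball x0 R) u" and R: "R > 0" and c: "c < \<gamma>"
    and slope: "\<And>r. 0 < r \<Longrightarrow> r < R \<Longrightarrow> \<gamma> * r < \<alpha>"
    and center: "u x0 \<le> \<beta>" and k: "k \<le> \<beta>"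
    and bdry: "\<And>x. dist x0 x = R \<Longrightarrow> u x \<le> \<beta> + \<alpha> * R - \<gamma> * R\<^sup>2 / 2"
    and sub: "\<And>x. x \<in> ball x0 R \<Longrightarrow> k \<le> u x \<Longrightarrow> visc_sub u x c"
    and x: "x \<in> cball x0 R"
  shows "u x \<le> \<beta> + \<alpha> * dist x0 x - \<gamma> * (dist x0 x)\<^sup>2 / 2"
proof (rule ccontr)
  assume neg: "\<not> ?thesis"
  define \<psi> where "\<psi> r = \<beta> + \<alpha> * r - \<gamma> * r\<^sup>2 / 2" for r
  have "usc_on (cball x0 R) (\<lambda>x. u x + - \<psi> (dist x0 x))"
    unfolding \<psi>_def by (intro usc_on_add usc continuous_on_imp_usc_on continuous_intros) auto
  then obtain x1 where x1: "x1 \<in> cball x0 R"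
    "\<And>y. y \<in> cball x0 R \<Longrightarrow> u y + - \<psi> (dist x0 y) \<le> u x1 + - \<psi> (dist x0 x1)"
    by (rule usc_on_attains_sup) (use R in auto)
  have pos: "u x1 > \<psi> (dist x0 x1)"
    using x1(2)[OF x] neg by (simp add: \<psi>_def)
  define r where "r = dist x0 x1"
  have r0: "r > 0"
    using pos center by (cases "x0 = x1") (auto simp: r_def \<psi>_def)
  have rR: "r < R"
    using x1(1) bdry[of x1] pos by (cases "r = R") (auto simp: r_def \<psi>_def)
  have ar: "\<gamma> * r < \<alpha>" using slope r0 rR by auto
  \<comment> \<open>Let the radius tend to 0 in \<open>slope\<close>.\<close>
  have a0: "0 \<le> \<alpha>"
  proof (rule field_le_epsilon)
    fix e :: real assume e: "e > 0"
    define t where "t = min (r/2) (e / (1 + \<bar>\<gamma>\<bar>))"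
    have t: "0 < t" "t < R" "t \<le> e / (1 + \<bar>\<gamma>\<bar>)"
      using r0 rR e by (auto simp: t_def)
    have "\<bar>\<gamma>\<bar> * t \<le> (1 + \<bar>\<gamma>\<bar>) * (e / (1 + \<bar>\<gamma>\<bar>))"
      using t by (intro mult_mono) auto
    then have "\<bar>\<gamma> * t\<bar> \<le> e" using t(1) by (simp add: abs_mult)
    then show "0 \<le> \<alpha> + e" using slope[OF t(1,2)] by linarith
  qed
  have "\<psi> r \<ge> \<beta>"
  proof -
    have "\<gamma> * r / 2 \<le> \<alpha>" using ar a0 by linarith
    then have "\<gamma> * r / 2 * r \<le> \<alpha> * r" using r0 by (intro mult_right_mono) auto
    then show ?thesis by (simp add: \<psi>_def power2_eq_square)
  qed
  then have "k \<le> u x1" using pos k by (simp add: r_def)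
  then have vs: "visc_sub u x1 c" using sub x1(1) rR by (auto simp: r_def)
  define e where "e = (1/r) *\<^sub>R (x1 - x0)"
  have ne: "norm e = 1" using r0 by (simp add: e_def r_def dist_norm norm_minus_commute)
  have ee: "e \<bullet> e = 1" using ne by (simp add: norm_eq_1)
  have x1e: "x1 = x0 + r *\<^sub>R e" using r0 by (simp add: e_def)
  \<comment> \<open>The radial eigenvalue is exact. The tangential curvature of
    \<open>\<psi>\<close> is \<open>\<alpha> / r - \<gamma>\<close>; doubling
    \<open>\<alpha> / r\<close> turns a second-order expansion into a true upper bound on the ball
    of radius \<open>r / 2\<close>, and costs nothing since only the radial direction is
    tested.\<close>
  define H where "H v = (2 * \<alpha> / r - \<gamma>) *\<^sub>R (v - (e \<bullet> v) *\<^sub>R e) - (\<gamma> * (e \<bullet> v)) *\<^sub>R e" for v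
  define p where "p = (\<alpha> - \<gamma> * r) *\<^sub>R e"
  have linH: "linear H"
    unfolding H_def by (intro linearI) (simp_all add: algebra_simps inner_simps)
  have "u y \<le> u x1 + p \<bullet> (y - x1) + (y - x1) \<bullet> H (y - x1) / 2" if y: "y \<in> ball x1 (min (r/2) (R - r))" for y
  proof -
    define z where "z = y - x1"
    define s where "s = r + e \<bullet> z"
    define t2 where "t2 = z \<bullet> z - (e \<bullet> z)\<^sup>2"
    have nz: "norm z < r/2" "norm z < R - r" using y by (auto simp: z_def dist_norm norm_minus_commute)
    have "\<bar>e \<bullet> z\<bar> \<le> norm z" using Cauchy_Schwarz_ineq2[of e z] ne by simp
    then have s: "s \<ge> r/2" using nz by (simp add: s_def)
    have t2: "t2 \<ge> 0"
      using Cauchy_Schwarz_ineq[of e z] by (simp add: t2_def ee)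
    have yx: "y - x0 = r *\<^sub>R e + z" using x1e by (simp add: z_def)
    have d2: "(dist x0 y)\<^sup>2 = s\<^sup>2 + t2"
    proof -
      have "(dist x0 y)\<^sup>2 = (y - x0) \<bullet> (y - x0)" by (metis dist_commute dist_norm power2_norm_eq_inner)
      also have "\<dots> = r\<^sup>2 + 2 * r * (e \<bullet> z) + z \<bullet> z"
        by (simp add: yx inner_simps ee power2_eq_square inner_commute)
      finally show ?thesis by (simp add: s_def t2_def power2_eq_square algebra_simps)
    qed
    have "dist x0 y \<le> s + t2 / r"
    proof (rule power2_le_imp_le)
      have "t2 = r * (t2 / r)" using r0 by simp
      also have "\<dots> \<le> 2 * s * (t2 / r)" using s t2 r0 by (intro mult_right_mono) auto
      finally show "(dist x0 y)\<^sup>2 \<le> (s + t2 / r)\<^sup>2"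
        unfolding d2 power2_sum using zero_le_power2[of "t2 / r"] by linarith
      show "0 \<le> s + t2 / r" using s t2 r0 by simp
    qed
    then have "\<psi> (dist x0 y) \<le> \<beta> + \<alpha> * (s + t2 / r) - \<gamma> * (s\<^sup>2 + t2) / 2"
      unfolding \<psi>_def d2 using a0 by (simp add: mult_left_mono)
    also have "\<dots> = \<psi> r + p \<bullet> z + z \<bullet> H z / 2"
    proof -
      have "z \<bullet> H z = (2 * \<alpha> / r - \<gamma>) * t2 - \<gamma> * (e \<bullet> z)\<^sup>2"
        by (simp add: H_def t2_def inner_simps inner_commute power2_eq_square algebra_simps)
      moreover have "p \<bullet> z = (\<alpha> - \<gamma> * r) * (e \<bullet> z)" by (simp add: p_def)
      moreover have "\<alpha> * (s + t2 / r) - \<gamma> * (s\<^sup>2 + t2) / 2 = (\<alpha> * r - \<gamma> * r\<^sup>2 / 2)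
          + (\<alpha> - \<gamma> * r) * (e \<bullet> z) + ((2 * \<alpha> / r - \<gamma>) * t2 - \<gamma> * (e \<bullet> z)\<^sup>2) / 2"
        unfolding s_def using r0 by (simp add: power2_eq_square field_simps)
      ultimately show ?thesis by (simp add: \<psi>_def)
    qed
    finally have "\<psi> (dist x0 y) \<le> \<psi> r + p \<bullet> z + z \<bullet> H z / 2" .
    moreover have "y \<in> cball x0 R"
      using dist_triangle[of x0 y x1] nz by (simp add: z_def r_def dist_norm norm_minus_commute)
    ultimately show ?thesis using x1(2)[of y] by (simp add: z_def r_def)
  qed
  moreover have "min (r/2) (R - r) > 0" using r0 rR by simp
  ultimately obtain w where w: "norm w \<le> 1" "p = norm p *\<^sub>R w" "- (w \<bullet> H w) \<le> c"
    using vs linH unfolding visc_sub_def by blast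
  have "norm p = \<alpha> - \<gamma> * r" using ar ne by (simp add: p_def)
  then have "w = e" using w(2) ar by (simp add: p_def)
  then have "- (w \<bullet> H w) = \<gamma>" by (simp add: H_def ee)
  then show False using w(3) c by simp
qed

text \<open>
  With \<open>D = M - max (u x0) k\<close>, the comparison function has slope \<open>D / (2 * s) + \<gamma> * s\<close> at \<open>x0\<close> and the
  value \<open>M\<close> at radius \<open>2 * s\<close>. If \<open>0 < D < 2 * \<gamma> * s\<^sup>2\<close> it would decrease before that radius; one then
  uses the parabola whose apex has height \<open>M\<close>, on the ball up to its apex.
\<close>

lemma radial_finite_difference:
  fixes u :: "'a::euclidean_space \<Rightarrow> real"
  assumes usc: "usc_on (cball x0 (2 * s)) u" and s: "s > 0"
    and sub: "\<And>x. x \<in> ball x0 (2 * s) \<Longrightarrow> k \<le> u x \<Longrightarrow> visc_sub u x c"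
    and y0: "y0 \<in> cball x0 s" 
    and M: "\<And>x. x \<in> cball x0 (2 * s) \<Longrightarrow> u x \<le> M"
    and big: "k + \<bar>c\<bar> * s\<^sup>2 \<le> u y0"
  shows "2 * u y0 - M - max (u x0) k \<le> c * s\<^sup>2"
proof -
  define k' where "k' = max (u x0) k"
  define d where "d = dist x0 y0"
  have d: "0 \<le> d" "d \<le> s" using y0 by (auto simp: d_def)
  have y0M: "u y0 \<le> M" using M[of y0] y0 s by auto
  have y0R: "y0 \<in> cball x0 (2 * s)" using y0 s by auto
  \<comment> \<open>Radial comparison needs a strict gap above \<open>c\<close>, so \<gamma> is sent
    to \<open>c\<close> only at the end; for negative \<open>c\<close> it has to stay negative on
    the way.\<close>
  have key: "2 * u y0 - M - k' \<le> \<gamma> * s\<^sup>2" if g: "\<gamma> > c" "c \<ge> 0 \<or> \<gamma> < 0" for \<gamma>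
  proof (cases "c \<ge> 0")
    case True
    then have g0: "\<gamma> > 0" using g by simp
    define D where "D = M - k'"
    have gs: "\<gamma> * s\<^sup>2 > 0" using g0 s by simp
    consider "D \<le> \<gamma> * s\<^sup>2" | "D > \<gamma> * s\<^sup>2" "D < 2 * \<gamma> * s\<^sup>2" | "D \<ge> 2 * \<gamma> * s\<^sup>2" by linarith
    then show ?thesis
    proof cases
      case 1
      then show ?thesis using y0M by (simp add: D_def)
    next
      case 2
      \<comment> \<open>With slope \<open>\<gamma> * R\<close> at the centre the apex lies at
        \<open>R\<close> and has height \<open>k' + D = M\<close>. The bounds of this case put
        \<open>R\<close> between \<open>s\<close> and \<open>2 * s\<close>.\<close>
      define R where "R = sqrt (2 * D / \<gamma>)"
      have D0: "D > 0" using 2 gs by linarith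
      have R2: "R\<^sup>2 = 2 * D / \<gamma>" using D0 g0 by (simp add: R_def)
      have R0: "R > 0" using D0 g0 by (simp add: R_def)
      have "s\<^sup>2 \<le> R\<^sup>2" unfolding R2 using 2 g0 D0 by (simp add: field_simps)
      then have sR: "s \<le> R" using R0 by (auto intro: power2_le_imp_le)
      have "R\<^sup>2 \<le> (2 * s)\<^sup>2" unfolding R2 using 2 g0 by (simp add: field_simps)
      then have R2s: "R \<le> 2 * s" using s by (auto intro: power2_le_imp_le)
      have "u y0 \<le> k' + (\<gamma> * R) * dist x0 y0 - \<gamma> * (dist x0 y0)\<^sup>2 / 2"
      proof (rule radial_quadratic_comparison[where R = R and k = k and c = c])
        show "usc_on (cball x0 R) u" by (rule usc_on_subset[OF usc]) (use R2s in auto)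
        show "u x \<le> k' + \<gamma> * R * R - \<gamma> * R\<^sup>2 / 2" if "dist x0 x = R" for x
        proof -
          have "\<gamma> * R\<^sup>2 = 2 * D" using R2 g0 by simp
          then have "k' + \<gamma> * R * R - \<gamma> * R\<^sup>2 / 2 = M"
            by (simp add: D_def power2_eq_square mult.assoc diff_divide_distrib)
          then show ?thesis using M[of x] that R2s by simp
        qed
      qed (use R0 R2s g g0 sub y0 sR in \<open>auto simp: k'_def\<close>)
      also have "\<dots> \<le> k' + D / 2 + \<gamma> * s\<^sup>2 / 2"
      proof -
        have "0 \<le> (s - d) * (2 * R - s - d)" using d sR by simp
        then have "R * d - d\<^sup>2 / 2 \<le> R * s - s\<^sup>2 / 2" by (simp add: algebra_simps power2_eq_square)
        moreover have "R * s - s\<^sup>2 / 2 \<le> R\<^sup>2 / 4 + s\<^sup>2 / 2"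
          using zero_le_power2[of "R / 2 - s"] by (simp add: power2_diff field_simps)
        ultimately have "R * d - d\<^sup>2 / 2 \<le> R\<^sup>2 / 4 + s\<^sup>2 / 2" by linarith
        then have "\<gamma> * (R * d - d\<^sup>2 / 2) \<le> \<gamma> * (R\<^sup>2 / 4 + s\<^sup>2 / 2)" using g0 by (intro mult_left_mono) auto
        also have "\<dots> = D / 2 + \<gamma> * s\<^sup>2 / 2" unfolding R2 using g0 by (simp add: field_simps)
        finally show ?thesis by (simp add: d_def algebra_simps)
      qed
      finally show ?thesis by (simp add: D_def field_simps)
    next
      case 3
      define \<alpha> where "\<alpha> = D / (2 * s) + \<gamma> * s"
      have Ds: "D / (2 * s) \<ge> \<gamma> * s" using 3 s by (simp add: field_simps power2_eq_square)
      have "u y0 \<le> k' + \<alpha> * dist x0 y0 - \<gamma> * (dist x0 y0)\<^sup>2 / 2"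
      proof (rule radial_quadratic_comparison[where R = "2 * s" and k = k and c = c])
        show "u x \<le> k' + \<alpha> * (2 * s) - \<gamma> * (2 * s)\<^sup>2 / 2" if "dist x0 x = 2 * s" for x
        proof -
          have "k' + \<alpha> * (2 * s) - \<gamma> * (2 * s)\<^sup>2 / 2 = M"
            using s by (simp add: \<alpha>_def D_def field_simps power2_eq_square)
          then show ?thesis using M[of x] that by simp
        qed
        show "\<gamma> * r < \<alpha>" if "0 < r" "r < 2 * s" for r
        proof -
          have "\<gamma> * r < \<gamma> * (2 * s)" using that g0 by simp
          also have "\<dots> \<le> \<alpha>" using Ds by (simp add: \<alpha>_def)
          finally show ?thesis .
        qed
      qed (use usc s g sub y0R in \<open>auto simp: k'_def\<close>)
      also have "\<dots> \<le> k' + D / 2 + \<gamma> * s\<^sup>2 / 2"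
      proof -
        have "2 * (\<gamma> * s) \<le> \<alpha>" using Ds by (simp add: \<alpha>_def)
        moreover have "\<gamma> * ((s + d) / 2) \<le> \<gamma> * s" using d g0 by (intro mult_left_mono) auto
        moreover have "\<gamma> * s > 0" using g0 s by simp
        ultimately have "0 \<le> (s - d) * (\<alpha> - \<gamma> * ((s + d) / 2))" using d by (intro mult_nonneg_nonneg) linarith+
        then have "\<alpha> * d - \<gamma> * d\<^sup>2 / 2 \<le> \<alpha> * s - \<gamma> * s\<^sup>2 / 2" by (simp add: algebra_simps power2_eq_square add_divide_distrib diff_divide_distrib)
        also have "\<alpha> * s - \<gamma> * s\<^sup>2 / 2 = D / 2 + \<gamma> * s\<^sup>2 / 2"
          using s by (simp add: \<alpha>_def field_simps power2_eq_square)
        finally show ?thesis by (simp add: d_def)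
      qed
      finally show ?thesis by (simp add: D_def field_simps)
    qed
  next
    case False
    then have c0: "c < 0" "\<gamma> < 0" using g by auto
    define D where "D = M - k'"
    \<comment> \<open>Otherwise the convex parabola with \<open>\<alpha> = 0\<close> exceeds
      \<open>M\<close> on the rim and so dominates \<open>u\<close>. If \<open>k \<le> u x0\<close>,
      it touches \<open>u\<close> at the centre with zero gradient, and every \<open>w\<close> in
      the unit ball contradicts the negative \<open>c\<close>. If not, its value at
      \<open>y0\<close> is too small for \<open>big\<close>.\<close>
    have D: "D \<ge> - 2 * \<gamma> * s\<^sup>2"
    proof (rule ccontr)
      assume neg: "\<not> ?thesis"
      have cmp: "u x \<le> k' + 0 * dist x0 x - \<gamma> * (dist x0 x)\<^sup>2 / 2" if "x \<in> cball x0 (2 * s)" for x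
      proof (rule radial_quadratic_comparison[where R = "2 * s" and k = k and c = c])
        show "u x \<le> k' + 0 * (2 * s) - \<gamma> * (2 * s)\<^sup>2 / 2" if "dist x0 x = 2 * s" for x
          using M[of x] that neg by (simp add: D_def power2_eq_square)
        show "\<gamma> * r < 0" if "0 < r" "r < 2 * s" for r using that c0 by (simp add: mult_neg_pos)
      qed (use usc s g sub that in \<open>auto simp: k'_def\<close>)
      show False
      proof (cases "k \<le> u x0")
        case True
        have vs: "visc_sub u x0 c" using sub[of x0] True s by simp
        have lin: "linear (\<lambda>v. (- \<gamma>) *\<^sub>R v)" by (intro linear_scale_self)
        have "u y \<le> u x0 + 0 \<bullet> (y - x0) + (y - x0) \<bullet> ((- \<gamma>) *\<^sub>R (y - x0)) / 2" if "y \<in> ball x0 (2 * s)" for y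
        proof -
          have "(y - x0) \<bullet> (y - x0) = (dist x0 y)\<^sup>2"
            by (metis dist_commute dist_norm power2_norm_eq_inner)
          then show ?thesis using cmp[of y] that True by (simp add: k'_def)
        qed
        moreover have "2 * s > 0" using s by simp
        ultimately obtain w :: 'a where w: "norm w \<le> 1" "- (w \<bullet> ((- \<gamma>) *\<^sub>R w)) \<le> c"
          using vs lin unfolding visc_sub_def by blast
        have "w \<bullet> w \<le> 1" using w(1) by (simp add: norm_le_square)
        then have "\<gamma> * (w \<bullet> w) \<ge> \<gamma> * 1" using c0 by (intro mult_left_mono_neg) auto
        then show False using w(2) g by simp
      next
        case F: False
        have "u y0 \<le> k - \<gamma> * d\<^sup>2 / 2"
          using cmp[OF y0R] F by (simp add: k'_def d_def)
        moreover have "- \<gamma> * d\<^sup>2 \<le> - \<gamma> * s\<^sup>2" using c0 d by (intro mult_left_mono power_mono) auto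
        moreover have "- \<gamma> * s\<^sup>2 < - c * s\<^sup>2" using g s by simp
        moreover have "- \<gamma> * s\<^sup>2 > 0" using c0 s using mult_neg_pos[of \<gamma> "s\<^sup>2"] by simp
        moreover have "\<bar>c\<bar> * s\<^sup>2 = - c * s\<^sup>2" using c0 by simp
        ultimately show False using big by linarith
      qed
    qed
    define \<alpha> where "\<alpha> = D / (2 * s) + \<gamma> * s"
    have a0: "\<alpha> \<ge> 0" using D s by (simp add: \<alpha>_def field_simps power2_eq_square)
    have "u y0 \<le> k' + \<alpha> * dist x0 y0 - \<gamma> * (dist x0 y0)\<^sup>2 / 2"
    proof (rule radial_quadratic_comparison[where R = "2 * s" and k = k and c = c])
      show "u x \<le> k' + \<alpha> * (2 * s) - \<gamma> * (2 * s)\<^sup>2 / 2" if "dist x0 x = 2 * s" for x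
      proof -
        have "k' + \<alpha> * (2 * s) - \<gamma> * (2 * s)\<^sup>2 / 2 = M"
          using s by (simp add: \<alpha>_def D_def field_simps power2_eq_square)
        then show ?thesis using M[of x] that by simp
      qed
      show "\<gamma> * r < \<alpha>" if "0 < r" "r < 2 * s" for r
        using mult_neg_pos[OF c0(2) that(1)] a0 by linarith
    qed (use usc s g sub y0R in \<open>auto simp: k'_def\<close>)
    also have "\<dots> \<le> k' + D / 2 + \<gamma> * s\<^sup>2 / 2"
    proof -
      have "\<alpha> * d \<le> \<alpha> * s" using a0 d by (intro mult_left_mono) auto
      moreover have "- \<gamma> * d\<^sup>2 \<le> - \<gamma> * s\<^sup>2" using c0 d by (intro mult_left_mono power_mono) auto
      moreover have "\<alpha> * s - \<gamma> * s\<^sup>2 / 2 = D / 2 + \<gamma> * s\<^sup>2 / 2"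
        using s by (simp add: \<alpha>_def field_simps power2_eq_square)
      ultimately show ?thesis by (simp add: d_def)
    qed
    finally show ?thesis by (simp add: D_def field_simps)
  qed
  show ?thesis unfolding k'_def[symmetric]
  proof (rule field_le_epsilon)
    fix e :: real assume e: "e > 0"
    define t where "t = min (e / s\<^sup>2) (if c < 0 then - c / 2 else 1)"
    have t: "t > 0" using e s by (auto simp: t_def)
    have "t \<le> e / s\<^sup>2" by (simp add: t_def)
    then have ts: "t * s\<^sup>2 \<le> e" using s by (simp add: field_simps)
    have "c \<ge> 0 \<or> c + t < 0"
      by (cases "c < 0") (auto simp: t_def min_def)
    then have "2 * u y0 - M - k' \<le> (c + t) * s\<^sup>2" using key[of "c + t"] t by auto
    then show "2 * u y0 - M - k' \<le> c * s\<^sup>2 + e" using ts by (simp add: algebra_simps)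
  qed
qed

text \<open>
  Near \<open>x\<close>, \<open>c1\<close> and \<open>c2\<close> play the roles of \<open>f\<close> and \<open>- f\<close>, and \<open>k\<close> that of a constant just above the
  obstacle. Either \<open>c1 + c2 < 0\<close> (strict comparison) or \<open>c1 = c2 = 0\<close> (the homogeneous equation).
\<close>

definition fits_at_scale :: "'a::euclidean_space set \<Rightarrow> ('a \<Rightarrow> real) \<Rightarrow> ('a \<Rightarrow> real) \<Rightarrow> real \<Rightarrow> 'a \<Rightarrow> real \<Rightarrow> bool" where
  "fits_at_scale \<Omega> u w m x r \<longleftrightarrow> (\<exists>c1 c2 k. c1 + c2 \<le> 0 \<and> (c1 + c2 < 0 \<or> c1 = 0) \<and>
     (\<forall>a\<in>ball x r. a \<in> \<Omega> \<and> (k \<le> u a \<longrightarrow> visc_sub u a c1) \<and> visc_sub w a c2 \<and> k + w a \<le> m / 2) \<and>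
     \<bar>c1\<bar> * r\<^sup>2 \<le> m / 2)"

lemma fits_at_scale_shrink:
  assumes "fits_at_scale \<Omega> u w m x r" "ball y q \<subseteq> ball x r" "0 < q" "q \<le> r"
  shows "fits_at_scale \<Omega> u w m y q"
proof -
  obtain c1 c2 k where c: "c1 + c2 \<le> 0" "c1 + c2 < 0 \<or> c1 = 0"
     "\<forall>a\<in>ball x r. a \<in> \<Omega> \<and> (k \<le> u a \<longrightarrow> visc_sub u a c1) \<and> visc_sub w a c2 \<and> k + w a \<le> m / 2"
     "\<bar>c1\<bar> * r\<^sup>2 \<le> m / 2"
    using assms(1) unfolding fits_at_scale_def by blast
  have "\<bar>c1\<bar> * q\<^sup>2 \<le> \<bar>c1\<bar> * r\<^sup>2" using assms(3,4) by (intro mult_left_mono power_mono) auto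
  then have "\<bar>c1\<bar> * q\<^sup>2 \<le> m / 2" using c(4) by linarith
  moreover have "\<forall>a\<in>ball y q. a \<in> \<Omega> \<and> (k \<le> u a \<longrightarrow> visc_sub u a c1) \<and> visc_sub w a c2 \<and> k + w a \<le> m / 2"
    using c(3) assms(2) by blast
  ultimately show ?thesis unfolding fits_at_scale_def using c(1,2)
    by (intro exI[of _ c1] exI[of _ c2] exI[of _ k]) simp
qed

text \<open>By compactness: for scales tending to 0, counterexample pairs and centres accumulate at
  one point \<open>l\<close>, semicontinuity gives \<open>m \<le> u l + w l\<close>, so
  \<open>l\<close> lies in \<Omega>, and the scale that fits at \<open>l\<close> fits at all nearby
  centres. The radius \<open>3 * s\<close> leaves room for closed balls of radius
  \<open>2 * s\<close>.\<close>

lemma uniform_scale: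
  fixes u w :: "'a::euclidean_space \<Rightarrow> real"
  assumes K: "compact K"
    and usc: "usc_on K u" "usc_on K w"
    and bdry: "\<And>x. x \<in> K - \<Omega> \<Longrightarrow> u x + w x < m"
    and loc: "\<And>x. x \<in> K \<inter> \<Omega> \<Longrightarrow> \<exists>r>0. fits_at_scale \<Omega> u w m x r"
  shows "\<exists>s>0. \<forall>x y y'. y \<in> K \<inter> cball x s \<longrightarrow> y' \<in> K \<inter> cball x s \<longrightarrow> m \<le> u y + w y'
           \<longrightarrow> fits_at_scale \<Omega> u w m x (3 * s)"
proof (rule ccontr)
  assume neg: "\<not> ?thesis"
  define s where "s n = inverse (real (Suc n))" for n
  have s0: "s n > 0" for n by (simp add: s_def)
  have "\<forall>n. \<exists>x y y'. y \<in> K \<inter> cball x (s n) \<and> y' \<in> K \<inter> cball x (s n) \<and> m \<le> u y + w y'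
           \<and> \<not> fits_at_scale \<Omega> u w m x (3 * s n)"
    using neg s0 by blast
  then obtain x y y' where xy: "\<And>n. y n \<in> K" "\<And>n. dist (x n) (y n) \<le> s n" "\<And>n. y' n \<in> K"
      "\<And>n. dist (x n) (y' n) \<le> s n" "\<And>n. m \<le> u (y n) + w (y' n)"
      "\<And>n. \<not> fits_at_scale \<Omega> u w m (x n) (3 * s n)"
    unfolding Int_iff mem_cball by metis
  obtain l \<rho> where l: "l \<in> K" and \<rho>: "strict_mono \<rho>" and lim: "(y \<circ> \<rho>) \<longlonglongrightarrow> l"
    using K xy(1) unfolding compact_def by blast
  have slim: "(\<lambda>n. s (\<rho> n)) \<longlonglongrightarrow> 0"
    using LIMSEQ_subseq_LIMSEQ[OF LIMSEQ_inverse_real_of_nat \<rho>] by (simp add: s_def o_def)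
  have xlim: "(\<lambda>n. x (\<rho> n)) \<longlonglongrightarrow> l"
  proof (rule Lim_transform[OF lim])
    have "(\<lambda>n. dist (x (\<rho> n)) (y (\<rho> n))) \<longlonglongrightarrow> 0"
      by (rule tendsto_sandwich[OF _ _ tendsto_const slim]) (auto simp: xy(2))
    then show "(\<lambda>n. x (\<rho> n) - (y \<circ> \<rho>) n) \<longlonglongrightarrow> 0"
      by (simp add: dist_norm tendsto_norm_zero_iff o_def)
  qed
  have y'lim: "(\<lambda>n. y' (\<rho> n)) \<longlonglongrightarrow> l"
  proof (rule Lim_transform[OF xlim])
    have "(\<lambda>n. dist (x (\<rho> n)) (y' (\<rho> n))) \<longlonglongrightarrow> 0"
      by (rule tendsto_sandwich[OF _ _ tendsto_const slim]) (auto simp: xy(4))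
    then show "(\<lambda>n. y' (\<rho> n) - x (\<rho> n)) \<longlonglongrightarrow> 0"
      unfolding dist_commute[of "x _"] by (simp add: dist_norm tendsto_norm_zero_iff)
  qed
  have "m \<le> u l + w l"
  proof (rule ccontr)
    assume "\<not> ?thesis"
    then have e: "(m - u l - w l) / 2 > 0" by simp
    have "\<forall>\<^sub>F n in sequentially. u ((y \<circ> \<rho>) n) < u l + (m - u l - w l) / 2"
      using usc_on_sequentially[OF usc(1) l _ lim] xy(1) e by simp
    moreover have "\<forall>\<^sub>F n in sequentially. w (y' (\<rho> n)) < w l + (m - u l - w l) / 2"
      using usc_on_sequentially[OF usc(2) l _ y'lim] xy(3) e by simp
    ultimately have "\<forall>\<^sub>F n in sequentially. False"
    proof eventually_elim
      case (elim n)
      then show ?case using xy(5)[of "\<rho> n"] by (simp add: field_simps)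
    qed
    then show False by simp
  qed
  then have "l \<in> K \<inter> \<Omega>" using bdry[of l] l by force
  then obtain r where r: "r > 0" "fits_at_scale \<Omega> u w m l r" using loc by blast
  have "\<forall>\<^sub>F n in sequentially. dist (x (\<rho> n)) l < r / 2"
    using xlim r(1) by (intro tendstoD) auto
  moreover have "\<forall>\<^sub>F n in sequentially. s (\<rho> n) < r / 6"
    using slim r(1) by (intro order_tendstoD) auto
  ultimately have "\<forall>\<^sub>F n in sequentially. False"
  proof eventually_elim
    case (elim n)
    have "ball (x (\<rho> n)) (3 * s (\<rho> n)) \<subseteq> ball l r"
    proof
      fix z assume "z \<in> ball (x (\<rho> n)) (3 * s (\<rho> n))"
      then show "z \<in> ball l r"
        using elim dist_triangle[of l z "x (\<rho> n)"] by (simp add: dist_commute)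
    qed
    then have "fits_at_scale \<Omega> u w m (x (\<rho> n)) (3 * s (\<rho> n))"
      using fits_at_scale_shrink[OF r(2)] elim(2) s0[of "\<rho> n"] by simp
    then show ?case using xy(6) by blast
  qed
  then show False by simp
qed

text \<open>
  In the homogeneous case take, among the maximising pairs, one with \<open>u y\<close> largest. Any centre within
  \<open>s\<close> of both points of such a pair forms such a pair with itself, so the set \<open>G\<close> of these centres is
  invariant under steps of length \<open>s\<close>, which contradicts boundedness.
\<close>

lemma doubled_comparison:
  fixes u w :: "'a::euclidean_space \<Rightarrow> real"
  assumes K: "compact K" "\<Omega> \<subseteq> K"
    and usc: "usc_on K u" "usc_on K w"
    and m: "m > 0"
    and bdry: "\<And>x. x \<in> K - \<Omega> \<Longrightarrow> u x + w x < m"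
    and loc: "\<And>x. x \<in> K \<inter> \<Omega> \<Longrightarrow> \<exists>r>0. fits_at_scale \<Omega> u w m x r"
    and x: "x \<in> K"
  shows "u x + w x < m"
proof (rule ccontr)
  assume "\<not> ?thesis"
  then have xm: "m \<le> u x + w x" by simp
  obtain s where s: "s > 0" and good: "\<And>x y y'. y \<in> K \<inter> cball x s \<Longrightarrow> y' \<in> K \<inter> cball x s
      \<Longrightarrow> m \<le> u y + w y' \<Longrightarrow> fits_at_scale \<Omega> u w m x (3 * s)"
    using uniform_scale[OF K(1) usc bdry loc] by blast
  define P where "P = {p \<in> K \<times> K. dist (fst p) (snd p) \<le> 2 * s}"
  have cP: "compact P"
  proof -
    have "P = (K \<times> K) \<inter> {p. dist (fst p) (snd p) \<le> 2 * s}" by (auto simp: P_def)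
    moreover have "closed {p::'a \<times> 'a. dist (fst p) (snd p) \<le> 2 * s}"
      by (intro closed_Collect_le continuous_intros)
    ultimately show ?thesis using compact_Times[OF K(1) K(1)] by (simp add: compact_Int_closed)
  qed
  have u1: "usc_on P (\<lambda>p. u (fst p))"
    by (rule usc_on_compose[OF usc(1)]) (auto simp: P_def intro!: continuous_intros)
  have w1: "usc_on P (\<lambda>p. w (snd p))"
    by (rule usc_on_compose[OF usc(2)]) (auto simp: P_def intro!: continuous_intros)
  have xP: "(x, x) \<in> P" using x s by (simp add: P_def)
  obtain p where p: "p \<in> P" "\<And>q. q \<in> P \<Longrightarrow> u (fst q) + w (snd q) \<le> u (fst p) + w (snd p)"
    using usc_on_attains_sup[OF usc_on_add[OF u1 w1] cP] xP by blast
  define m' where "m' = u (fst p) + w (snd p)"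
  have mm': "m \<le> m'" using p(2)[OF xP] xm by (simp add: m'_def)
  have m'_ge: "u y + w y' \<le> m'" if "y \<in> K" "y' \<in> K" "dist y y' \<le> 2 * s" for y y'
    using p(2)[of "(y, y')"] that by (simp add: P_def m'_def)
  define E where "E = {p \<in> P. m' \<le> u (fst p) + w (snd p)}"
  have cE: "compact E" unfolding E_def by (rule usc_on_compact_ge[OF usc_on_add[OF u1 w1] cP])
  have pE: "p \<in> E" using p(1) by (simp add: E_def m'_def)
  have "usc_on E (\<lambda>p. u (fst p))" by (rule usc_on_subset[OF u1]) (auto simp: E_def)
  then obtain e where e: "e \<in> E" "\<And>q. q \<in> E \<Longrightarrow> u (fst q) \<le> u (fst e)"
    using usc_on_attains_sup[OF _ cE] pE by blast
  define U where "U = u (fst e)"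
  define G where "G x \<longleftrightarrow> (\<exists>y y'. y \<in> K \<inter> cball x s \<and> y' \<in> K \<inter> cball x s \<and> m' \<le> u y + w y' \<and> u y = U)" for x
  have step: "x \<in> K \<and> u x = U \<and> m' \<le> u x + w x" if "G x" for x
  proof -
    from that obtain y y' where y: "y \<in> K" "dist x y \<le> s" "y' \<in> K" "dist x y' \<le> s" "m' \<le> u y + w y'" "u y = U"
      unfolding G_def by auto
    have "fits_at_scale \<Omega> u w m x (3 * s)" using good[of y x y'] y mm' by auto
    then obtain c1 c2 k where c: "c1 + c2 \<le> 0" "c1 + c2 < 0 \<or> c1 = 0"
      and sub: "\<And>a. a \<in> ball x (3 * s) \<Longrightarrow> a \<in> \<Omega> \<and> (k \<le> u a \<longrightarrow> visc_sub u a c1) \<and> visc_sub w a c2 \<and> k + w a \<le> m / 2"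
      and small: "\<bar>c1\<bar> * (3 * s)\<^sup>2 \<le> m / 2"
      unfolding fits_at_scale_def by blast
    have in3: "a \<in> ball x (3 * s)" if "a \<in> cball x (2 * s)" for a
      using that s by auto
    have cK: "cball x (2 * s) \<subseteq> K" using in3 sub K(2) by blast
    have xK: "x \<in> K" using cK s by auto
    have ne: "cball x (2 * s) \<noteq> {}" using s by auto
    obtain y1 where y1: "y1 \<in> cball x (2 * s)" "\<And>a. a \<in> cball x (2 * s) \<Longrightarrow> u a \<le> u y1"
      using usc_on_attains_sup[OF usc_on_subset[OF usc(1) cK] compact_cball ne] by blast
    obtain y2 where y2: "y2 \<in> cball x (2 * s)" "\<And>a. a \<in> cball x (2 * s) \<Longrightarrow> w a \<le> w y2"
      using usc_on_attains_sup[OF usc_on_subset[OF usc(2) cK] compact_cball ne] by blast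
    have y'3: "y' \<in> ball x (3 * s)" using y s by auto
    have fu: "2 * u y - u y1 - max (u x) k \<le> c1 * s\<^sup>2"
    proof (rule radial_finite_difference[OF usc_on_subset[OF usc(1) cK] s])
      show "visc_sub u a c1" if "a \<in> ball x (2 * s)" "k \<le> u a" for a
        using sub[of a] that s by auto
      show "k + \<bar>c1\<bar> * s\<^sup>2 \<le> u y"
      proof -
        have "\<bar>c1\<bar> * s\<^sup>2 \<le> \<bar>c1\<bar> * (3 * s)\<^sup>2" using s by (intro mult_left_mono power_mono) auto
        then show ?thesis using small sub[OF y'3] y(5) mm' by linarith
      qed
    qed (use y y1 in auto)
    have y'x: "w x \<le> w y'"
    proof -
      have "u y + w x \<le> m'" using m'_ge[of y x] y xK s by (simp add: dist_commute)
      then show ?thesis using y(5) by linarith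
    qed
    \<comment> \<open>The inequality for \<open>w\<close> has no threshold, so one is invented:
      \<open>w x - \<bar>c2\<bar> * s^2\<close> is low enough to be harmless in the maximum, and by
      \<open>y'x\<close> it meets the largeness condition at \<open>y'\<close>.\<close>
    have "2 * w y' - w y2 - max (w x) (w x - \<bar>c2\<bar> * s\<^sup>2) \<le> c2 * s\<^sup>2"
    proof (rule radial_finite_difference[OF usc_on_subset[OF usc(2) cK] s])
      show "visc_sub w a c2" if "a \<in> ball x (2 * s)" for a
        using sub[of a] that s by auto
    qed (use y y2 y'x in auto)
    moreover have "max (w x) (w x - \<bar>c2\<bar> * s\<^sup>2) = w x" by (intro max.absorb1) simp
    ultimately have fw: "2 * w y' - w y2 - w x \<le> c2 * s\<^sup>2" by simp
    \<comment> \<open>In the sum of \<open>fu\<close> and \<open>fw\<close> the subtracted terms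
      group into the admissible pairs \<open>(y1, x)\<close> and \<open>(x, y2)\<close>, each at
      most \<open>m'\<close>; \<open>a3\<close> replaces the second bound when \<open>k\<close>
      exceeds \<open>u x\<close>. What remains is \<open>0 \<le> (c1 + c2) * s^2\<close>.\<close>
    have a1: "u y1 + w x \<le> m'" using m'_ge[of y1 x] y1(1) cK xK by (auto simp: dist_commute)
    have a2: "u x + w y2 \<le> m'" using m'_ge[of x y2] y2(1) cK xK by auto
    have a3: "k + w y2 < m'" using sub[OF in3[OF y2(1)]] m mm' by linarith
    have cs: "c1 * s\<^sup>2 + c2 * s\<^sup>2 = (c1 + c2) * s\<^sup>2" by (simp add: algebra_simps)
    have s2: "s\<^sup>2 > 0" using s by simp
    have "(c1 + c2) * s\<^sup>2 \<ge> 0" using fu fw a1 a2 a3 y(5) cs by linarith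
    then have "\<not> c1 + c2 < 0" using s2 mult_neg_pos[of "c1 + c2" "s\<^sup>2"] by linarith
    then have c0: "c1 = 0" "c2 = 0" using c by auto
    have e1: "m' \<le> u y1 + w x" using fu fw a1 a2 a3 y(5) c0 by simp
    have "(y1, x) \<in> E" using e1 y1(1) cK xK by (auto simp: E_def P_def dist_commute)
    then have "u y1 \<le> U" using e(2) by (fastforce simp: U_def)
    then have "U \<le> max (u x) k" using fu c0 y(6) by simp
    moreover have kx: "k < u x" 
    proof (rule ccontr)
      assume "\<not> k < u x"
      then have "max (u x) k = k" by simp
      then show False using fu fw c0 a1 a3 y(5) by simp
    qed
    ultimately have "U \<le> u x" by simp
    moreover have "u x \<le> u y1" using y1(2)[of x] s by simp
    ultimately have "u x = U" using \<open>u y1 \<le> U\<close> by simp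
    moreover have "m' \<le> u x + w x" using e1 \<open>u y1 \<le> U\<close> \<open>u x = U\<close> by simp
    ultimately show ?thesis using xK by simp
  qed
  have G0: "G (midpoint (fst e) (snd e))"
    unfolding G_def
    using e(1) by (intro exI[of _ "fst e"] exI[of _ "snd e"]) (auto simp: E_def P_def U_def dist_midpoint)
  define b :: 'a where "b = (SOME b. b \<in> Basis)"
  have nb: "norm b = 1" unfolding b_def by (simp add: SOME_Basis)
  have Gn: "G (midpoint (fst e) (snd e) + (real n * s) *\<^sub>R b)" for n
  proof (induction n)
    case 0
    then show ?case using G0 by simp
  next
    case (Suc n)
    let ?z = "midpoint (fst e) (snd e) + (real n * s) *\<^sub>R b"
    have z: "?z \<in> K" "u ?z = U" "m' \<le> u ?z + w ?z" using step[OF Suc] by auto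
    have "dist (midpoint (fst e) (snd e) + (real (Suc n) * s) *\<^sub>R b) ?z = s"
    proof -
      have "(midpoint (fst e) (snd e) + (real (Suc n) * s) *\<^sub>R b) - ?z = s *\<^sub>R b" by (simp add: algebra_simps)
      then show ?thesis using nb s by (simp add: dist_norm)
    qed
    then show ?case unfolding G_def using z by (intro exI[of _ ?z]) auto
  qed
  obtain B where B: "\<And>z. z \<in> K \<Longrightarrow> norm z \<le> B" using compact_imp_bounded[OF K(1)] by (auto simp: bounded_iff)
  obtain n where n: "real n * s > B + norm (midpoint (fst e) (snd e))"
    using reals_Archimedean3[OF s] by auto
  let ?z = "midpoint (fst e) (snd e) + (real n * s) *\<^sub>R b"
  have "norm ?z \<le> B" using step[OF Gn] B by blast
  moreover have "norm ((real n * s) *\<^sub>R b) \<le> norm ?z + norm (midpoint (fst e) (snd e))"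
    using norm_triangle_ineq4[of ?z "midpoint (fst e) (snd e)"] by simp
  ultimately show False using n nb s by simp
qed

section \<open>The discrete operator\<close>

lemma cball_subset_of_infdist:
  fixes x :: "'a::real_normed_vector"
  assumes x: "x \<in> \<Omega>" and r: "infdist x (frontier \<Omega>) > r" "r \<ge> 0"
  shows "cball x r \<subseteq> \<Omega>"
proof (rule ccontr)
  assume "\<not> ?thesis"
  then have "cball x r - \<Omega> \<noteq> {}" by blast
  moreover have "x \<in> cball x r \<inter> \<Omega>" using x r by simp
  ultimately have "cball x r \<inter> frontier \<Omega> \<noteq> {}"
    using connected_Int_frontier[OF connected_cball, of x r \<Omega>] by blast
  then obtain y where "y \<in> frontier \<Omega>" "dist x y \<le> r" by auto
  then show False using infdist_le[of y "frontier \<Omega>" x] r by simp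
qed

lemma Max_image_le_add:
  fixes f g :: "'a \<Rightarrow> real"
  assumes "finite A" "A \<noteq> {}" "\<And>x. x \<in> A \<Longrightarrow> f x \<le> g x + c"
  shows "Max (f ` A) \<le> Max (g ` A) + c"
proof -
  have "Max (f ` A) \<in> f ` A" using assms by (intro Max_in) auto
  then obtain x where x: "x \<in> A" "Max (f ` A) = f x" by auto
  moreover have "g x \<le> Max (g ` A)" using assms(1) x by (intro Max_ge) auto
  ultimately show ?thesis using assms(3)[OF x(1)] by simp
qed

lemma Min_image_le_add:
  fixes f g :: "'a \<Rightarrow> real"
  assumes "finite A" "A \<noteq> {}" "\<And>x. x \<in> A \<Longrightarrow> f x \<le> g x + c"
  shows "Min (f ` A) \<le> Min (g ` A) + c"
proof -
  have "Min (g ` A) \<in> g ` A" using assms by (intro Min_in) auto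
  then obtain x where x: "x \<in> A" "Min (g ` A) = g x" by auto
  moreover have "Min (f ` A) \<le> f x" using assms(1) x by (intro Min_le) auto
  ultimately show ?thesis using assms(3)[OF x(1)] by simp
qed

text \<open>Two tangent-line bounds for concave functions: for \<open>sqrt\<close> at \<rho>, and
  for the distance as the root of its square. The middle term is linear in \<open>y - x\<close>, so
  interpolation annihilates it and only the quadratic remainder counts.\<close>

lemma sqrt_dist_tangent:
  fixes x y x0 :: "'a::real_inner"
  assumes \<rho>: "dist x x0 = \<rho>" "\<rho> > 0"
  shows "sqrt (dist y x0) \<le> sqrt \<rho> + ((x - x0) \<bullet> (y - x)) / (2 * \<rho> * sqrt \<rho>) + (dist x y)\<^sup>2 / (4 * \<rho> * sqrt \<rho>)"
proof -
  define a where "a = (x - x0) \<bullet> (y - x)"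
  define q where "q = dist y x0"
  have q2: "q\<^sup>2 = \<rho>\<^sup>2 + 2 * a + (dist x y)\<^sup>2"
  proof -
    have "q\<^sup>2 = (norm ((x - x0) + (y - x)))\<^sup>2" by (simp add: q_def dist_norm)
    also have "\<dots> = (norm (x - x0))\<^sup>2 + 2 * a + (norm (y - x))\<^sup>2"
      by (simp add: power2_norm_eq_inner inner_simps a_def inner_commute)
    finally show ?thesis using \<rho> by (simp add: dist_norm norm_minus_commute)
  qed
  have s: "sqrt \<rho> > 0" "sqrt \<rho> * sqrt \<rho> = \<rho>" using \<rho> by auto
  have "2 * \<rho> * q \<le> \<rho>\<^sup>2 + q\<^sup>2" using zero_le_power2[of "q - \<rho>"] by (simp add: power2_diff algebra_simps)
  then have q1: "q \<le> (\<rho>\<^sup>2 + q\<^sup>2) / (2 * \<rho>)" using \<rho> by (simp add: field_simps)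
  have q0: "q \<ge> 0" by (simp add: q_def)
  have "2 * sqrt \<rho> * sqrt q \<le> \<rho> + q"
    using zero_le_power2[of "sqrt q - sqrt \<rho>"] q0 \<rho> by (simp add: power2_diff algebra_simps)
  then have "sqrt q \<le> (\<rho> + q) / (2 * sqrt \<rho>)" using s by (simp add: field_simps)
  also have "\<dots> \<le> (\<rho> + (\<rho>\<^sup>2 + q\<^sup>2) / (2 * \<rho>)) / (2 * sqrt \<rho>)"
    using q1 s by (intro divide_right_mono) auto
  also have "\<dots> = sqrt \<rho> + a / (2 * \<rho> * sqrt \<rho>) + (dist x y)\<^sup>2 / (4 * \<rho> * sqrt \<rho>)"
  proof -
    have "\<rho> / sqrt \<rho> = sqrt \<rho>" using s by (simp add: real_div_sqrt \<rho>(2) less_imp_le)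
    then show ?thesis unfolding q2 using \<rho> s(1) by (simp add: field_simps power2_eq_square) 
  qed
  finally show ?thesis by (simp add: q_def a_def)
qed

text \<open>The threshold \<psi> is the obstacle for the discrete solutions. Their negatives satisfy
  the operator inequality at all interior nodes, so for them any constant may be inserted.\<close>

definition disc_sub :: "(real^'n) set \<Rightarrow> (real^'n) set set \<Rightarrow> (real^'n) set \<Rightarrow> real \<Rightarrow>
   (real^'n \<Rightarrow> real) \<Rightarrow> (real^'n \<Rightarrow> real) \<Rightarrow> (real^'n \<Rightarrow> real) \<Rightarrow> bool" where
  "disc_sub \<Omega> Th S \<epsilon> F \<psi> U \<longleftrightarrow>
     (\<forall>z\<in>interior_nodes \<Omega> Th \<epsilon>. U z \<le> \<psi> z \<or> minus_disc_inf_lap Th S \<epsilon> U z \<le> F z)"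

locale two_scale =
  fixes \<Omega> :: "(real^'n) set" and Th :: "(real^'n) set set" and S :: "(real^'n) set"
    and \<epsilon> \<theta> h :: real
  assumes mesh: "is_mesh Th"
    and mesh_dom: "inner_set \<Omega> (meshsize Th) \<subseteq> mesh_domain Th" "mesh_domain Th \<subseteq> \<Omega>"
    and h_def: "h = meshsize Th"
    and h_le: "h \<le> \<epsilon>"
    and dirs: "admissible_dirs \<theta> S"
begin

lemma h_pos: "h > 0" using meshsize_pos[OF mesh] by (simp add: h_def)

lemma eps_pos: "\<epsilon> > 0" using h_pos h_le by simp

lemma finite_S: "finite S" and norm_S: "v \<in> S \<Longrightarrow> norm v = 1" and neg_S: "v \<in> S \<Longrightarrow> - v \<in> S"
  and dense_S: "norm x = 1 \<Longrightarrow> \<exists>v\<in>S. norm (x - v) \<le> \<theta>"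
  using dirs by (auto simp: admissible_dirs_def)

lemma finite_stencil [simp]: "finite (stencil S \<epsilon> z)" "stencil S \<epsilon> z \<noteq> {}"
  using finite_S by (auto simp: stencil_def)

lemma stencil_eq: "stencil S \<epsilon> z = (\<lambda>v. z + \<epsilon> *\<^sub>R v) ` insert 0 S"
  by (auto simp: stencil_def)

lemma stencil_dist: "x \<in> stencil S \<epsilon> z \<Longrightarrow> dist z x \<le> \<epsilon>"
  using eps_pos norm_S by (auto simp: stencil_def dist_norm)

lemma interior_node_cball:
  assumes "z \<in> interior_nodes \<Omega> Th \<epsilon>"
  shows "cball z \<epsilon> \<subseteq> \<Union>Th"
proof
  fix x assume x: "x \<in> cball z \<epsilon>"
  have z: "z \<in> \<Omega>" "infdist z (frontier \<Omega>) > 2 * \<epsilon>"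
    using assms by (auto simp: interior_nodes_def inner_set_def)
  have "x \<in> \<Omega>" using cball_subset_of_infdist[of z \<Omega> \<epsilon>] z x eps_pos by auto
  moreover have "infdist z (frontier \<Omega>) \<le> infdist x (frontier \<Omega>) + dist z x"
    by (rule infdist_triangle)
  ultimately have "x \<in> inner_set \<Omega> (meshsize Th)"
    using z x h_le by (simp add: inner_set_def h_def)
  then show "x \<in> \<Union>Th" using mesh_dom(1) interior_subset unfolding mesh_domain_def by blast
qed

lemma stencil_mesh: "z \<in> interior_nodes \<Omega> Th \<epsilon> \<Longrightarrow> x \<in> stencil S \<epsilon> z \<Longrightarrow> x \<in> \<Union>Th"
  using interior_node_cball[of z] stencil_dist[of x z] by auto

lemma interp_weights:
  assumes x: "x \<in> \<Union>Th"
  obtains \<mu> where "\<And>v. v \<in> nodes Th \<Longrightarrow> 0 \<le> \<mu> v"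
    "\<And>v. v \<in> nodes Th \<Longrightarrow> \<mu> v \<noteq> 0 \<Longrightarrow> dist x v \<le> h"
    "sum \<mu> (nodes Th) = 1" "(\<Sum>v\<in>nodes Th. \<mu> v *\<^sub>R v) = x"
    "\<And>w. interp Th w x = (\<Sum>v\<in>nodes Th. \<mu> v * w v)"
  by (rule interp_representation[OF mesh x, folded h_def]) (rule that)

text \<open>Since \<open>x\<close> is the barycentre of its weights, a linear term in
  \<open>v - x\<close> averages to 0. This is where second-order accuracy of the interpolation comes
  from.\<close>

lemma interp_le_affine:
  assumes x: "x \<in> \<Union>Th" and l: "linear l"
    and le: "\<And>v. v \<in> nodes Th \<Longrightarrow> dist x v \<le> h \<Longrightarrow> W v \<le> c + l (v - x)"
  shows "interp Th W x \<le> c"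
proof -
  obtain \<mu> where \<mu>: "\<And>v. v \<in> nodes Th \<Longrightarrow> 0 \<le> \<mu> v"
    "\<And>v. v \<in> nodes Th \<Longrightarrow> \<mu> v \<noteq> 0 \<Longrightarrow> dist x v \<le> h"
    "sum \<mu> (nodes Th) = 1" "(\<Sum>v\<in>nodes Th. \<mu> v *\<^sub>R v) = x"
    "\<And>w. interp Th w x = (\<Sum>v\<in>nodes Th. \<mu> v * w v)"
    by (rule interp_weights[OF x]) (rule that)
  have "interp Th W x \<le> (\<Sum>v\<in>nodes Th. \<mu> v * (c + l (v - x)))"
    unfolding \<mu>(5)
  proof (rule sum_mono)
    fix v assume v: "v \<in> nodes Th"
    show "\<mu> v * W v \<le> \<mu> v * (c + l (v - x))"
      using \<mu>(1,2)[OF v] le[OF v] by (cases "\<mu> v = 0") (auto intro: mult_left_mono)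
  qed
  also have "\<dots> = (\<Sum>v\<in>nodes Th. \<mu> v * c) + (\<Sum>v\<in>nodes Th. l (\<mu> v *\<^sub>R (v - x)))"
    by (simp add: distrib_left sum.distrib linear_scale[OF l])
  also have "(\<Sum>v\<in>nodes Th. l (\<mu> v *\<^sub>R (v - x))) = l (\<Sum>v\<in>nodes Th. \<mu> v *\<^sub>R (v - x))"
    by (simp add: linear_sum[OF l])
  also have "(\<Sum>v\<in>nodes Th. \<mu> v *\<^sub>R (v - x)) = (\<Sum>v\<in>nodes Th. \<mu> v *\<^sub>R v) - sum \<mu> (nodes Th) *\<^sub>R x"
    by (simp add: scaleR_diff_right sum_subtractf scaleR_sum_left)
  also have "\<dots> = 0" using \<mu>(3,4) by simp
  also have "l 0 = 0" using l by (rule linear_0)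
  finally show ?thesis using \<mu>(3) by (simp flip: sum_distrib_right)
qed

lemma interp_uminus: "interp Th (\<lambda>y. - W y) x = - interp Th W x"
  by (simp add: interp_def sum_negf)

text \<open>The maximum and the minimum enter symmetrically, so the operator is odd; supersolutions
  never need a separate treatment.\<close>

lemma minus_disc_inf_lap_uminus:
  "minus_disc_inf_lap Th S \<epsilon> (\<lambda>y. - W y) z = - minus_disc_inf_lap Th S \<epsilon> W z"
proof -
  let ?I = "interp Th W ` stencil S \<epsilon> z"
  have I: "interp Th (\<lambda>y. - W y) ` stencil S \<epsilon> z = uminus ` ?I"
    by (simp add: interp_uminus image_image)
  have neg: "Max (uminus ` ?I) = - Min ?I" "Min (uminus ` ?I) = - Max ?I"
    using minus_Max_eq_Min[of ?I] minus_Min_eq_Max[of ?I] by auto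
  have "2 * - W z - - Min ?I - - Max ?I = - (2 * W z - Max ?I - Min ?I)"
    by (simp del: minus_Max_eq_Min minus_Min_eq_Max)
  then show ?thesis unfolding minus_disc_inf_lap_def I neg by (simp only: minus_divide_left)
qed

text \<open>Monotonicity in localised form: stencil points are within \<epsilon> of \<open>z\<close>
  and interpolation adds \<open>h\<close>, so a maximum of \<open>U - W\<close> over nodes in that
  range is enough. Locality is what allows test functions that touch only near a point.\<close>

lemma minus_disc_inf_lap_mono:
  assumes z: "z \<in> interior_nodes \<Omega> Th \<epsilon>"
    and le: "\<And>v. v \<in> nodes Th \<Longrightarrow> dist z v \<le> \<epsilon> + h \<Longrightarrow> U v - W v \<le> U z - W z"
  shows "minus_disc_inf_lap Th S \<epsilon> W z \<le> minus_disc_inf_lap Th S \<epsilon> U z"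
proof -
  define m where "m = U z - W z"
  have le': "interp Th U x \<le> interp Th W x + m" if x: "x \<in> stencil S \<epsilon> z" for x
  proof -
    obtain \<mu> where \<mu>: "\<And>v. v \<in> nodes Th \<Longrightarrow> 0 \<le> \<mu> v"
      "\<And>v. v \<in> nodes Th \<Longrightarrow> \<mu> v \<noteq> 0 \<Longrightarrow> dist x v \<le> h"
      "sum \<mu> (nodes Th) = 1" "(\<Sum>v\<in>nodes Th. \<mu> v *\<^sub>R v) = x"
      "\<And>w. interp Th w x = (\<Sum>v\<in>nodes Th. \<mu> v * w v)"
      by (rule interp_weights[OF stencil_mesh[OF z x]]) (rule that)
    have "interp Th U x \<le> (\<Sum>v\<in>nodes Th. \<mu> v * (W v + m))"
      unfolding \<mu>(5)
    proof (rule sum_mono)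
      fix v assume v: "v \<in> nodes Th"
      show "\<mu> v * U v \<le> \<mu> v * (W v + m)"
      proof (cases "\<mu> v = 0")
        case False
        have "dist z v \<le> \<epsilon> + h"
          using dist_triangle[of z v x] stencil_dist[OF x] \<mu>(2)[OF v False] by simp
        then show ?thesis using le[OF v] \<mu>(1)[OF v] by (intro mult_left_mono) (auto simp: m_def)
      qed simp
    qed
    also have "\<dots> = interp Th W x + m"
      unfolding \<mu>(5) using \<mu>(3) by (simp add: distrib_left sum.distrib flip: sum_distrib_right)
    finally show ?thesis .
  qed
  have "Max (interp Th U ` stencil S \<epsilon> z) \<le> Max (interp Th W ` stencil S \<epsilon> z) + m"
       "Min (interp Th U ` stencil S \<epsilon> z) \<le> Min (interp Th W ` stencil S \<epsilon> z) + m"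
    by (intro Max_image_le_add Min_image_le_add le'; simp)+
  then have "2 * W z - Max (interp Th W ` stencil S \<epsilon> z) - Min (interp Th W ` stencil S \<epsilon> z)
     \<le> 2 * U z - Max (interp Th U ` stencil S \<epsilon> z) - Min (interp Th U ` stencil S \<epsilon> z)"
    unfolding m_def by linarith
  then show ?thesis unfolding minus_disc_inf_lap_def by (rule divide_right_mono) simp
qed

text \<open>At a node where \<open>U - W\<close> has a positive maximum, \<open>U\<close> exceeds
  \<psi>, so its operator inequality applies and monotonicity contradicts strictness.\<close>

lemma strict_comparison:
  assumes U: "disc_sub \<Omega> Th S \<epsilon> F \<psi> U"
    and bdry: "\<And>z. z \<in> boundary_nodes \<Omega> Th \<epsilon> \<Longrightarrow> U z \<le> W z"
    and obst: "\<And>z. z \<in> interior_nodes \<Omega> Th \<epsilon> \<Longrightarrow> \<psi> z \<le> W z"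
    and strict: "\<And>z. z \<in> interior_nodes \<Omega> Th \<epsilon> \<Longrightarrow> F z < minus_disc_inf_lap Th S \<epsilon> W z"
    and z: "z \<in> nodes Th"
  shows "U z \<le> W z"
proof -
  let ?d = "\<lambda>v. U v - W v"
  have "Max (?d ` nodes Th) \<in> ?d ` nodes Th" using finite_nodes[OF mesh] z by (intro Max_in) auto
  then obtain y where y: "y \<in> nodes Th" "?d y = Max (?d ` nodes Th)" by auto
  have max: "?d v \<le> ?d y" if "v \<in> nodes Th" for v
    unfolding y(2) using finite_nodes[OF mesh] that by (intro Max_ge) auto
  have "?d y \<le> 0"
  proof (rule ccontr)
    assume pos: "\<not> ?d y \<le> 0"
    then have "y \<notin> boundary_nodes \<Omega> Th \<epsilon>" using bdry[of y] by linarith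
    then have yi: "y \<in> interior_nodes \<Omega> Th \<epsilon>" using y(1) by (simp add: boundary_nodes_def)
    have "minus_disc_inf_lap Th S \<epsilon> W y \<le> minus_disc_inf_lap Th S \<epsilon> U y"
      by (rule minus_disc_inf_lap_mono[OF yi]) (use max in auto)
    moreover have "U y \<le> \<psi> y \<or> minus_disc_inf_lap Th S \<epsilon> U y \<le> F y"
      using U yi unfolding disc_sub_def by blast
    ultimately show False using obst[OF yi] strict[OF yi] pos by linarith
  qed
  then show ?thesis using max[OF z] by simp
qed

end

text \<open>
  The square root is chosen for its scaling: at distance \<open>r\<close> the second difference, of order
  \<open>r^(-3/2)\<close>, dominates the interpolation error \<open>h\<^sup>2 / \<epsilon>\<^sup>2 * r^(-3/2)\<close> even for \<open>r\<close> comparable to \<open>\<epsilon>\<close>.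
\<close>

lemma (in two_scale) disc_lap_barrier:
  fixes x0 :: "real^'n"
  assumes z: "z \<in> interior_nodes \<Omega> Th \<epsilon>" and r: "2 * \<epsilon> < dist z x0" "dist z x0 \<le> D"
    and small: "2 * (h / \<epsilon>)\<^sup>2 + D * (\<theta> / \<epsilon>) \<le> 1 / 8" and \<theta>: "\<theta> \<ge> 0" and A: "A \<ge> 0"
  shows "A / (8 * D * sqrt D) \<le> minus_disc_inf_lap Th S \<epsilon> (\<lambda>y. c + A * sqrt (dist y x0)) z"
proof -
  let ?W = "\<lambda>y. c + A * sqrt (dist y x0)"
  define r where "r = dist z x0"
  \<comment> \<open>Stencil points stay at distance at least \<open>r / 2\<close> from
    \<open>x0\<close>, and there \<open>4 * \<rho> * sqrt \<rho>\<close> is at least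
    \<open>r * sqrt r\<close>; so this bounds the remainder of the tangent estimate throughout the
    stencil.\<close>
  define E where "E = h\<^sup>2 / (r * sqrt r)"
  have r0: "r > 2 * \<epsilon>" "r > 0" using r(1) eps_pos by (auto simp: r_def)
  have err: "interp Th ?W x \<le> c + A * (sqrt (dist x x0) + E)" if x: "x \<in> stencil S \<epsilon> z" for x
  proof -
    define \<rho> where "\<rho> = dist x x0"
    have "dist z x \<le> \<epsilon>" using stencil_dist[OF x] .
    then have \<rho>: "\<rho> \<ge> r / 2" using dist_triangle[of z x0 x] r0(1) unfolding \<rho>_def r_def by linarith
    then have \<rho>0: "\<rho> > 0" using r0(2) by linarith
    have "r * sqrt r / 4 = (r / 2) * (sqrt r / 2)" by simp
    also have "\<dots> \<le> \<rho> * sqrt \<rho>"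
    proof (rule mult_mono)
      have "sqrt r / 2 = sqrt (r / 4)" by (simp add: real_sqrt_divide)
      also have "\<dots> \<le> sqrt \<rho>" using \<rho> r0 by simp
      finally show "sqrt r / 2 \<le> sqrt \<rho>" .
    qed (use \<rho> \<rho>0 r0 in auto)
    finally have rho: "r * sqrt r \<le> 4 * \<rho> * sqrt \<rho>" by simp
    have E: "h\<^sup>2 / (4 * \<rho> * sqrt \<rho>) \<le> E"
      unfolding E_def using rho r0 by (intro divide_left_mono mult_pos_pos) (auto simp: \<rho>0)
    define l where "l b = A * (((x - x0) \<bullet> b) / (2 * \<rho> * sqrt \<rho>))" for b
    show ?thesis
    proof (rule interp_le_affine[OF stencil_mesh[OF z x]])
      show "linear l" unfolding l_def
        by (intro linearI) (simp_all add: inner_add_right add_divide_distrib distrib_left)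
      fix v assume v: "dist x v \<le> h"
      have "(dist x v)\<^sup>2 / (4 * \<rho> * sqrt \<rho>) \<le> h\<^sup>2 / (4 * \<rho> * sqrt \<rho>)"
        using v \<rho>0 by (intro divide_right_mono power_mono) auto
      then have "sqrt (dist v x0) \<le> sqrt \<rho> + ((x - x0) \<bullet> (v - x)) / (2 * \<rho> * sqrt \<rho>) + E"
        using sqrt_dist_tangent[of x x0 \<rho> v] \<rho>0 E by (simp add: \<rho>_def)
      from mult_left_mono[OF this A]
      show "?W v \<le> c + A * (sqrt (dist x x0) + E) + l (v - x)"
        by (simp add: l_def \<rho>_def algebra_simps)
    qed
  qed
  have max: "Max (interp Th ?W ` stencil S \<epsilon> z) \<le> c + A * (sqrt (r + \<epsilon>) + E)"
  proof -
    have "interp Th ?W x \<le> c + A * (sqrt (r + \<epsilon>) + E)" if x: "x \<in> stencil S \<epsilon> z" for x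
    proof -
      have "dist x x0 \<le> r + \<epsilon>"
        using dist_triangle[of x x0 z] stencil_dist[OF x] by (simp add: r_def dist_commute)
      then have "A * (sqrt (dist x x0) + E) \<le> A * (sqrt (r + \<epsilon>) + E)"
        using A by (intro mult_left_mono) auto
      then show ?thesis using err[OF x] by linarith
    qed
    then show ?thesis by simp
  qed
  have min: "Min (interp Th ?W ` stencil S \<epsilon> z) \<le> c + A * (sqrt (r - \<epsilon>) + \<epsilon> * \<theta> / sqrt r + E)"
  proof -
    \<comment> \<open>The exact direction towards \<open>x0\<close>. Its replacement from
      \<open>S\<close> changes the distance by at most \<open>\<epsilon> * \<theta>\<close>, an
      error of first order.\<close>
    define e where "e = (1 / r) *\<^sub>R (x0 - z)"
    have ne: "norm e = 1" using r0 by (simp add: e_def r_def dist_norm norm_minus_commute)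
    obtain v where v: "v \<in> S" "norm (e - v) \<le> \<theta>" using dense_S[OF ne] by blast
    define x where "x = z + \<epsilon> *\<^sub>R v"
    have x: "x \<in> stencil S \<epsilon> z" using v by (auto simp: stencil_def x_def)
    have x0z: "x0 = z + r *\<^sub>R e" using r0 by (simp add: e_def)
    have "x - x0 = (\<epsilon> - r) *\<^sub>R e - \<epsilon> *\<^sub>R (e - v)"
      unfolding x0z x_def by (simp add: algebra_simps)
    then have "dist x x0 \<le> norm ((\<epsilon> - r) *\<^sub>R e) + norm (\<epsilon> *\<^sub>R (e - v))"
      unfolding dist_norm by (metis norm_triangle_ineq4)
    also have "\<dots> \<le> (r - \<epsilon>) + \<epsilon> * \<theta>" using v(2) ne r0 eps_pos by simp
    finally have d: "dist x x0 \<le> (r - \<epsilon>) + \<epsilon> * \<theta>" .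
    have sr: "sqrt r / 2 \<le> sqrt (r - \<epsilon>)"
    proof -
      have "sqrt r / 2 = sqrt (r / 4)" by (simp add: real_sqrt_divide)
      also have "\<dots> \<le> sqrt (r - \<epsilon>)" using r0 eps_pos by simp
      finally show ?thesis .
    qed
    have "sqrt (dist x x0) \<le> sqrt (r - \<epsilon>) + \<epsilon> * \<theta> / sqrt r"
    proof (rule real_le_lsqrt)
      have nn: "0 \<le> \<epsilon> * \<theta> / sqrt r" using eps_pos \<theta> r0 by simp
      then show "0 \<le> sqrt (r - \<epsilon>) + \<epsilon> * \<theta> / sqrt r" using r0 eps_pos by simp
      have "\<epsilon> * \<theta> = 2 * (sqrt r / 2) * (\<epsilon> * \<theta> / sqrt r)" using r0 by simp
      also have "\<dots> \<le> 2 * sqrt (r - \<epsilon>) * (\<epsilon> * \<theta> / sqrt r)"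
        using sr nn by (intro mult_right_mono) auto
      finally show "dist x x0 \<le> (sqrt (r - \<epsilon>) + \<epsilon> * \<theta> / sqrt r)\<^sup>2"
        unfolding power2_sum using d real_sqrt_pow2[of "r - \<epsilon>"] r0 eps_pos zero_le_power2[of "\<epsilon> * \<theta> / sqrt r"]
        by linarith
    qed
    then have "A * (sqrt (dist x x0) + E) \<le> A * (sqrt (r - \<epsilon>) + \<epsilon> * \<theta> / sqrt r + E)"
      using A by (intro mult_left_mono) auto
    moreover have "Min (interp Th ?W ` stencil S \<epsilon> z) \<le> interp Th ?W x" using x by (intro Min_le) auto
    ultimately show ?thesis using err[OF x] by linarith
  qed
  \<comment> \<open>Quantitative concavity of the square root, obtained by squaring twice.\<close>
  have gap: "2 * sqrt r - sqrt (r + \<epsilon>) - sqrt (r - \<epsilon>) \<ge> \<epsilon>\<^sup>2 / (4 * r * sqrt r)"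
  proof -
    have q: "\<epsilon>\<^sup>2 / (8 * r\<^sup>2) \<le> 1"
    proof -
      have "\<epsilon>\<^sup>2 \<le> r\<^sup>2" using r0 eps_pos by (intro power_mono) auto
      then have "\<epsilon>\<^sup>2 \<le> 8 * r\<^sup>2" using zero_le_power2[of r] by linarith
      then show ?thesis using r0 by simp
    qed
    have s1: "sqrt (r + \<epsilon>) * sqrt (r - \<epsilon>) \<le> r * (1 - \<epsilon>\<^sup>2 / (2 * r\<^sup>2))"
    proof -
      have "sqrt (r + \<epsilon>) * sqrt (r - \<epsilon>) = sqrt (r\<^sup>2 - \<epsilon>\<^sup>2)"
        by (simp add: power2_eq_square algebra_simps flip: real_sqrt_mult)
      also have "\<dots> \<le> r * (1 - \<epsilon>\<^sup>2 / (2 * r\<^sup>2))"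
      proof (rule real_le_lsqrt)
        have "\<epsilon>\<^sup>2 \<le> r\<^sup>2" using r0 eps_pos by (intro power_mono) auto
        then have "\<epsilon>\<^sup>2 \<le> 2 * r\<^sup>2" using zero_le_power2[of r] by linarith
        then have "\<epsilon>\<^sup>2 / (2 * r\<^sup>2) \<le> 1" using r0 by simp
        then show "0 \<le> r * (1 - \<epsilon>\<^sup>2 / (2 * r\<^sup>2))" using r0 by simp
        have "(r * (1 - \<epsilon>\<^sup>2 / (2 * r\<^sup>2)))\<^sup>2 = r\<^sup>2 - \<epsilon>\<^sup>2 + (r * (\<epsilon>\<^sup>2 / (2 * r\<^sup>2)))\<^sup>2"
          using r0 by (simp add: field_simps power2_eq_square)
        then show "r\<^sup>2 - \<epsilon>\<^sup>2 \<le> (r * (1 - \<epsilon>\<^sup>2 / (2 * r\<^sup>2)))\<^sup>2" by simp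
      qed
      finally show ?thesis .
    qed
    have "sqrt (r + \<epsilon>) + sqrt (r - \<epsilon>) \<le> 2 * sqrt r * (1 - \<epsilon>\<^sup>2 / (8 * r\<^sup>2))"
    proof (rule power2_le_imp_le)
      have "(sqrt (r + \<epsilon>) + sqrt (r - \<epsilon>))\<^sup>2 = 2 * r + 2 * (sqrt (r + \<epsilon>) * sqrt (r - \<epsilon>))"
        using r0 eps_pos by (simp add: power2_sum)
      also have "\<dots> \<le> 2 * r + 2 * (r * (1 - \<epsilon>\<^sup>2 / (2 * r\<^sup>2)))" using s1 by simp
      also have "\<dots> = 4 * r * (1 - 2 * (\<epsilon>\<^sup>2 / (8 * r\<^sup>2)))" using r0 by (simp add: field_simps)
      also have "\<dots> \<le> 4 * r * (1 - \<epsilon>\<^sup>2 / (8 * r\<^sup>2))\<^sup>2"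
        using r0 zero_le_power2[of "\<epsilon>\<^sup>2 / (8 * r\<^sup>2)"] by (intro mult_left_mono) (auto simp: power2_diff)
      also have "\<dots> = (2 * sqrt r * (1 - \<epsilon>\<^sup>2 / (8 * r\<^sup>2)))\<^sup>2"
        using r0 by (simp add: power_mult_distrib)
      finally show "(sqrt (r + \<epsilon>) + sqrt (r - \<epsilon>))\<^sup>2 \<le> (2 * sqrt r * (1 - \<epsilon>\<^sup>2 / (8 * r\<^sup>2)))\<^sup>2" .
      show "0 \<le> 2 * sqrt r * (1 - \<epsilon>\<^sup>2 / (8 * r\<^sup>2))" using q r0 by simp
    qed
    moreover have "2 * sqrt r * (\<epsilon>\<^sup>2 / (8 * r\<^sup>2)) = \<epsilon>\<^sup>2 / (4 * r * sqrt r)"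
    proof -
      have "sqrt r / r\<^sup>2 = 1 / (r * sqrt r)" using r0 by (simp add: field_simps power2_eq_square)
      moreover have "2 * sqrt r * (\<epsilon>\<^sup>2 / (8 * r\<^sup>2)) = \<epsilon>\<^sup>2 / 4 * (sqrt r / r\<^sup>2)" by simp
      ultimately show ?thesis by (simp add: mult.assoc)
    qed
    ultimately show ?thesis by (simp add: algebra_simps)
  qed
  have rD: "r \<le> D" using r(2) by (simp add: r_def)
  have D0: "D > 0" using rD r0 by simp
  have "\<epsilon>\<^sup>2 / (8 * D * sqrt D) \<le> \<epsilon>\<^sup>2 / (8 * r * sqrt r)"
    using rD r0 D0 by (intro divide_left_mono mult_mono mult_pos_pos) auto
  \<comment> \<open>By \<open>small\<close>, interpolation and direction errors together use up at
    most half of \<open>gap\<close>.\<close>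
  also have "\<dots> \<le> \<epsilon>\<^sup>2 / (4 * r * sqrt r) - 2 * E - \<epsilon> * \<theta> / sqrt r"
  proof -
    have "\<epsilon> * \<theta> * r \<le> \<epsilon> * \<theta> * D" using rD eps_pos \<theta> by (intro mult_left_mono) auto
    moreover have "2 * h\<^sup>2 + D * \<theta> * \<epsilon> \<le> \<epsilon>\<^sup>2 / 8"
    proof -
      have "(2 * (h / \<epsilon>)\<^sup>2 + D * (\<theta> / \<epsilon>)) * \<epsilon>\<^sup>2 \<le> 1 / 8 * \<epsilon>\<^sup>2"
        using small by (intro mult_right_mono) auto
      moreover have "(h / \<epsilon>)\<^sup>2 * \<epsilon>\<^sup>2 = h\<^sup>2" "(\<theta> / \<epsilon>) * \<epsilon>\<^sup>2 = \<theta> * \<epsilon>"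
        using eps_pos by (simp_all add: power_divide power2_eq_square)
      moreover have "(2 * (h / \<epsilon>)\<^sup>2 + D * (\<theta> / \<epsilon>)) * \<epsilon>\<^sup>2 = 2 * ((h / \<epsilon>)\<^sup>2 * \<epsilon>\<^sup>2) + D * ((\<theta> / \<epsilon>) * \<epsilon>\<^sup>2)"
        by (simp only: distrib_right mult.assoc)
      ultimately show ?thesis by (simp only: mult.assoc)
    qed
    ultimately have "\<epsilon>\<^sup>2 / 8 \<le> \<epsilon>\<^sup>2 / 4 - 2 * h\<^sup>2 - \<epsilon> * \<theta> * r" by (simp add: algebra_simps)
    then have "(\<epsilon>\<^sup>2 / 8) / (r * sqrt r) \<le> (\<epsilon>\<^sup>2 / 4 - 2 * h\<^sup>2 - \<epsilon> * \<theta> * r) / (r * sqrt r)"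
      using r0 by (intro divide_right_mono) auto
    then show ?thesis using r0 by (simp add: E_def diff_divide_distrib mult.assoc)
  qed
  also have "\<dots> \<le> 2 * sqrt r - (sqrt (r + \<epsilon>) + E) - (sqrt (r - \<epsilon>) + \<epsilon> * \<theta> / sqrt r + E)"
    using gap by simp
  finally have "A * (\<epsilon>\<^sup>2 / (8 * D * sqrt D))
      \<le> A * (2 * sqrt r - (sqrt (r + \<epsilon>) + E) - (sqrt (r - \<epsilon>) + \<epsilon> * \<theta> / sqrt r + E))"
    using A by (rule mult_left_mono)
  also have "\<dots> \<le> 2 * ?W z - Max (interp Th ?W ` stencil S \<epsilon> z) - Min (interp Th ?W ` stencil S \<epsilon> z)"
  proof -
    have "A * (2 * q - X - Y) \<le> 2 * (c + A * q) - M - N"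
      if "M \<le> c + A * X" "N \<le> c + A * Y" for q X Y M N :: real
    proof -
      have "2 * (c + A * q) - (c + A * X) - (c + A * Y) = A * (2 * q - X - Y)" by (simp add: algebra_simps)
      moreover have "2 * (c + A * q) - (c + A * X) - (c + A * Y) \<le> 2 * (c + A * q) - M - N"
        using that by (intro diff_mono order_refl)
      ultimately show ?thesis by simp
    qed
    from this[OF max min, of "sqrt r"] show ?thesis unfolding r_def .
  qed
  finally have "A * (\<epsilon>\<^sup>2 / (8 * D * sqrt D)) / \<epsilon>\<^sup>2 \<le> minus_disc_inf_lap Th S \<epsilon> ?W z"
    unfolding minus_disc_inf_lap_def by (rule divide_right_mono) simp
  moreover have "A * (\<epsilon>\<^sup>2 / (8 * D * sqrt D)) / \<epsilon>\<^sup>2 = A / (8 * D * sqrt D)" using eps_pos by simp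
  ultimately show ?thesis by (simp only:)
qed


text \<open>Let \<open>w\<close> be a direction in which the interpolated maximum is attained and
  bound the minimum by the value at \<open>- w\<close>. The first-order terms cancel exactly, so the
  coarseness of \<open>S\<close> costs nothing here and interpolation contributes
  \<open>B * (h / \<epsilon>)^2\<close>. As the centre belongs to the stencil, \<open>w = 0\<close>
  cannot be excluded. The last conclusion says that \<open>w\<close> almost maximises
  \<open>p\<close>, which identifies its limit.\<close>

lemma (in two_scale) quadratic_consistency:
  assumes z: "z \<in> interior_nodes \<Omega> Th \<epsilon>" and H: "linear H"
    and B: "\<And>a. \<bar>a \<bullet> H a\<bar> \<le> B * (norm a)\<^sup>2" "B \<ge> 0"
    and W: "\<And>a. W (z + a) = W z + p \<bullet> a + a \<bullet> H a / 2"
    and le: "minus_disc_inf_lap Th S \<epsilon> W z \<le> F"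
  obtains w where "norm w \<le> 1" "- (w \<bullet> H w) \<le> F + B * (h / \<epsilon>)\<^sup>2"
    "\<And>v. v \<in> S \<Longrightarrow> p \<bullet> v \<le> p \<bullet> w + 2 * B * \<epsilon>"
proof -
  have I: "interp Th W x \<le> W x + B * h\<^sup>2 / 2" "W x - B * h\<^sup>2 / 2 \<le> interp Th W x" if x: "x \<in> stencil S \<epsilon> z" for x
  proof -
    define a where "a = x - z"
    \<comment> \<open>The derivative of \<open>W\<close> at \<open>x\<close>; \<open>H\<close> is
      not assumed symmetric, hence both mixed terms.\<close>
    define l where "l b = p \<bullet> b + (a \<bullet> H b + b \<bullet> H a) / 2" for b
    have l: "linear l" unfolding l_def
      by (intro linearI) (simp_all add: linear_add[OF H] linear_scale[OF H] inner_simps algebra_simps add_divide_distrib)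
    have Wv: "W v = W x + l (v - x) + (v - x) \<bullet> H (v - x) / 2" for v
    proof -
      have "W v = W z + p \<bullet> (a + (v - x)) + (a + (v - x)) \<bullet> H (a + (v - x)) / 2"
        using W[of "a + (v - x)"] by (simp add: a_def)
      moreover have "W x = W z + p \<bullet> a + a \<bullet> H a / 2" using W[of a] by (simp add: a_def)
      ultimately show ?thesis
        by (simp add: l_def linear_add[OF H] inner_add_left inner_add_right add_divide_distrib)
    qed
    have R: "\<bar>(v - x) \<bullet> H (v - x) / 2\<bar> \<le> B * h\<^sup>2 / 2" if "dist x v \<le> h" for v
    proof -
      have "\<bar>(v - x) \<bullet> H (v - x)\<bar> \<le> B * (norm (v - x))\<^sup>2" by (rule B)
      also have "\<dots> \<le> B * h\<^sup>2" using that B(2)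
        by (intro mult_left_mono power_mono) (auto simp: dist_norm norm_minus_commute)
      finally show ?thesis by simp
    qed
    show "interp Th W x \<le> W x + B * h\<^sup>2 / 2"
    proof (rule interp_le_affine[OF stencil_mesh[OF z x] l])
      fix v assume "dist x v \<le> h"
      then show "W v \<le> W x + B * h\<^sup>2 / 2 + l (v - x)" using R[of v] Wv[of v] by linarith
    qed
    have "interp Th (\<lambda>y. - W y) x \<le> - W x + B * h\<^sup>2 / 2"
    proof (rule interp_le_affine[OF stencil_mesh[OF z x]])
      show "linear (\<lambda>b. - l b)" using l by (rule linear_compose_neg)
      fix v assume "dist x v \<le> h"
      then show "- W v \<le> - W x + B * h\<^sup>2 / 2 + - l (v - x)" using R[of v] Wv[of v] by linarith
    qed
    then show "W x - B * h\<^sup>2 / 2 \<le> interp Th W x" by (simp add: interp_uminus)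
  qed
  let ?St = "stencil S \<epsilon> z"
  have "Max (interp Th W ` ?St) \<in> interp Th W ` ?St" by (intro Max_in) auto
  then obtain w where w: "w \<in> insert 0 S" "Max (interp Th W ` ?St) = interp Th W (z + \<epsilon> *\<^sub>R w)"
    unfolding stencil_eq by blast
  have nw: "norm w \<le> 1" using w(1) norm_S by auto
  have St: "z + \<epsilon> *\<^sub>R v \<in> ?St" if "v \<in> insert 0 S" for v using that unfolding stencil_eq by blast
  have mw: "- w \<in> insert 0 S" using w(1) neg_S by auto
  have Wv: "W (z + \<epsilon> *\<^sub>R v) = W z + \<epsilon> * (p \<bullet> v) + \<epsilon>\<^sup>2 * (v \<bullet> H v) / 2" for v
    unfolding W by (simp add: linear_scale[OF H] power2_eq_square)
  have Wm: "W (z + \<epsilon> *\<^sub>R (- w)) = W z - \<epsilon> * (p \<bullet> w) + \<epsilon>\<^sup>2 * (w \<bullet> H w) / 2"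
    unfolding Wv by (simp add: linear_neg[OF H])
  have "Min (interp Th W ` ?St) \<le> interp Th W (z + \<epsilon> *\<^sub>R (- w))"
    using St[OF mw] by (intro Min_le) auto
  also have "\<dots> \<le> W z - \<epsilon> * (p \<bullet> w) + \<epsilon>\<^sup>2 * (w \<bullet> H w) / 2 + B * h\<^sup>2 / 2"
    using I(1)[OF St[OF mw]] unfolding Wm .
  finally have mn: "Min (interp Th W ` ?St) \<le> W z - \<epsilon> * (p \<bullet> w) + \<epsilon>\<^sup>2 * (w \<bullet> H w) / 2 + B * h\<^sup>2 / 2" .
  have mx: "Max (interp Th W ` ?St) \<le> W z + \<epsilon> * (p \<bullet> w) + \<epsilon>\<^sup>2 * (w \<bullet> H w) / 2 + B * h\<^sup>2 / 2"
    using I(1)[OF St[OF w(1)]] unfolding w(2) Wv .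
  show thesis
  proof (rule that[OF nw])
    have "2 * W z - Max (interp Th W ` ?St) - Min (interp Th W ` ?St) \<le> F * \<epsilon>\<^sup>2"
      using le eps_pos unfolding minus_disc_inf_lap_def by (simp add: field_simps)
    then have "- (\<epsilon>\<^sup>2 * (w \<bullet> H w)) \<le> F * \<epsilon>\<^sup>2 + B * h\<^sup>2"
      using mn mx by linarith
    then have "- (w \<bullet> H w) * \<epsilon>\<^sup>2 \<le> (F + B * (h / \<epsilon>)\<^sup>2) * \<epsilon>\<^sup>2"
      using eps_pos by (simp add: algebra_simps power_divide)
    then show "- (w \<bullet> H w) \<le> F + B * (h / \<epsilon>)\<^sup>2" using eps_pos by (simp only: mult_le_cancel_right_pos zero_less_power)
    fix v assume v: "v \<in> S"
    have "interp Th W (z + \<epsilon> *\<^sub>R v) \<le> Max (interp Th W ` ?St)" using St[of v] v by (intro Max_ge) auto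
    then have "W z + \<epsilon> * (p \<bullet> v) + \<epsilon>\<^sup>2 * (v \<bullet> H v) / 2 - B * h\<^sup>2 / 2
        \<le> W z + \<epsilon> * (p \<bullet> w) + \<epsilon>\<^sup>2 * (w \<bullet> H w) / 2 + B * h\<^sup>2 / 2"
      using I(2)[OF St[of v], OF insertI2[OF v]] mx unfolding Wv by linarith
    moreover have "\<epsilon>\<^sup>2 * (w \<bullet> H w) \<le> \<epsilon>\<^sup>2 * B"
    proof (rule mult_left_mono)
      have "w \<bullet> H w \<le> B * (norm w)\<^sup>2" using B(1)[of w] by simp
      also have "\<dots> \<le> B * 1" using nw B(2) by (intro mult_left_mono) (auto simp: power_le_one)
      finally show "w \<bullet> H w \<le> B" by simp
    qed simp
    moreover have "\<epsilon>\<^sup>2 * (- B) \<le> \<epsilon>\<^sup>2 * (v \<bullet> H v)"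
      using B(1)[of v] norm_S[OF v] by (intro mult_left_mono) auto
    moreover have "B * h\<^sup>2 \<le> B * \<epsilon>\<^sup>2"
      using B(2) h_pos h_le by (intro mult_left_mono power_mono) auto
    ultimately have "\<epsilon> * (p \<bullet> v) \<le> \<epsilon> * (p \<bullet> w) + 2 * (\<epsilon>\<^sup>2 * B)"
      by (simp add: mult.commute)
    also have "\<dots> = \<epsilon> * (p \<bullet> w + 2 * B * \<epsilon>)" by (simp add: power2_eq_square algebra_simps)
    finally show "p \<bullet> v \<le> p \<bullet> w + 2 * B * \<epsilon>" using eps_pos by (simp only: mult_le_cancel_left_pos)
  qed
qed

section \<open>Smooth test functions\<close>

lemma linear_axis_expansion:
  fixes l :: "real^'n \<Rightarrow> real"
  assumes "linear l"
  shows "l a = (\<Sum>j\<in>UNIV. a $ j * l (axis j 1))"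
proof -
  have "l a = l (\<Sum>j\<in>UNIV. (a $ j) *\<^sub>R axis j 1)"
    using basis_expansion[of a] by (simp add: scalar_mult_eq_scaleR)
  also have "\<dots> = (\<Sum>j\<in>UNIV. a $ j * l (axis j 1))"
    by (simp add: linear_sum[OF assms] linear_scale[OF assms])
  finally show ?thesis .
qed

lemma line_has_derivative:
  fixes \<phi> :: "real^'n \<Rightarrow> real"
  assumes "\<phi> differentiable (at (y + t *\<^sub>R a))"
  shows "((\<lambda>t. \<phi> (y + t *\<^sub>R a)) has_real_derivative frechet_derivative \<phi> (at (y + t *\<^sub>R a)) a) (at t)"
proof -
  have d: "(\<phi> has_derivative frechet_derivative \<phi> (at (y + t *\<^sub>R a))) (at (y + t *\<^sub>R a))"
    using assms frechet_derivative_works by blast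
  have l: "((\<lambda>t. y + t *\<^sub>R a) has_derivative (\<lambda>s. s *\<^sub>R a)) (at t)"
    by (auto intro!: derivative_eq_intros)
  have "((\<lambda>t. \<phi> (y + t *\<^sub>R a)) has_derivative (\<lambda>s. frechet_derivative \<phi> (at (y + t *\<^sub>R a)) (s *\<^sub>R a))) (at t)"
    using has_derivative_compose[OF l d] .
  moreover have "frechet_derivative \<phi> (at (y + t *\<^sub>R a)) (s *\<^sub>R a) = frechet_derivative \<phi> (at (y + t *\<^sub>R a)) a * s" for s
    using linear_scale[OF has_derivative_linear[OF d]] by simp
  ultimately show ?thesis unfolding has_field_derivative_def by (simp add: fun_eq_iff)
qed

abbreviation partial :: "(real^'n \<Rightarrow> real) \<Rightarrow> 'n \<Rightarrow> real^'n \<Rightarrow> real" where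
  "partial \<phi> j y \<equiv> frechet_derivative \<phi> (at y) (axis j 1)"

lemma hess_nth: "hess \<phi> x $ i $ j = partial (partial \<phi> j) i x"
  by (simp add: hess_def)

lemma C2D:
  assumes "C2 \<phi>"
  shows "\<phi> differentiable (at x)" "partial \<phi> j differentiable (at x)"
    "continuous_on UNIV (\<lambda>x. hess \<phi> x $ i $ j)"
  using assms unfolding C2_def by auto

text \<open>The mean value theorem once in each coordinate direction. The left side is symmetric in
  \<open>i\<close> and \<open>j\<close>, which will force the Hessian to be symmetric.\<close>

lemma second_difference:
  fixes \<phi> :: "real^'n \<Rightarrow> real"
  assumes C: "C2 \<phi>" and s: "s > 0"
  shows "\<exists>\<xi>. dist x \<xi> \<le> 2 * s \<and>
    \<phi> (x + s *\<^sub>R axis i 1 + s *\<^sub>R axis j 1) - \<phi> (x + s *\<^sub>R axis i 1) - \<phi> (x + s *\<^sub>R axis j 1) + \<phi> x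
      = s\<^sup>2 * (hess \<phi> \<xi> $ i $ j)"
proof -
  let ?ei = "axis i 1 :: real^'n" and ?ej = "axis j 1 :: real^'n"
  define q where "q t = \<phi> (x + s *\<^sub>R ?ei + t *\<^sub>R ?ej) - \<phi> (x + t *\<^sub>R ?ej)" for t
  have dq: "(q has_real_derivative (partial \<phi> j (x + s *\<^sub>R ?ei + t *\<^sub>R ?ej) - partial \<phi> j (x + t *\<^sub>R ?ej))) (at t)" for t
    unfolding q_def by (intro DERIV_diff line_has_derivative C2D(1)[OF C])
  obtain \<tau> where \<tau>: "0 < \<tau>" "\<tau> < s"
    "q s - q 0 = (s - 0) * (partial \<phi> j (x + s *\<^sub>R ?ei + \<tau> *\<^sub>R ?ej) - partial \<phi> j (x + \<tau> *\<^sub>R ?ej))"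
    using MVT2[OF s dq] by blast
  define p where "p t = partial \<phi> j ((x + \<tau> *\<^sub>R ?ej) + t *\<^sub>R ?ei)" for t
  have dp: "(p has_real_derivative (hess \<phi> ((x + \<tau> *\<^sub>R ?ej) + t *\<^sub>R ?ei) $ i $ j)) (at t)" for t
    unfolding p_def hess_nth by (intro line_has_derivative C2D(2)[OF C])
  obtain \<sigma> where \<sigma>: "0 < \<sigma>" "\<sigma> < s"
    "p s - p 0 = (s - 0) * (hess \<phi> ((x + \<tau> *\<^sub>R ?ej) + \<sigma> *\<^sub>R ?ei) $ i $ j)"
    using MVT2[OF s dp] by blast
  let ?\<xi> = "(x + \<tau> *\<^sub>R ?ej) + \<sigma> *\<^sub>R ?ei"
  have "dist x ?\<xi> = norm (\<tau> *\<^sub>R ?ej + \<sigma> *\<^sub>R ?ei)"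
    by (metis add.assoc add_diff_cancel_left' dist_commute dist_norm)
  also have "\<dots> \<le> norm (\<tau> *\<^sub>R ?ej) + norm (\<sigma> *\<^sub>R ?ei)" by (rule norm_triangle_ineq)
  also have "\<dots> \<le> 2 * s" using \<tau> \<sigma> by simp
  finally have d: "dist x ?\<xi> \<le> 2 * s" .
  have "q s - q 0 = s * (p s - p 0)"
    unfolding \<tau>(3) by (simp add: p_def add.assoc add.commute add.left_commute)
  then have "q s - q 0 = s\<^sup>2 * (hess \<phi> ?\<xi> $ i $ j)"
    unfolding \<sigma>(3) by (simp add: power2_eq_square)
  then show ?thesis using d by (intro exI[of _ ?\<xi>]) (simp add: q_def)
qed

lemma hess_continuous:
  assumes C: "C2 \<phi>" and e: "e > 0"
  shows "\<exists>d>0. \<forall>y. dist x y < d \<longrightarrow> (\<forall>i j. \<bar>hess \<phi> y $ i $ j - hess \<phi> x $ i $ j\<bar> < e)"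
proof -
  have "\<forall>\<^sub>F y in nhds x. \<forall>i j. dist (hess \<phi> y $ i $ j) (hess \<phi> x $ i $ j) < e"
  proof (intro eventually_all_finite)
    fix i j
    have "isCont (\<lambda>x. hess \<phi> x $ i $ j) x"
      using C2D(3)[OF C, of i j] by (simp add: continuous_on_eq_continuous_at)
    then have "((\<lambda>x. hess \<phi> x $ i $ j) \<longlongrightarrow> hess \<phi> x $ i $ j) (nhds x)"
      unfolding isCont_def using tendsto_at_iff_tendsto_nhds[of "\<lambda>x. hess \<phi> x $ i $ j" x] by blast
    then show "\<forall>\<^sub>F y in nhds x. dist (hess \<phi> y $ i $ j) (hess \<phi> x $ i $ j) < e"
      using e by (rule tendstoD)
  qed
  then show ?thesis unfolding eventually_nhds_metric by (auto simp: dist_real_def dist_commute)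
qed

lemma hess_symmetric:
  assumes C: "C2 \<phi>"
  shows "hess \<phi> x $ i $ j = hess \<phi> x $ j $ i"
proof (rule ccontr)
  assume neg: "\<not> ?thesis"
  define e where "e = \<bar>hess \<phi> x $ i $ j - hess \<phi> x $ j $ i\<bar> / 2"
  have "e > 0" using neg by (simp add: e_def)
  then obtain d where d: "d > 0" "\<And>y i j. dist x y < d \<Longrightarrow> \<bar>hess \<phi> y $ i $ j - hess \<phi> x $ i $ j\<bar> < e"
    using hess_continuous[OF C, of e x] by blast
  define s where "s = d / 3"
  have s: "s > 0" "2 * s < d" using d(1) by (auto simp: s_def)
  obtain \<xi> where \<xi>: "dist x \<xi> \<le> 2 * s"
    "\<phi> (x + s *\<^sub>R axis i 1 + s *\<^sub>R axis j 1) - \<phi> (x + s *\<^sub>R axis i 1) - \<phi> (x + s *\<^sub>R axis j 1) + \<phi> x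
      = s\<^sup>2 * (hess \<phi> \<xi> $ i $ j)"
    using second_difference[OF C s(1), of x i j] by blast
  obtain \<zeta> where \<zeta>: "dist x \<zeta> \<le> 2 * s"
    "\<phi> (x + s *\<^sub>R axis j 1 + s *\<^sub>R axis i 1) - \<phi> (x + s *\<^sub>R axis j 1) - \<phi> (x + s *\<^sub>R axis i 1) + \<phi> x
      = s\<^sup>2 * (hess \<phi> \<zeta> $ j $ i)"
    using second_difference[OF C s(1), of x j i] by blast
  have comm: "x + s *\<^sub>R axis j 1 + s *\<^sub>R axis i 1 = x + s *\<^sub>R axis i 1 + s *\<^sub>R axis j 1" by simp
  have "s\<^sup>2 * (hess \<phi> \<xi> $ i $ j) = s\<^sup>2 * (hess \<phi> \<zeta> $ j $ i)"
    using \<xi>(2) \<zeta>(2) unfolding comm by linarith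
  then have "hess \<phi> \<xi> $ i $ j = hess \<phi> \<zeta> $ j $ i" using s by simp
  moreover have "\<bar>hess \<phi> \<xi> $ i $ j - hess \<phi> x $ i $ j\<bar> < e" using d(2)[of \<xi> i j] \<xi>(1) s by simp
  moreover have "\<bar>hess \<phi> \<zeta> $ j $ i - hess \<phi> x $ j $ i\<bar> < e" using d(2)[of \<zeta> j i] \<zeta>(1) s by simp
  moreover have False if "a = b" "\<bar>a - c\<bar> < e" "\<bar>b - d\<bar> < e" "2 * e = \<bar>c - d\<bar>" for a b c d :: real
    using that by (auto simp: abs_if split: if_splits)
  moreover have "2 * e = \<bar>hess \<phi> x $ i $ j - hess \<phi> x $ j $ i\<bar>" by (simp add: e_def)
  ultimately show False by blast
qed

lemma quadratic_form_sum:
  fixes A :: "real^'n^'n"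
  shows "a \<bullet> (A *v a) = (\<Sum>i\<in>UNIV. \<Sum>j\<in>UNIV. a $ i * a $ j * A $ i $ j)"
  by (simp add: inner_vec_def matrix_vector_mult_def sum_distrib_left algebra_simps)

text \<open>Taylor's formula along the segment from \<open>x\<close> to \<open>y\<close> with
  Lagrange remainder. Continuity of the Hessian moves the remainder to \<open>x\<close>; each of its
  entries may err by \<eta> divided by their number.\<close>

lemma C2_taylor:
  fixes \<phi> :: "real^'n \<Rightarrow> real"
  assumes C: "C2 \<phi>" and e: "\<eta> > 0"
  shows "\<exists>r>0. \<forall>y\<in>ball x r. \<bar>\<phi> y - (\<phi> x + grad \<phi> x \<bullet> (y - x) + (y - x) \<bullet> (hess \<phi> x *v (y - x)) / 2)\<bar> \<le> \<eta> * (norm (y - x))\<^sup>2"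
proof -
  define e where "e = \<eta> / (real CARD('n))\<^sup>2"
  have e0: "e > 0" using assms by (simp add: e_def)
  obtain d where d: "d > 0" "\<And>y i j. dist x y < d \<Longrightarrow> \<bar>hess \<phi> y $ i $ j - hess \<phi> x $ i $ j\<bar> < e"
    using hess_continuous[OF C e0] by blast
  have "\<bar>\<phi> y - (\<phi> x + grad \<phi> x \<bullet> (y - x) + (y - x) \<bullet> (hess \<phi> x *v (y - x)) / 2)\<bar> \<le> \<eta> * (norm (y - x))\<^sup>2"
    if y: "y \<in> ball x d" for y
  proof -
    define a where "a = y - x"
    \<comment> \<open>\<phi> on the segment and its first two derivatives, bundled as one family
      indexed by the order of differentiation for Maclaurin's formula.\<close>
    define g where "g m t = (if m = 0 then \<phi> (x + t *\<^sub>R a) else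
       if m = 1 then (\<Sum>j\<in>UNIV. a $ j * partial \<phi> j (x + t *\<^sub>R a))
       else a \<bullet> (hess \<phi> (x + t *\<^sub>R a) *v a))" for m :: nat and t
    have fe: "frechet_derivative \<psi> (at z) a = (\<Sum>j\<in>UNIV. a $ j * partial \<psi> j z)"
      if "\<psi> differentiable (at z)" for \<psi> :: "real^'n \<Rightarrow> real" and z
      using linear_axis_expansion linear_frechet_derivative that by blast
    have d0: "(g 0 has_real_derivative g 1 t) (at t)" for t
    proof -
      have "((\<lambda>t. \<phi> (x + t *\<^sub>R a)) has_real_derivative frechet_derivative \<phi> (at (x + t *\<^sub>R a)) a) (at t)"
        by (rule line_has_derivative[OF C2D(1)[OF C]])
      moreover have "g 0 = (\<lambda>t. \<phi> (x + t *\<^sub>R a))" by (simp add: g_def fun_eq_iff)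
      ultimately show ?thesis unfolding fe[OF C2D(1)[OF C]] by (simp add: g_def)
    qed
    have d1: "(g 1 has_real_derivative g 2 t) (at t)" for t
    proof -
      have "((\<lambda>t. \<Sum>j\<in>UNIV. a $ j * partial \<phi> j (x + t *\<^sub>R a)) has_real_derivative
          (\<Sum>j\<in>UNIV. a $ j * frechet_derivative (partial \<phi> j) (at (x + t *\<^sub>R a)) a)) (at t)"
        by (intro DERIV_sum DERIV_cmult line_has_derivative C2D(2)[OF C])
      moreover have "(\<Sum>j\<in>UNIV. a $ j * frechet_derivative (partial \<phi> j) (at (x + t *\<^sub>R a)) a) = g 2 t"
        unfolding g_def quadratic_form_sum fe[OF C2D(2)[OF C]] hess_nth
        by (subst sum.swap) (simp add: sum_distrib_left mult.assoc mult.left_commute)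
      moreover have "g 1 = (\<lambda>t. \<Sum>j\<in>UNIV. a $ j * partial \<phi> j (x + t *\<^sub>R a))" by (simp add: g_def fun_eq_iff)
      ultimately show ?thesis by simp
    qed
    have "\<forall>m t. m < 2 \<and> 0 \<le> t \<and> t \<le> 1 \<longrightarrow> DERIV (g m) t :> g (Suc m) t"
    proof (intro allI impI)
      fix m :: nat and t :: real assume "m < 2 \<and> 0 \<le> t \<and> t \<le> 1"
      then have "m = 0 \<or> m = 1" by auto
      then show "DERIV (g m) t :> g (Suc m) t" using d0[of t] d1[of t] by (auto simp: numeral_2_eq_2)
    qed
    from Maclaurin2[of 1 g "g 0" 2, OF zero_less_one refl this]
    obtain t where t: "0 < t" "t \<le> 1" "g 0 1 = (\<Sum>m<2. g m 0 / fact m * 1 ^ m) + g 2 t / fact 2 * 1\<^sup>2"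
      by blast
    have g1: "g 1 0 = grad \<phi> x \<bullet> a" by (simp add: g_def grad_def inner_vec_def mult.commute)
    have eq: "\<phi> y = \<phi> x + grad \<phi> x \<bullet> a + g 2 t / 2"
    proof -
      have "g 0 1 = g 0 0 + g 1 0 + g 2 t / 2"
        using t(3) by (simp add: numeral_2_eq_2)
      then show ?thesis unfolding g1 by (simp add: g_def a_def)
    qed
    have near: "dist x (x + t *\<^sub>R a) < d"
    proof -
      have "dist x (x + t *\<^sub>R a) = t * norm a" using t by (simp add: dist_norm)
      also have "\<dots> \<le> norm a" using t by (simp add: mult_left_le_one_le)
      also have "\<dots> < d" using y by (simp add: a_def dist_norm norm_minus_commute)
      finally show ?thesis .
    qed
    have "\<bar>g 2 t - a \<bullet> (hess \<phi> x *v a)\<bar> = \<bar>\<Sum>i\<in>UNIV. \<Sum>j\<in>UNIV. a $ i * a $ j * (hess \<phi> (x + t *\<^sub>R a) $ i $ j - hess \<phi> x $ i $ j)\<bar>"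
      by (simp add: g_def quadratic_form_sum right_diff_distrib sum_subtractf)
    also have "\<dots> \<le> (\<Sum>i\<in>UNIV. \<Sum>j\<in>UNIV. \<bar>a $ i * a $ j * (hess \<phi> (x + t *\<^sub>R a) $ i $ j - hess \<phi> x $ i $ j)\<bar>)"
      by (intro order_trans[OF sum_abs] sum_mono sum_abs)
    also have "\<dots> \<le> (\<Sum>i\<in>(UNIV :: 'n set). \<Sum>j\<in>(UNIV :: 'n set). norm a * norm a * e)"
    proof (intro sum_mono)
      fix i j
      have "\<bar>a $ i * a $ j * (hess \<phi> (x + t *\<^sub>R a) $ i $ j - hess \<phi> x $ i $ j)\<bar>
          = \<bar>a $ i\<bar> * \<bar>a $ j\<bar> * \<bar>hess \<phi> (x + t *\<^sub>R a) $ i $ j - hess \<phi> x $ i $ j\<bar>" by (simp add: abs_mult)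
      also have "\<dots> \<le> norm a * norm a * e"
        using d(2)[OF near, of i j] by (intro mult_mono) (auto simp: component_le_norm_cart)
      finally show "\<bar>a $ i * a $ j * (hess \<phi> (x + t *\<^sub>R a) $ i $ j - hess \<phi> x $ i $ j)\<bar> \<le> norm a * norm a * e" .
    qed
    also have "\<dots> = \<eta> * (norm a)\<^sup>2" by (simp add: e_def power2_eq_square)
    finally have fin: "\<bar>g 2 t - a \<bullet> (hess \<phi> x *v a)\<bar> \<le> \<eta> * (norm a)\<^sup>2" .
    moreover have "\<eta> * (norm a)\<^sup>2 \<ge> 0" using assms(2) by simp
    ultimately have "\<bar>\<phi> y - (\<phi> x + grad \<phi> x \<bullet> a + a \<bullet> (hess \<phi> x *v a) / 2)\<bar> \<le> \<eta> * (norm a)\<^sup>2"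
      unfolding eq by (simp add: abs_le_iff)
    then show ?thesis by (simp add: a_def)
  qed
  then show ?thesis using d(1) by blast
qed

section \<open>Eigenvalues of symmetric matrices\<close>

lemma symmetric_inner_commute:
  fixes A :: "real^'n^'n"
  assumes "\<And>i j. A $ i $ j = A $ j $ i"
  shows "x \<bullet> (A *v y) = (A *v x) \<bullet> y"
proof -
  have "transpose A = A" using assms by (simp add: transpose_def vec_eq_iff)
  then have "A *v x = x v* A" by (metis vector_transpose_matrix)
  then show ?thesis by (simp add: dot_lmul_matrix)
qed

text \<open>Eigenvectors to different eigenvalues are orthogonal, hence finitely many, and the
  maximum of the quadratic form on the unit sphere is itself an eigenvalue. Finiteness and
  nonemptiness give the \<open>Max\<close> and \<open>Min\<close> in the infinity Laplacians their
  meaning.\<close>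

lemma symmetric_eigenvalues:
  fixes A :: "real^'n^'n"
  assumes sym: "\<And>i j. A $ i $ j = A $ j $ i"
  shows "finite (eigenvalues A)" "eigenvalues A \<noteq> {}" "v \<bullet> (A *v v) \<le> Max (eigenvalues A) * (norm v)\<^sup>2"
proof -
  note comm = symmetric_inner_commute[OF sym]
  define ev where "ev c = (SOME v. v \<noteq> 0 \<and> A *v v = c *\<^sub>R v)" for c
  have ev: "ev c \<noteq> 0" "A *v ev c = c *\<^sub>R ev c" if "c \<in> eigenvalues A" for c
    using that someI_ex[of "\<lambda>v. v \<noteq> 0 \<and> A *v v = c *\<^sub>R v"] unfolding ev_def eigenvalues_def by auto
  have orth: "ev c \<bullet> ev d = 0" if "c \<in> eigenvalues A" "d \<in> eigenvalues A" "c \<noteq> d" for c d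
  proof -
    have "d * (ev c \<bullet> ev d) = c * (ev c \<bullet> ev d)"
      using comm[of "ev c" "ev d"] ev[OF that(1)] ev[OF that(2)] by simp
    then show ?thesis using that(3) by simp
  qed
  have "pairwise orthogonal (ev ` eigenvalues A)"
    using orth by (fastforce simp: pairwise_def orthogonal_def)
  moreover have "0 \<notin> ev ` eigenvalues A" using ev(1) by force
  ultimately have "finite (ev ` eigenvalues A)"
    using pairwise_orthogonal_independent independent_imp_finite by blast
  moreover have "inj_on ev (eigenvalues A)"
    using orth ev(1) by (intro inj_onI) (metis inner_eq_zero_iff)
  ultimately show fin: "finite (eigenvalues A)" using finite_imageD by blast
  have "continuous_on (sphere 0 1) (\<lambda>v. v \<bullet> (A *v v))"
    by (intro continuous_intros linear_continuous_on_compose[OF continuous_on_id]) auto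
  moreover have "sphere (0 :: real^'n) 1 \<noteq> {}" by simp
  ultimately have "\<exists>w\<in>sphere 0 1. \<forall>v\<in>sphere 0 1. v \<bullet> (A *v v) \<le> w \<bullet> (A *v w)"
    by (intro continuous_attains_sup compact_sphere)
  then obtain w where w: "norm w = 1" "\<And>v. norm v = 1 \<Longrightarrow> v \<bullet> (A *v v) \<le> w \<bullet> (A *v w)" by auto
  define M where "M = w \<bullet> (A *v w)"
  have le: "v \<bullet> (A *v v) \<le> M * (norm v)\<^sup>2" for v
  proof (cases "v = 0")
    case False
    have "((1 / norm v) *\<^sub>R v) \<bullet> (A *v ((1 / norm v) *\<^sub>R v)) \<le> M"
      unfolding M_def using False by (intro w(2)) simp
    then have "(v \<bullet> (A *v v)) / (norm v)\<^sup>2 \<le> M"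
      by (simp add: matrix_vector_mult_scaleR power2_eq_square)
    then show ?thesis using False by (simp add: divide_le_eq)
  qed simp
  \<comment> \<open>First variation at the maximiser: \<open>2 * t * b \<le> t^2 * c\<close> for all
    \<open>t\<close>, tested with \<open>t = b / c\<close>.\<close>
  have grad0: "z \<bullet> (A *v w - M *\<^sub>R w) = 0" for z
  proof -
    define b where "b = z \<bullet> (A *v w - M *\<^sub>R w)"
    define c where "c = \<bar>z \<bullet> (A *v z) - M * (norm z)\<^sup>2\<bar> + 1"
    have ineq: "2 * t * b \<le> t\<^sup>2 * c" for t
    proof -
      have "(w + t *\<^sub>R z) \<bullet> (A *v (w + t *\<^sub>R z)) \<le> M * (norm (w + t *\<^sub>R z))\<^sup>2" by (rule le)
      moreover have "(w + t *\<^sub>R z) \<bullet> (A *v (w + t *\<^sub>R z)) = M + 2 * t * (z \<bullet> (A *v w)) + t\<^sup>2 * (z \<bullet> (A *v z))"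
        using comm[of w z] by (simp add: M_def matrix_vector_right_distrib matrix_vector_mult_scaleR inner_simps
            power2_eq_square algebra_simps inner_commute)
      moreover have "(norm (w + t *\<^sub>R z))\<^sup>2 = 1 + 2 * t * (z \<bullet> w) + t\<^sup>2 * (norm z)\<^sup>2"
        using w(1) unfolding power2_norm_eq_inner norm_eq_1
        by (simp add: inner_simps inner_commute power2_eq_square del: dot_square_norm)
      ultimately have "2 * t * b \<le> t\<^sup>2 * (M * (norm z)\<^sup>2 - z \<bullet> (A *v z))"
        by (simp add: b_def inner_simps algebra_simps)
      also have "\<dots> \<le> t\<^sup>2 * c" unfolding c_def by (intro mult_left_mono) auto
      finally show ?thesis .
    qed
    have c: "c > 0" by (simp add: c_def)
    have "2 * (b / c) * b \<le> (b / c)\<^sup>2 * c" by (rule ineq)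
    then have "b\<^sup>2 \<le> 0" using c by (simp add: power2_eq_square field_simps)
    then show ?thesis by (simp add: b_def)
  qed
  have "A *v w = M *\<^sub>R w" using grad0[of "A *v w - M *\<^sub>R w"] by simp
  then have M: "M \<in> eigenvalues A" unfolding eigenvalues_def using w(1) by (intro CollectI exI[of _ w]) auto
  then show "eigenvalues A \<noteq> {}" by blast
  have "M \<le> Max (eigenvalues A)" using fin M by (rule Max_ge)
  then show "v \<bullet> (A *v v) \<le> Max (eigenvalues A) * (norm v)\<^sup>2"
    using le[of v] by (meson mult_right_mono order_trans zero_le_power2)
qed

text \<open>
  Recovers the full inequality at critical points: tilting the touching paraboloid makes it touch
  at a point where its gradient does not vanish.
\<close>

lemma visc_sub_no_concave_touching:
  fixes u :: "'a::euclidean_space \<Rightarrow> real"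
  assumes usc: "usc_on (ball x0 R) u" and R: "R > 0"
    and sub: "\<And>x. x \<in> ball x0 R \<Longrightarrow> visc_sub u x d"
    and c: "0 < c'" "d < c'" "c' < c"
    and touch: "\<And>y. y \<in> ball x0 R \<Longrightarrow> u y \<le> u x0 - c / 2 * (norm (y - x0))\<^sup>2"
  shows False
proof -
  define \<rho> where "\<rho> = R / 2"
  \<comment> \<open>Small enough that \<open>c' * (1 + \<kappa>)^2 < c\<close>: with the vertex
    moved by \<delta>, the flatter paraboloid still attains its contact inside the ball of radius
    \<rho>.\<close>
  define \<kappa> where "\<kappa> = min 1 ((c - c') / (4 * c'))"
  define \<delta> where "\<delta> = \<rho> * \<kappa>"
  define b :: 'a where "b = (SOME b. b \<in> Basis)"
  define z where "z = x0 + \<delta> *\<^sub>R b"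
  have nb: "norm b = 1" unfolding b_def by (simp add: SOME_Basis)
  have \<kappa>: "0 < \<kappa>" "\<kappa> \<le> 1" "4 * c' * \<kappa> \<le> c - c'"
    using c by (auto simp: \<kappa>_def min_def field_simps)
  have \<rho>: "0 < \<rho>" "\<rho> < R" using R by (auto simp: \<rho>_def)
  have \<delta>: "0 < \<delta>" "\<delta> \<le> \<rho>" using \<kappa> \<rho> by (auto simp: \<delta>_def)
  have dz: "norm (z - x0) = \<delta>" using \<delta> nb by (simp add: z_def)
  have sub_ball: "cball x0 \<rho> \<subseteq> ball x0 R" using \<rho> by auto
  have big: "c' * (\<rho> + \<delta>)\<^sup>2 < c * \<rho>\<^sup>2"
  proof -
    have "\<kappa>\<^sup>2 \<le> \<kappa>" using \<kappa> by (simp add: power2_eq_square mult_left_le)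
    then have "(1 + \<kappa>)\<^sup>2 \<le> 1 + 3 * \<kappa>" by (simp add: power2_sum)
    then have "c' * (1 + \<kappa>)\<^sup>2 \<le> c' * (1 + 3 * \<kappa>)" using c by (intro mult_left_mono) auto
    also have "\<dots> < c' + 4 * c' * \<kappa>" using c \<kappa> by (simp add: algebra_simps)
    also have "\<dots> \<le> c" using \<kappa> by simp
    finally have "c' * (1 + \<kappa>)\<^sup>2 * \<rho>\<^sup>2 < c * \<rho>\<^sup>2" using \<rho> by simp
    moreover have "\<rho> + \<delta> = (1 + \<kappa>) * \<rho>" by (simp add: \<delta>_def algebra_simps)
    ultimately show ?thesis by (simp add: power_mult_distrib mult.assoc)
  qed
  have "usc_on (cball x0 \<rho>) (\<lambda>y. u y + c' / 2 * (norm (y - z))\<^sup>2)"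
    by (intro usc_on_add usc_on_subset[OF usc sub_ball] continuous_on_imp_usc_on continuous_intros)
  then obtain y where y: "y \<in> cball x0 \<rho>"
    "\<And>x. x \<in> cball x0 \<rho> \<Longrightarrow> u x + c' / 2 * (norm (x - z))\<^sup>2 \<le> u y + c' / 2 * (norm (y - z))\<^sup>2"
    by (rule usc_on_attains_sup) (use \<rho> in auto)
  have atx0: "u x0 + c' / 2 * \<delta>\<^sup>2 \<le> u y + c' / 2 * (norm (y - z))\<^sup>2"
    using y(2)[of x0] \<rho> dz by (simp add: norm_minus_commute)
  have uy: "u y \<le> u x0 - c / 2 * (norm (y - x0))\<^sup>2" using touch y(1) sub_ball by blast
  have inside: "norm (y - x0) < \<rho>"
  proof (rule ccontr)
    assume "\<not> ?thesis"
    then have eq: "norm (y - x0) = \<rho>" using y(1) by (simp add: dist_norm norm_minus_commute)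
    have "norm (y - z) \<le> norm (y - x0) + norm (z - x0)"
      using norm_triangle_ineq4[of "y - x0" "z - x0"] by simp
    then have "(norm (y - z))\<^sup>2 \<le> (\<rho> + \<delta>)\<^sup>2" using eq dz by (intro power_mono) auto
    then have "c' * (norm (y - z))\<^sup>2 \<le> c' * (\<rho> + \<delta>)\<^sup>2" using c by (intro mult_left_mono) auto
    moreover have "c' * \<delta>\<^sup>2 \<ge> 0" using c by simp
    ultimately show False using atx0 uy big eq by simp
  qed
  have vs: "visc_sub u y d" using sub y(1) sub_ball by blast
  define p where "p = - (c' *\<^sub>R (y - z))"
  have lin: "linear (\<lambda>v :: 'a. (- c') *\<^sub>R v)" by (rule linear_scale_self)
  have "u x \<le> u y + p \<bullet> (x - y) + (x - y) \<bullet> ((- c') *\<^sub>R (x - y)) / 2" if x: "x \<in> ball y (\<rho> - norm (y - x0))" for x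
  proof -
    have "dist x0 x \<le> dist x0 y + dist y x" by (rule dist_triangle)
    then have "x \<in> cball x0 \<rho>" using x by (simp add: dist_norm norm_minus_commute)
    from y(2)[OF this] have "u x \<le> u y + c' / 2 * (norm (y - z))\<^sup>2 - c' / 2 * (norm (x - z))\<^sup>2" by simp
    also have "(norm (x - z))\<^sup>2 = (norm (y - z))\<^sup>2 + 2 * ((y - z) \<bullet> (x - y)) + (x - y) \<bullet> (x - y)"
    proof -
      have "x - z = (y - z) + (x - y)" by simp
      then have "(norm (x - z))\<^sup>2 = ((y - z) + (x - y)) \<bullet> ((y - z) + (x - y))" by (simp only: power2_norm_eq_inner)
      also have "\<dots> = (y - z) \<bullet> (y - z) + 2 * ((y - z) \<bullet> (x - y)) + (x - y) \<bullet> (x - y)"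
        unfolding inner_add_left inner_add_right by (simp add: inner_commute)
      finally show ?thesis by (simp only: power2_norm_eq_inner)
    qed
    also have "u y + c' / 2 * (norm (y - z))\<^sup>2 - c' / 2 * ((norm (y - z))\<^sup>2 + 2 * ((y - z) \<bullet> (x - y)) + (x - y) \<bullet> (x - y))
       = u y + p \<bullet> (x - y) + (x - y) \<bullet> ((- c') *\<^sub>R (x - y)) / 2"
    proof -
      have "u y + c' / 2 * N - c' / 2 * (N + 2 * I + Q) = u y + - (c' * I) + (- c') * Q / 2" for N I Q
        by (simp add: algebra_simps)
      then show ?thesis unfolding p_def inner_minus_left inner_scaleR_left inner_scaleR_right by blast
    qed
    finally show ?thesis .
  qed
  moreover have "\<rho> - norm (y - x0) > 0" using inside by simp
  ultimately obtain w where w: "norm w \<le> 1" "p = norm p *\<^sub>R w" "- (w \<bullet> ((- c') *\<^sub>R w)) \<le> d"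
    using vs lin unfolding visc_sub_def by blast
  \<comment> \<open>The touching gradient vanishes only at \<open>y = z\<close>, where
    \<open>u\<close> is too low compared with \<open>x0\<close>. Anywhere else \<open>w\<close> is a
    unit vector and the inequality reads \<open>c' \<le> d\<close>.\<close>
  show False
  proof (cases "y = z")
    case True
    then have "c' / 2 * \<delta>\<^sup>2 \<le> - (c / 2 * \<delta>\<^sup>2)" using atx0 uy dz by simp
    moreover have "c' / 2 * \<delta>\<^sup>2 > 0" "c / 2 * \<delta>\<^sup>2 > 0" using c \<delta> by simp_all
    ultimately show False by linarith
  next
    case False
    then have "norm p > 0" using c by (simp add: p_def)
    moreover have "norm p = norm p * norm w" using arg_cong[OF w(2), of norm] by simp
    ultimately have "norm w = 1" by simp
    then have "w \<bullet> w = 1" by (simp add: norm_eq_1)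
    then show False using w(3) c by simp
  qed
qed


text \<open>Adding \<open>\<eta> * (norm (y - x0))^2\<close> to the Taylor polynomial gives a
  quadratic touching from above. If the gradient is nonzero, \<open>w\<close> is its unit direction
  and \<eta> tends to 0. If it vanishes, the only way to evade the inequality is a short
  \<open>w\<close>; that requires \<open>0 \<le> f x0\<close> and a strictly concave contact, which
  is then ruled out by tilting.\<close>

lemma visc_sub_inf_lap_plus:
  fixes u \<phi> :: "real^'n \<Rightarrow> real"
  assumes x0: "x0 \<in> N" and N: "open N"
    and u: "continuous_on N u" and f: "continuous_on N f"
    and sub: "\<And>x. x \<in> N \<Longrightarrow> visc_sub u x (f x)"
    and C: "C2 \<phi>" and r: "r > 0" "\<And>y. y \<in> N \<inter> ball x0 r \<Longrightarrow> u y - \<phi> y \<le> u x0 - \<phi> x0"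
  shows "- inf_lap_plus \<phi> x0 \<le> f x0"
proof -
  define p where "p = grad \<phi> x0"
  define A where "A = hess \<phi> x0"
  have touch: "\<exists>\<rho>>0. ball x0 \<rho> \<subseteq> N \<and> (\<forall>y\<in>ball x0 \<rho>. u y \<le> u x0 + p \<bullet> (y - x0) + (y - x0) \<bullet> (A *v (y - x0)) / 2 + \<eta> * (norm (y - x0))\<^sup>2)"
    if e: "\<eta> > 0" for \<eta>
  proof -
    obtain r1 where r1: "r1 > 0" "\<And>y. y \<in> ball x0 r1 \<Longrightarrow>
       \<bar>\<phi> y - (\<phi> x0 + p \<bullet> (y - x0) + (y - x0) \<bullet> (A *v (y - x0)) / 2)\<bar> \<le> \<eta> * (norm (y - x0))\<^sup>2"
      using C2_taylor[OF C e, of x0] unfolding p_def A_def by blast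
    obtain r2 where r2: "r2 > 0" "ball x0 r2 \<subseteq> N" using N x0 openE by blast
    show ?thesis
    proof (intro exI[of _ "min r (min r1 r2)"] conjI ballI)
      show "min r (min r1 r2) > 0" "ball x0 (min r (min r1 r2)) \<subseteq> N" using r r1 r2 by auto
      fix y assume y: "y \<in> ball x0 (min r (min r1 r2))"
      then have "u y - \<phi> y \<le> u x0 - \<phi> x0" using r(2)[of y] r2 by auto
      moreover have "\<bar>\<phi> y - (\<phi> x0 + p \<bullet> (y - x0) + (y - x0) \<bullet> (A *v (y - x0)) / 2)\<bar> \<le> \<eta> * (norm (y - x0))\<^sup>2"
        using r1(2)[of y] y by auto
      ultimately show "u y \<le> u x0 + p \<bullet> (y - x0) + (y - x0) \<bullet> (A *v (y - x0)) / 2 + \<eta> * (norm (y - x0))\<^sup>2"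
        by linarith
    qed
  qed
  have weak: "\<exists>w. norm w \<le> 1 \<and> p = norm p *\<^sub>R w \<and> - (w \<bullet> (A *v w)) - 2 * \<eta> * (norm w)\<^sup>2 \<le> f x0" if e: "\<eta> > 0" for \<eta>
  proof -
    define H where "H v = A *v v + (2 * \<eta>) *\<^sub>R v" for v
    have lin: "linear H" unfolding H_def
      by (intro linear_compose_add matrix_vector_mul_linear linear_scale_self)
    have quad: "v \<bullet> H v = v \<bullet> (A *v v) + 2 * \<eta> * (norm v)\<^sup>2" for v
      by (simp add: H_def inner_add_right power2_norm_eq_inner)
    obtain \<rho> where \<rho>: "\<rho> > 0" "\<And>y. y \<in> ball x0 \<rho> \<Longrightarrow> u y \<le> u x0 + p \<bullet> (y - x0) + (y - x0) \<bullet> (A *v (y - x0)) / 2 + \<eta> * (norm (y - x0))\<^sup>2"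
      using touch[OF e] by blast
    have "\<forall>y\<in>ball x0 \<rho>. u y \<le> u x0 + p \<bullet> (y - x0) + (y - x0) \<bullet> H (y - x0) / 2"
    proof
      fix y assume "y \<in> ball x0 \<rho>"
      from \<rho>(2)[OF this] show "u y \<le> u x0 + p \<bullet> (y - x0) + (y - x0) \<bullet> H (y - x0) / 2"
        unfolding quad by (simp add: add_divide_distrib)
    qed
    then obtain w where "norm w \<le> 1" "p = norm p *\<^sub>R w" "- (w \<bullet> H w) \<le> f x0"
      using sub[OF x0] lin \<rho>(1) unfolding visc_sub_def by blast
    then show ?thesis unfolding quad by (intro exI[of _ w]) simp
  qed
  show ?thesis
  proof (cases "p = 0")
    case False
    have "- inf_lap_plus \<phi> x0 \<le> f x0 + e" if e: "e > 0" for e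
    proof -
      obtain w where w: "norm w \<le> 1" "p = norm p *\<^sub>R w" "- (w \<bullet> (A *v w)) - e * (norm w)\<^sup>2 \<le> f x0"
        using weak[of "e / 2"] e by auto
      have "norm p = norm p * norm w" using arg_cong[OF w(2), of norm] by simp
      then have nw: "norm w = 1" using False by simp
      have "p \<bullet> (A *v p) = (norm p)\<^sup>2 * (w \<bullet> (A *v w))"
        by (subst (1 2) w(2)) (simp add: matrix_vector_mult_scaleR power2_eq_square)
      then have "inf_lap_plus \<phi> x0 = w \<bullet> (A *v w)"
        using False by (simp add: inf_lap_plus_def p_def A_def)
      then show ?thesis using w(3) nw by simp
    qed
    then show ?thesis by (rule field_le_epsilon)
  next
    case True
    define c where "c = - Max (eigenvalues A)"
    have eig: "v \<bullet> (A *v v) \<le> - c * (norm v)\<^sup>2" for v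
      using symmetric_eigenvalues(3)[of A v] hess_symmetric[OF C] by (simp add: A_def c_def)
    have lap: "- inf_lap_plus \<phi> x0 = c" using True by (simp add: inf_lap_plus_def p_def A_def c_def)
    show ?thesis
    proof (rule ccontr)
      assume "\<not> ?thesis"
      then have cf: "f x0 < c" unfolding lap by simp
      \<comment> \<open>This choice makes \<open>c1\<close> the midpoint of \<open>f x0\<close> and
        \<open>c\<close>.\<close>
      define \<eta> where "\<eta> = (c - f x0) / 4"
      define c1 where "c1 = c - 2 * \<eta>"
      have e: "\<eta> > 0" and c1: "f x0 < c1" using cf by (auto simp: \<eta>_def c1_def field_simps)
      obtain w where w: "norm w \<le> 1" "- (w \<bullet> (A *v w)) - 2 * \<eta> * (norm w)\<^sup>2 \<le> f x0"
        using weak[OF e] by blast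
      have cw: "c1 * (norm w)\<^sup>2 \<le> f x0" using w(2) eig[of w] by (simp add: c1_def algebra_simps)
      have w1: "(norm w)\<^sup>2 \<le> 1" using w(1) by (simp add: power_le_one)
      have c10: "c1 > 0"
      proof (rule ccontr)
        assume "\<not> c1 > 0"
        then have "c1 * 1 \<le> c1 * (norm w)\<^sup>2" using w1 by (intro mult_left_mono_neg) auto
        then show False using cw c1 by simp
      qed
      have f0: "f x0 \<ge> 0" using cw c10 by (meson less_imp_le mult_nonneg_nonneg order_trans zero_le_power2)
      \<comment> \<open>\<open>d\<close> and \<open>c'\<close> divide the interval from
        \<open>f x0\<close> to \<open>c1\<close> into thirds: the first absorbs the variation of
        \<open>f\<close> near \<open>x0\<close>, the second is the curvature of the tilted
        paraboloid.\<close>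
      define d where "d = (2 * f x0 + c1) / 3"
      define c' where "c' = (f x0 + 2 * c1) / 3"
      have ord: "f x0 < d" "d < c'" "c' < c1" "0 < c'" using c1 f0 by (auto simp: d_def c'_def)
      obtain \<rho> where \<rho>: "\<rho> > 0" "ball x0 \<rho> \<subseteq> N" "\<And>y. y \<in> ball x0 \<rho> \<Longrightarrow> u y \<le> u x0 + p \<bullet> (y - x0) + (y - x0) \<bullet> (A *v (y - x0)) / 2 + \<eta> * (norm (y - x0))\<^sup>2"
        using touch[OF e] by blast
      have "isCont f x0" using f N x0 continuous_on_eq_continuous_at by blast
      then have "\<forall>\<^sub>F y in at x0. f y < d" unfolding isCont_def using ord(1) by (rule order_tendstoD)
      then obtain s where s: "s > 0" "\<And>y. y \<noteq> x0 \<Longrightarrow> dist y x0 < s \<Longrightarrow> f y < d"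
        unfolding eventually_at by auto
      define R where "R = min \<rho> s"
      show False
      proof (rule visc_sub_no_concave_touching[of x0 R u d c' c1])
        show "usc_on (ball x0 R) u"
          by (rule continuous_on_imp_usc_on, rule continuous_on_subset[OF u]) (use \<rho>(2) in \<open>auto simp: R_def\<close>)
        show "R > 0" using \<rho> s by (simp add: R_def)
        show "visc_sub u x d" if x: "x \<in> ball x0 R" for x
        proof (rule visc_sub_mono[OF sub])
          show "x \<in> N" using x \<rho>(2) by (auto simp: R_def)
          show "f x \<le> d" using s(2)[of x] x ord(1) by (cases "x = x0") (auto simp: R_def dist_commute)
        qed
        show "u y \<le> u x0 - c1 / 2 * (norm (y - x0))\<^sup>2" if y: "y \<in> ball x0 R" for y
        proof -
          have "y \<in> ball x0 \<rho>" using y by (simp add: R_def)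
          from \<rho>(3)[OF this] have "u y \<le> u x0 + (y - x0) \<bullet> (A *v (y - x0)) / 2 + \<eta> * (norm (y - x0))\<^sup>2"
            using True by simp
          also have "\<dots> \<le> u x0 + (- c * (norm (y - x0))\<^sup>2) / 2 + \<eta> * (norm (y - x0))\<^sup>2"
            using eig[of "y - x0"] by simp
          also have "\<dots> = u x0 - c1 / 2 * (norm (y - x0))\<^sup>2" by (simp add: c1_def field_simps)
          finally show ?thesis .
        qed
      qed (use ord in auto)
    qed
  qed
qed

lemma frechet_derivative_uminus:
  "\<phi> differentiable (at x) \<Longrightarrow> frechet_derivative (\<lambda>y. - \<phi> y) (at x) = (\<lambda>v. - frechet_derivative \<phi> (at x) v)"
  by (intro frechet_derivative_at[symmetric] has_derivative_minus) (simp add: frechet_derivative_works)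

lemma C2_uminus:
  assumes C: "C2 \<phi>"
  shows "C2 (\<lambda>x. - \<phi> x)" "grad (\<lambda>x. - \<phi> x) x = - grad \<phi> x" "hess (\<lambda>x. - \<phi> x) x = - hess \<phi> x"
proof -
  have p: "partial (\<lambda>x. - \<phi> x) j = (\<lambda>y. - partial \<phi> j y)" for j
    by (simp add: fun_eq_iff frechet_derivative_uminus[OF C2D(1)[OF C]])
  have h: "hess (\<lambda>x. - \<phi> x) x = - hess \<phi> x" for x
    unfolding vec_eq_iff hess_nth p by (simp add: frechet_derivative_uminus[OF C2D(2)[OF C]] hess_nth)
  then show "hess (\<lambda>x. - \<phi> x) x = - hess \<phi> x" .
  show "grad (\<lambda>x. - \<phi> x) x = - grad \<phi> x"
    unfolding grad_def vec_eq_iff by (simp add: fun_cong[OF p])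
  show "C2 (\<lambda>x. - \<phi> x)"
    unfolding C2_def p h vector_uminus_component
    by (intro conjI allI differentiable_minus continuous_on_minus C2D[OF C])
qed

text \<open>Negation exchanges the largest and the smallest eigenvalue; this reduces the
  supersolution half of the viscosity definition to the subsolution half for
  \<open>- u\<close>.\<close>

lemma inf_lap_plus_uminus:
  assumes C: "C2 \<phi>"
  shows "inf_lap_plus (\<lambda>x. - \<phi> x) x = - inf_lap_minus \<phi> x"
proof -
  note sym = hess_symmetric[OF C]
  let ?E = "eigenvalues (hess \<phi> x)"
  have neg: "(- A) *v v = - (A *v v)" for A :: "real^'n^'n" and v
    by (simp add: vec_eq_iff matrix_vector_mult_def sum_negf)
  have negv: "A *v (- v) = - (A *v v)" for A :: "real^'n^'n" and v
    by (simp add: vec_eq_iff matrix_vector_mult_def sum_negf)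
  have "eigenvalues (- hess \<phi> x) = uminus ` ?E"
  proof (intro equalityI subsetI)
    fix c assume "c \<in> eigenvalues (- hess \<phi> x)"
    then obtain v where v: "v \<noteq> 0" "- (hess \<phi> x *v v) = c *\<^sub>R v" unfolding eigenvalues_def neg by blast
    then have "hess \<phi> x *v v = (- c) *\<^sub>R v" by (metis add.inverse_inverse scaleR_minus_left)
    then have "- c \<in> ?E" using v(1) unfolding eigenvalues_def by blast
    then show "c \<in> uminus ` ?E" by (intro image_eqI[of _ _ "- c"]) simp_all
  next
    fix c assume "c \<in> uminus ` ?E"
    then obtain v where "v \<noteq> 0" "hess \<phi> x *v v = (- c) *\<^sub>R v" unfolding eigenvalues_def by auto
    then show "c \<in> eigenvalues (- hess \<phi> x)" unfolding eigenvalues_def neg by auto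
  qed
  moreover have "Max (uminus ` ?E) = - Min ?E"
    using symmetric_eigenvalues(1,2)[of "hess \<phi> x"] sym by simp
  ultimately show ?thesis
    unfolding inf_lap_plus_def inf_lap_minus_def C2_uminus(2,3)[OF C] neg negv by simp
qed

section \<open>Limits of discrete subsolutions\<close>

locale convergent_scheme =
  fixes \<Omega> :: "(real^'n) set" and Th :: "nat \<Rightarrow> (real^'n) set set" and S :: "nat \<Rightarrow> (real^'n) set"
    and \<epsilon> \<theta> h :: "nat \<Rightarrow> real"
  assumes open_\<Omega>: "open \<Omega>" and bounded_\<Omega>: "bounded \<Omega>" and \<Omega>_ne: "\<Omega> \<noteq> {}"
    and two_scale: "\<And>j. two_scale \<Omega> (Th j) (S j) (\<epsilon> j) (\<theta> j) (h j)"
    and \<theta>_ge: "\<And>j. \<theta> j \<ge> 0"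
    and eps_lim: "\<epsilon> \<longlonglongrightarrow> 0"
    and heps_lim: "(\<lambda>j. h j / \<epsilon> j) \<longlonglongrightarrow> 0"
    and \<theta>eps_lim: "(\<lambda>j. \<theta> j / \<epsilon> j) \<longlonglongrightarrow> 0"
begin

lemma eps_pos: "\<epsilon> j > 0" and h_pos: "h j > 0" and h_le: "h j \<le> \<epsilon> j" and is_mesh: "is_mesh (Th j)"
  using two_scale.eps_pos[OF two_scale] two_scale.h_pos[OF two_scale] two_scale.h_le[OF two_scale]
    two_scale.mesh[OF two_scale] by auto

lemma nodes_in: "z \<in> nodes (Th j) \<Longrightarrow> z \<in> closure \<Omega>"
  using mesh_subset_closure[OF is_mesh two_scale.mesh_dom(2)[OF two_scale]] nodes_subset by blast

lemma compact_closure: "compact (closure \<Omega>)"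
  using bounded_\<Omega> by (simp add: compact_closure)

lemma frontier_ne: "frontier \<Omega> \<noteq> {}"
  using bounded_\<Omega> \<Omega>_ne frontier_not_empty not_bounded_UNIV by blast

lemma frontier_eq: "frontier \<Omega> = closure \<Omega> - \<Omega>"
  using open_\<Omega> by (simp add: frontier_def interior_open)

lemma \<theta>_lim: "\<theta> \<longlonglongrightarrow> 0"
proof -
  have "(\<lambda>j. \<theta> j / \<epsilon> j * \<epsilon> j) \<longlonglongrightarrow> 0 * 0" by (intro tendsto_mult \<theta>eps_lim eps_lim)
  moreover have "\<theta> j / \<epsilon> j * \<epsilon> j = \<theta> j" for j using eps_pos[of j] by simp
  ultimately show ?thesis by simp
qed

lemma h_lim: "h \<longlonglongrightarrow> 0"
proof -
  have "(\<lambda>j. h j / \<epsilon> j * \<epsilon> j) \<longlonglongrightarrow> 0 * 0" by (intro tendsto_mult heps_lim eps_lim)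
  moreover have "h j / \<epsilon> j * \<epsilon> j = h j" for j using eps_pos[of j] by simp
  ultimately show ?thesis by simp
qed

lemma interior_node_dist:
  assumes "z \<in> interior_nodes \<Omega> (Th j) (\<epsilon> j)" "x0 \<in> frontier \<Omega>"
  shows "2 * \<epsilon> j < dist z x0"
  using assms infdist_le[of x0 "frontier \<Omega>" z] by (auto simp: interior_nodes_def inner_set_def)

text \<open>
  The Kuratowski upper limit of the graphs of the nodal functions \<open>U j\<close>; \<open>upper U\<close> below is its upper
  envelope (defined only on the closure of \<open>\<Omega>\<close>, elsewhere it is \<open>Sup {}\<close>).
\<close>

definition limit_set :: "(nat \<Rightarrow> real^'n \<Rightarrow> real) \<Rightarrow> ((real^'n) \<times> real) set" where
  "limit_set U = (\<Inter>n. closure (\<Union>j\<in>{n..}. (\<lambda>z. (z, U j z)) ` nodes (Th j)))"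

text \<open>The indices \<open>r\<close> need only tend to infinity, not increase; this form is
  preserved by extraction and composition.\<close>

lemma limit_setI:
  assumes r: "filterlim r at_top sequentially" and z: "\<forall>\<^sub>F k in sequentially. z k \<in> nodes (Th (r k))"
    and lim: "z \<longlonglongrightarrow> x" "(\<lambda>k. U (r k) (z k)) \<longlonglongrightarrow> t"
  shows "(x, t) \<in> limit_set U"
  unfolding limit_set_def
proof
  fix n :: nat
  let ?A = "\<Union>j\<in>{n..}. (\<lambda>z. (z, U j z)) ` nodes (Th j)"
  show "(x, t) \<in> closure ?A"
  proof (rule Lim_in_closed_set[OF closed_closure])
    show "(\<lambda>k. (z k, U (r k) (z k))) \<longlonglongrightarrow> (x, t)" using lim by (rule tendsto_Pair)
    have "\<forall>\<^sub>F k in sequentially. n \<le> r k" using r by (simp add: filterlim_at_top)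
    with z show "\<forall>\<^sub>F k in sequentially. (z k, U (r k) (z k)) \<in> closure ?A"
    proof eventually_elim
      case (elim k)
      then have "r k \<in> {n..}" "(z k, U (r k) (z k)) \<in> (\<lambda>z. (z, U (r k) z)) ` nodes (Th (r k))" by simp_all
      then have "(z k, U (r k) (z k)) \<in> ?A" by (rule UN_I)
      then show ?case by (rule subsetD[OF closure_subset])
    qed
  qed simp
qed

lemma limit_setD:
  assumes "(x, t) \<in> limit_set U"
  obtains r z where "filterlim r at_top sequentially" "\<And>k. z k \<in> nodes (Th (r k))"
    "z \<longlonglongrightarrow> x" "(\<lambda>k. U (r k) (z k)) \<longlonglongrightarrow> t"
proof -
  have "\<exists>p. n \<le> fst p \<and> snd p \<in> nodes (Th (fst p)) \<and> dist (snd p, U (fst p) (snd p)) (x, t) < inverse (real (Suc n))" for n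
  proof -
    have "(x, t) \<in> closure (\<Union>j\<in>{n..}. (\<lambda>z. (z, U j z)) ` nodes (Th j))"
      using assms unfolding limit_set_def by blast
    then have "\<forall>e>0. \<exists>y\<in>(\<Union>j\<in>{n..}. (\<lambda>z. (z, U j z)) ` nodes (Th j)). dist y (x, t) < e"
      by (simp only: closure_approachable)
    from mp[OF spec[OF this, of "inverse (real (Suc n))"]]
    obtain y where "y \<in> (\<Union>j\<in>{n..}. (\<lambda>z. (z, U j z)) ` nodes (Th j))" and y: "dist y (x, t) < inverse (real (Suc n))"
      by (rule bexE) simp
    then obtain j where j: "n \<le> j" "y \<in> (\<lambda>z. (z, U j z)) ` nodes (Th j)" by (elim UN_E) simp
    from j(2) obtain z where z: "y = (z, U j z)" "z \<in> nodes (Th j)" by (rule imageE)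
    then show ?thesis using y j(1) by (intro exI[of _ "(j, z)"]) (simp only: fst_conv snd_conv simp_thms)
  qed
  then have "\<forall>n. \<exists>p. n \<le> fst p \<and> snd p \<in> nodes (Th (fst p)) \<and> dist (snd p, U (fst p) (snd p)) (x, t) < inverse (real (Suc n))"
    by (rule allI)
  then obtain p where p: "\<And>n. n \<le> fst (p n) \<and> snd (p n) \<in> nodes (Th (fst (p n))) \<and>
      dist (snd (p n), U (fst (p n)) (snd (p n))) (x, t) < inverse (real (Suc n))"
    using choice[of "\<lambda>n p. n \<le> fst p \<and> snd p \<in> nodes (Th (fst p)) \<and> dist (snd p, U (fst p) (snd p)) (x, t) < inverse (real (Suc n))"] by blast
  have plim: "(\<lambda>n. (snd (p n), U (fst (p n)) (snd (p n)))) \<longlonglongrightarrow> (x, t)"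
  proof (rule metric_tendsto_imp_tendsto[OF LIMSEQ_inverse_real_of_nat])
    show "\<forall>\<^sub>F n in sequentially. dist (snd (p n), U (fst (p n)) (snd (p n))) (x, t) \<le> dist (inverse (real (Suc n))) 0"
    proof (intro always_eventually allI)
      fix n
      have "dist (inverse (real (Suc n))) 0 = inverse (real (Suc n))" by simp
      then show "dist (snd (p n), U (fst (p n)) (snd (p n))) (x, t) \<le> dist (inverse (real (Suc n))) 0"
        using p[of n] by linarith
    qed
  qed
  have "(\<lambda>n. snd (p n)) \<longlonglongrightarrow> x" "(\<lambda>n. U (fst (p n)) (snd (p n))) \<longlonglongrightarrow> t"
    using tendsto_fst[OF plim] tendsto_snd[OF plim] by (simp_all only: fst_conv snd_conv)
  moreover have "filterlim (\<lambda>n. fst (p n)) at_top sequentially"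
    using filterlim_at_top_mono[OF filterlim_ident, of "\<lambda>n. fst (p n)"] p by (simp add: always_eventually)
  moreover have "snd (p n) \<in> nodes (Th (fst (p n)))" for n using p by blast
  ultimately show thesis by (intro that[of "\<lambda>n. fst (p n)" "\<lambda>n. snd (p n)"])
qed

lemma limit_set_uminus: "(x, t) \<in> limit_set (\<lambda>j z. - U j z) \<longleftrightarrow> (x, - t) \<in> limit_set U"
proof -
  have one: "(x, - t) \<in> limit_set (\<lambda>j z. - U j z)" if lt: "(x, t) \<in> limit_set U" for x t and U :: "nat \<Rightarrow> real^'n \<Rightarrow> real"
  proof -
    obtain r z where rz: "filterlim r at_top sequentially" "\<And>k. z k \<in> nodes (Th (r k))"
      "z \<longlonglongrightarrow> x" "(\<lambda>k. U (r k) (z k)) \<longlonglongrightarrow> t"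
      by (rule limit_setD[OF lt]) (rule that)
    show ?thesis by (rule limit_setI[OF rz(1) _ rz(3)]) (use rz in \<open>auto intro: tendsto_minus\<close>)
  qed
  show ?thesis using one[of x t "\<lambda>j z. - U j z"] one[of x "- t" U] by auto
qed

definition eventually_bounded :: "(nat \<Rightarrow> real^'n \<Rightarrow> real) \<Rightarrow> bool" where
  "eventually_bounded U \<longleftrightarrow> (\<exists>B. \<forall>\<^sub>F j in sequentially. \<forall>z\<in>nodes (Th j). \<bar>U j z\<bar> \<le> B)"

lemma compact_limit_set:
  assumes "eventually_bounded U"
  shows "compact (limit_set U)" "limit_set U \<subseteq> closure \<Omega> \<times> UNIV"
proof -
  obtain B J where B: "\<And>j z. j \<ge> J \<Longrightarrow> z \<in> nodes (Th j) \<Longrightarrow> \<bar>U j z\<bar> \<le> B"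
    using assms unfolding eventually_bounded_def eventually_sequentially by blast
  have cK: "compact (closure \<Omega> \<times> {-B..B})" by (intro compact_Times compact_closure compact_Icc)
  have "(\<Union>j\<in>{J..}. (\<lambda>z. (z, U j z)) ` nodes (Th j)) \<subseteq> closure \<Omega> \<times> {-B..B}"
    using B nodes_in by (fastforce simp: abs_le_iff)
  then have "closure (\<Union>j\<in>{J..}. (\<lambda>z. (z, U j z)) ` nodes (Th j)) \<subseteq> closure \<Omega> \<times> {-B..B}"
    using closure_minimal compact_imp_closed[OF cK] by blast
  then have sub: "limit_set U \<subseteq> closure \<Omega> \<times> {-B..B}" unfolding limit_set_def by blast
  then show "limit_set U \<subseteq> closure \<Omega> \<times> UNIV" by blast
  have "closed (limit_set U)" unfolding limit_set_def by (intro closed_INT) auto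
  then show "compact (limit_set U)" using sub cK
    using bounded_subset[OF compact_imp_bounded[OF cK]] by (simp add: compact_eq_bounded_closed)
qed

lemma subsequence_limit:
  assumes "eventually_bounded U" and r: "filterlim r at_top sequentially" and z: "\<And>k. z k \<in> nodes (Th (r k))"
  obtains \<sigma> x t where "strict_mono \<sigma>" "filterlim (\<lambda>k. r (\<sigma> k)) at_top sequentially"
    "(\<lambda>k. z (\<sigma> k)) \<longlonglongrightarrow> x" "(\<lambda>k. U (r (\<sigma> k)) (z (\<sigma> k))) \<longlonglongrightarrow> t" "(x, t) \<in> limit_set U"
proof -
  obtain B J where B: "\<And>j z. j \<ge> J \<Longrightarrow> z \<in> nodes (Th j) \<Longrightarrow> \<bar>U j z\<bar> \<le> B"
    using assms unfolding eventually_bounded_def eventually_sequentially by blast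
  obtain N where N: "\<And>k. k \<ge> N \<Longrightarrow> r k \<ge> J"
    using r unfolding filterlim_at_top eventually_sequentially by blast
  define q where "q k = (z (k + N), U (r (k + N)) (z (k + N)))" for k
  have "compact (closure \<Omega> \<times> {-B..B})" by (intro compact_Times compact_closure compact_Icc)
  moreover have "\<forall>k. q k \<in> closure \<Omega> \<times> {-B..B}"
  proof
    fix k
    have "\<bar>U (r (k + N)) (z (k + N))\<bar> \<le> B" using B[OF N z] by simp
    then show "q k \<in> closure \<Omega> \<times> {-B..B}" using nodes_in[OF z] by (auto simp: q_def abs_le_iff)
  qed
  ultimately obtain l \<tau> where l: "strict_mono \<tau>" "(q \<circ> \<tau>) \<longlonglongrightarrow> l" unfolding compact_def by blast
  obtain x t where xt: "l = (x, t)" by (cases l)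
  define \<sigma> where "\<sigma> k = \<tau> k + N" for k
  have lim: "(\<lambda>k. z (\<sigma> k)) \<longlonglongrightarrow> x" "(\<lambda>k. U (r (\<sigma> k)) (z (\<sigma> k))) \<longlonglongrightarrow> t"
    using tendsto_fst[OF l(2)] tendsto_snd[OF l(2)] by (simp_all add: xt q_def \<sigma>_def o_def)
  have sm: "strict_mono \<sigma>" using l(1) by (simp add: strict_mono_def \<sigma>_def)
  have fl: "filterlim (\<lambda>k. r (\<sigma> k)) at_top sequentially"
    using filterlim_compose[OF r filterlim_subseq[OF sm]] .
  show thesis
    by (rule that[OF sm fl lim limit_setI[OF fl _ lim]]) (simp add: z)
qed

lemma node_near:
  assumes x: "x \<in> \<Omega>"
  shows "\<forall>\<^sub>F j in sequentially. \<exists>z\<in>nodes (Th j). dist x z \<le> h j"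
proof -
  have "x \<notin> frontier \<Omega>" using x by (simp add: frontier_eq)
  then have "infdist x (frontier \<Omega>) > 0" using frontier_ne by (simp add: infdist_pos_not_in_closed)
  then have "\<forall>\<^sub>F j in sequentially. h j < infdist x (frontier \<Omega>)" using h_lim by (intro order_tendstoD)
  then show ?thesis
  proof eventually_elim
    case (elim j)
    have "x \<in> inner_set \<Omega> (meshsize (Th j))"
      using elim x two_scale.h_def[OF two_scale, of j] by (simp add: inner_set_def)
    then have "x \<in> \<Union>(Th j)"
      using two_scale.mesh_dom(1)[OF two_scale, of j] interior_subset unfolding mesh_domain_def by blast
    then obtain \<mu> where \<mu>: "\<And>v. v \<in> nodes (Th j) \<Longrightarrow> 0 \<le> \<mu> v"
      "\<And>v. v \<in> nodes (Th j) \<Longrightarrow> \<mu> v \<noteq> 0 \<Longrightarrow> dist x v \<le> h j" "sum \<mu> (nodes (Th j)) = 1"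
      "(\<Sum>v\<in>nodes (Th j). \<mu> v *\<^sub>R v) = x" "\<And>w. interp (Th j) w x = (\<Sum>v\<in>nodes (Th j). \<mu> v * w v)"
      by (rule two_scale.interp_weights[OF two_scale]) (rule that)
    have "\<exists>v\<in>nodes (Th j). \<mu> v \<noteq> 0" using \<mu>(3) by (rule contrapos_pp) simp
    then show ?case using \<mu>(2) by blast
  qed
qed

text \<open>Nodes come arbitrarily close to every point of \<Omega>, so bounded nodal values
  accumulate over it. The projection of the compact limit set is closed, which adds the boundary
  points.\<close>

lemma limit_set_fibre:
  assumes bd: "eventually_bounded U" and x: "x \<in> closure \<Omega>"
  shows "\<exists>t. (x, t) \<in> limit_set U"
proof -
  have "\<Omega> \<subseteq> fst ` limit_set U"
  proof
    fix y assume y: "y \<in> \<Omega>"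
    obtain N where N: "\<And>j. j \<ge> N \<Longrightarrow> \<exists>z\<in>nodes (Th j). dist y z \<le> h j"
      using node_near[OF y] unfolding eventually_sequentially by blast
    then have "\<forall>j. \<exists>z. z \<in> nodes (Th (j + N)) \<and> dist y z \<le> h (j + N)" using le_add2 by blast
    then obtain z where z: "\<And>j. z j \<in> nodes (Th (j + N)) \<and> dist y (z j) \<le> h (j + N)"
      using choice[of "\<lambda>j z. z \<in> nodes (Th (j + N)) \<and> dist y z \<le> h (j + N)"] by blast
    have r: "filterlim (\<lambda>j. j + N) at_top sequentially" by (rule filterlim_add_const_nat_at_top)
    have zn: "z j \<in> nodes (Th (j + N))" for j using z by blast
    obtain \<sigma> x' t where s: "strict_mono \<sigma>" "filterlim (\<lambda>k. \<sigma> k + N) at_top sequentially"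
      "(\<lambda>k. z (\<sigma> k)) \<longlonglongrightarrow> x'" "(\<lambda>k. U (\<sigma> k + N) (z (\<sigma> k))) \<longlonglongrightarrow> t" "(x', t) \<in> limit_set U"
      by (rule subsequence_limit[where z = z, OF bd r zn]) (rule that)
    have "z \<longlonglongrightarrow> y"
    proof (rule metric_tendsto_imp_tendsto)
      show "(\<lambda>j. h (j + N)) \<longlonglongrightarrow> 0" using h_lim by (rule LIMSEQ_ignore_initial_segment)
      show "\<forall>\<^sub>F j in sequentially. dist (z j) y \<le> dist (h (j + N)) 0"
        using z h_pos by (intro always_eventually allI) (simp add: dist_commute less_imp_le)
    qed
    then have "(\<lambda>k. z (\<sigma> k)) \<longlonglongrightarrow> y" using LIMSEQ_subseq_LIMSEQ[OF _ s(1)] by (simp add: o_def)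
    then have "x' = y" using s(3) LIMSEQ_unique by blast
    then show "y \<in> fst ` limit_set U" using s(5) by force
  qed
  moreover have "closed (fst ` limit_set U)"
    using compact_limit_set(1)[OF bd] by (intro compact_imp_closed compact_continuous_image continuous_intros)
  ultimately have "closure \<Omega> \<subseteq> fst ` limit_set U" by (rule closure_minimal)
  then show ?thesis using x by force
qed

definition upper :: "(nat \<Rightarrow> real^'n \<Rightarrow> real) \<Rightarrow> real^'n \<Rightarrow> real" where
  "upper U x = Sup {t. (x, t) \<in> limit_set U}"

lemma upper:
  assumes bd: "eventually_bounded U" and x: "x \<in> closure \<Omega>"
  shows "(x, upper U x) \<in> limit_set U" "\<And>t. (x, t) \<in> limit_set U \<Longrightarrow> t \<le> upper U x"
proof -
  have "{t. (x, t) \<in> limit_set U} = snd ` (limit_set U \<inter> ({x} \<times> UNIV))" by force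
  moreover have "compact (limit_set U \<inter> ({x} \<times> UNIV))"
    by (intro compact_Int_closed compact_limit_set bd closed_Times) auto
  ultimately have c: "compact {t. (x, t) \<in> limit_set U}"
    by (auto intro!: compact_continuous_image continuous_intros)
  have ne: "{t. (x, t) \<in> limit_set U} \<noteq> {}" using limit_set_fibre[OF bd x] by blast
  have bda: "bdd_above {t. (x, t) \<in> limit_set U}"
    by (rule bounded_imp_bdd_above[OF compact_imp_bounded[OF c]])
  show "(x, upper U x) \<in> limit_set U"
    using closed_contains_Sup[OF ne bda compact_imp_closed[OF c]] unfolding upper_def by blast
  show "t \<le> upper U x" if "(x, t) \<in> limit_set U" for t
    unfolding upper_def using that bda by (intro cSup_upper) auto
qed

text \<open>The points with \<open>a \<le> upper U x\<close> form the projection of a compact part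
  of the limit set, hence a closed set.\<close>

lemma usc_upper:
  assumes bd: "eventually_bounded U"
  shows "usc_on (closure \<Omega>) (upper U)"
  unfolding usc_on_def
proof (intro ballI allI impI)
  fix x a assume x: "x \<in> closure \<Omega>" and a: "upper U x < a"
  define C where "C = fst ` (limit_set U \<inter> (UNIV \<times> {a..}))"
  have "compact (limit_set U \<inter> (UNIV \<times> {a..}))"
    by (intro compact_Int_closed compact_limit_set bd closed_Times) auto
  then have "closed C" unfolding C_def
    by (intro compact_imp_closed compact_continuous_image continuous_intros)
  moreover have "x \<notin> C" using upper(2)[OF bd x] a unfolding C_def by force
  ultimately have "\<forall>\<^sub>F y in at x within closure \<Omega>. y \<in> - C \<and> y \<in> closure \<Omega>"
    unfolding eventually_at_topological by (intro exI[of _ "- C"]) (auto simp: open_Compl)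
  then show "\<forall>\<^sub>F y in at x within closure \<Omega>. upper U y < a"
  proof eventually_elim
    case (elim y)
    have "(y, upper U y) \<in> limit_set U" using upper(1)[OF bd] elim by blast
    then show ?case using elim unfolding C_def by force
  qed
qed

text \<open>One-sided, so that it can be applied to the solutions with \<open>g\<close> and to their
  negatives with \<open>- g\<close>. The bound \<open>B\<close> takes care of boundary nodes away
  from \<open>x0\<close>.\<close>

definition boundary_le :: "(real^'n \<Rightarrow> real) \<Rightarrow> (nat \<Rightarrow> real^'n \<Rightarrow> real) \<Rightarrow> bool" where
  "boundary_le G U \<longleftrightarrow>
     (\<forall>x0\<in>frontier \<Omega>. \<forall>\<eta>>0. \<exists>\<delta>>0. \<forall>\<^sub>F j in sequentially.
        \<forall>z\<in>boundary_nodes \<Omega> (Th j) (\<epsilon> j). dist z x0 < \<delta> \<longrightarrow> U j z \<le> G x0 + \<eta>) \<and>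
     (\<exists>B. \<forall>\<^sub>F j in sequentially. \<forall>z\<in>boundary_nodes \<Omega> (Th j) (\<epsilon> j). U j z \<le> B)"

text \<open>The barrier is compared with \<open>U j\<close> on the whole mesh; the point is that one
  \<open>A\<close> serves all large \<open>j\<close>, which gives both boundedness and the boundary
  values of the upper limit.\<close>

lemma sqrt_barrier_bound:
  assumes sub: "\<And>j. disc_sub \<Omega> (Th j) (S j) (\<epsilon> j) F \<psi> (U j)"
    and bdry: "boundary_le G U"
    and F: "\<And>x. x \<in> \<Omega> \<Longrightarrow> F x \<le> CF"
    and \<psi>: "continuous_on (closure \<Omega>) \<psi>" "\<psi> x0 < G x0" and x0: "x0 \<in> frontier \<Omega>" and \<eta>: "\<eta> > 0"
  shows "\<exists>A\<ge>0. \<forall>\<^sub>F j in sequentially. \<forall>z\<in>nodes (Th j). U j z \<le> G x0 + \<eta> + A * sqrt (dist z x0)"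
proof -
  obtain \<delta> where \<delta>: "\<delta> > 0" "\<forall>\<^sub>F j in sequentially. \<forall>z\<in>boundary_nodes \<Omega> (Th j) (\<epsilon> j). dist z x0 < \<delta> \<longrightarrow> U j z \<le> G x0 + \<eta>"
    using bdry x0 \<eta> unfolding boundary_le_def by blast
  obtain B where B: "\<forall>\<^sub>F j in sequentially. \<forall>z\<in>boundary_nodes \<Omega> (Th j) (\<epsilon> j). U j z \<le> B"
    using bdry unfolding boundary_le_def by blast
  have x0c: "x0 \<in> closure \<Omega>" using x0 by (simp add: frontier_eq)
  have "\<exists>d>0. \<forall>z\<in>closure \<Omega>. dist z x0 < d \<longrightarrow> dist (\<psi> z) (\<psi> x0) < G x0 - \<psi> x0"
    using \<psi>(1)[unfolded continuous_on_iff, rule_format, OF x0c, of "G x0 - \<psi> x0"] \<psi>(2) by simp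
  then obtain d where d: "d > 0" "\<And>z. z \<in> closure \<Omega> \<Longrightarrow> dist z x0 < d \<Longrightarrow> \<psi> z \<le> G x0"
  proof -
    assume *: "\<And>d. d > 0 \<Longrightarrow> (\<And>z. z \<in> closure \<Omega> \<Longrightarrow> dist z x0 < d \<Longrightarrow> \<psi> z \<le> G x0) \<Longrightarrow> thesis"
    assume "\<exists>d>0. \<forall>z\<in>closure \<Omega>. dist z x0 < d \<longrightarrow> dist (\<psi> z) (\<psi> x0) < G x0 - \<psi> x0"
    then obtain d where "d > 0" "\<And>z. z \<in> closure \<Omega> \<Longrightarrow> dist z x0 < d \<Longrightarrow> dist (\<psi> z) (\<psi> x0) < G x0 - \<psi> x0" by blast
    then show thesis by (intro *[of d]) (force simp: dist_real_def abs_less_iff)+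
  qed
  obtain b where b: "\<And>z. z \<in> closure \<Omega> \<Longrightarrow> \<psi> z \<le> b"
  proof -
    have "compact (\<psi> ` closure \<Omega>)" by (rule compact_continuous_image[OF \<psi>(1) compact_closure])
    then have "bdd_above (\<psi> ` closure \<Omega>)" by (intro bounded_imp_bdd_above compact_imp_bounded)
    then show thesis using that unfolding bdd_above_def by blast
  qed
  define D where "D = diameter (closure \<Omega>) + 1"
  have D0: "D > 0" using diameter_ge_0[OF compact_imp_bounded[OF compact_closure]] by (simp add: D_def)
  have D: "dist z x0 \<le> D" if "z \<in> closure \<Omega>" for z
    using diameter_bounded_bound[OF compact_imp_bounded[OF compact_closure] that x0c] by (simp add: D_def)
  \<comment> \<open>The three nonzero entries make the barrier exceed the boundary values at
    distance at least \<delta>, the threshold at distance at least \<open>d\<close>, and the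
    right-hand side everywhere.\<close>
  define A where "A = Max {0, (B - G x0) / sqrt \<delta>, (b - G x0) / sqrt d, (\<bar>CF\<bar> + 1) * (8 * D * sqrt D)}"
  have A: "A \<ge> 0" "(B - G x0) / sqrt \<delta> \<le> A" "(b - G x0) / sqrt d \<le> A" "(\<bar>CF\<bar> + 1) * (8 * D * sqrt D) \<le> A"
    unfolding A_def by auto
  have A_far: "c \<le> G x0 + \<eta> + A * sqrt s" if "(c - G x0) / sqrt e \<le> A" "e > 0" "s \<ge> e" for c e s
  proof -
    have "c - G x0 \<le> A * sqrt e" using that by (simp add: divide_le_eq)
    also have "\<dots> \<le> A * sqrt s" using that A by (intro mult_left_mono) auto
    finally show ?thesis using \<eta> by simp
  qed
  have "(\<lambda>j. 2 * (h j / \<epsilon> j)\<^sup>2 + D * (\<theta> j / \<epsilon> j)) \<longlonglongrightarrow> 2 * 0\<^sup>2 + D * 0"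
    by (intro tendsto_intros heps_lim \<theta>eps_lim)
  then have small: "\<forall>\<^sub>F j in sequentially. 2 * (h j / \<epsilon> j)\<^sup>2 + D * (\<theta> j / \<epsilon> j) < 1 / 8"
    by (intro order_tendstoD) auto
  have "\<forall>\<^sub>F j in sequentially. \<forall>z\<in>nodes (Th j). U j z \<le> G x0 + \<eta> + A * sqrt (dist z x0)"
    using \<delta>(2) B small
  proof eventually_elim
    case (elim j)
    show ?case
    proof
      fix z assume z: "z \<in> nodes (Th j)"
      show "U j z \<le> G x0 + \<eta> + A * sqrt (dist z x0)"
      proof (rule two_scale.strict_comparison[OF two_scale sub[of j] _ _ _ z])
        fix y assume y: "y \<in> boundary_nodes \<Omega> (Th j) (\<epsilon> j)"
        show "U j y \<le> G x0 + \<eta> + A * sqrt (dist y x0)"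
        proof (cases "dist y x0 < \<delta>")
          case True
          then have "U j y \<le> G x0 + \<eta>" using elim(1) y by blast
          then show ?thesis using A(1) by (simp add: add_increasing2)
        next
          case False
          then have "B \<le> G x0 + \<eta> + A * sqrt (dist y x0)" using A_far[OF A(2) \<delta>(1)] by simp
          then show ?thesis using elim(2) y by force
        qed
      next
        fix y assume y: "y \<in> interior_nodes \<Omega> (Th j) (\<epsilon> j)"
        have yO: "y \<in> \<Omega>" "y \<in> closure \<Omega>" using y closure_subset by (auto simp: interior_nodes_def inner_set_def)
        show "\<psi> y \<le> G x0 + \<eta> + A * sqrt (dist y x0)"
        proof (cases "dist y x0 < d")
          case True
          then have "\<psi> y \<le> G x0" using d(2) yO by blast
          moreover have "0 \<le> A * sqrt (dist y x0)" using A(1) by simp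
          ultimately show ?thesis using \<eta> by linarith
        next
          case False
          then have "b \<le> G x0 + \<eta> + A * sqrt (dist y x0)" using A_far[OF A(3) d(1)] by simp
          then show ?thesis using b[OF yO(2)] by linarith
        qed
        have "F y < \<bar>CF\<bar> + 1" using F[OF yO(1)] by linarith
        also have "\<dots> \<le> A / (8 * D * sqrt D)" using A(4) D0 by (simp add: le_divide_eq)
        also have "\<dots> \<le> minus_disc_inf_lap (Th j) (S j) (\<epsilon> j) (\<lambda>y. (G x0 + \<eta>) + A * sqrt (dist y x0)) y"
          using interior_node_dist[OF y x0] D[OF yO(2)] elim(3) \<theta>_ge[of j] A(1)
          by (intro two_scale.disc_lap_barrier[OF two_scale y]) auto
        finally show "F y < minus_disc_inf_lap (Th j) (S j) (\<epsilon> j) (\<lambda>y. G x0 + \<eta> + A * sqrt (dist y x0)) y" .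
      qed
    qed
  qed
  then show ?thesis using A(1) by (intro exI[of _ A] conjI)
qed

end

section \<open>Stability of subsolutions under the upper limit\<close>

context convergent_scheme
begin

text \<open>Maximisers of \<open>U - Q\<close> over nodes in the ball accumulate at some
  \<open>(x, t)\<close> in the limit set. Their values dominate those along a sequence realising
  \<open>upper U x1\<close>, so strictness leaves only \<open>x = x1\<close> and
  \<open>t = upper U x1\<close>.\<close>

lemma limit_maximizer:
  assumes bd: "eventually_bounded U" and x1: "x1 \<in> \<Omega>" and \<rho>: "\<rho> > 0" "cball x1 \<rho> \<subseteq> \<Omega>"
    and Q: "continuous_on UNIV Q"
    and strict: "\<And>y. y \<in> cball x1 \<rho> \<Longrightarrow> y \<noteq> x1 \<Longrightarrow> upper U y - Q y < upper U x1 - Q x1"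
  obtains r z where "filterlim r at_top sequentially" "\<And>k. z k \<in> nodes (Th (r k))" "z \<longlonglongrightarrow> x1"
    "(\<lambda>k. U (r k) (z k)) \<longlonglongrightarrow> upper U x1"
    "\<And>k v. v \<in> nodes (Th (r k)) \<Longrightarrow> v \<in> cball x1 \<rho> \<Longrightarrow> U (r k) v - Q v \<le> U (r k) (z k) - Q (z k)"
proof -
  have x1c: "x1 \<in> closure \<Omega>" using x1 closure_subset by blast
  obtain r0 y0 where r0: "filterlim r0 at_top sequentially" "\<And>k. y0 k \<in> nodes (Th (r0 k))"
    "y0 \<longlonglongrightarrow> x1" "(\<lambda>k. U (r0 k) (y0 k)) \<longlonglongrightarrow> upper U x1"
    by (rule limit_setD[OF upper(1)[OF bd x1c]]) (rule that)
  have "\<forall>\<^sub>F k in sequentially. dist (y0 k) x1 < \<rho>" using r0(3) \<rho>(1) by (rule tendstoD)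
  then obtain N where N: "\<And>k. k \<ge> N \<Longrightarrow> dist (y0 k) x1 < \<rho>" unfolding eventually_sequentially by blast
  define r y where "r k = r0 (k + N)" and "y k = y0 (k + N)" for k
  have r: "filterlim r at_top sequentially"
    unfolding r_def by (rule filterlim_compose[OF r0(1) filterlim_add_const_nat_at_top])
  have y: "y k \<in> nodes (Th (r k))" "y k \<in> cball x1 \<rho>" for k
    using r0(2)[of "k + N"] N[of "k + N"] by (auto simp: y_def r_def dist_commute less_imp_le)
  have ylim: "y \<longlonglongrightarrow> x1" "(\<lambda>k. U (r k) (y k)) \<longlonglongrightarrow> upper U x1"
    using LIMSEQ_ignore_initial_segment[OF r0(3), of N] LIMSEQ_ignore_initial_segment[OF r0(4), of N]
    by (simp_all add: y_def[abs_def] r_def)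
  have "\<exists>z. z \<in> nodes (Th (r k)) \<inter> cball x1 \<rho> \<and>
      (\<forall>v\<in>nodes (Th (r k)) \<inter> cball x1 \<rho>. U (r k) v - Q v \<le> U (r k) z - Q z)" for k
  proof -
    let ?N = "nodes (Th (r k)) \<inter> cball x1 \<rho>" and ?d = "\<lambda>v. U (r k) v - Q v"
    have fin: "finite ?N" using finite_nodes[OF is_mesh] by blast
    have "y k \<in> ?N" using y by blast
    then have "Max (?d ` ?N) \<in> ?d ` ?N" using fin by (intro Max_in) auto
    then obtain z where z: "Max (?d ` ?N) = ?d z" "z \<in> ?N" by (rule imageE)
    have "?d v \<le> ?d z" if "v \<in> ?N" for v unfolding z(1)[symmetric] using fin that by (intro Max_ge) auto
    then show ?thesis using z(2) by (intro exI[of _ z]) simp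
  qed
  then have "\<forall>k. \<exists>z. z \<in> nodes (Th (r k)) \<inter> cball x1 \<rho> \<and>
      (\<forall>v\<in>nodes (Th (r k)) \<inter> cball x1 \<rho>. U (r k) v - Q v \<le> U (r k) z - Q z)" by (rule allI)
  from choice[OF this] obtain z where z': "\<forall>k. z k \<in> nodes (Th (r k)) \<inter> cball x1 \<rho> \<and>
      (\<forall>v\<in>nodes (Th (r k)) \<inter> cball x1 \<rho>. U (r k) v - Q v \<le> U (r k) (z k) - Q (z k))" by (rule exE)
  then have z: "z k \<in> nodes (Th (r k))" "z k \<in> cball x1 \<rho>"
    and zmax: "v \<in> nodes (Th (r k)) \<Longrightarrow> v \<in> cball x1 \<rho> \<Longrightarrow> U (r k) v - Q v \<le> U (r k) (z k) - Q (z k)" for k v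
    by blast+
  obtain \<sigma> x t where s: "strict_mono \<sigma>" "filterlim (\<lambda>k. r (\<sigma> k)) at_top sequentially"
    "(\<lambda>k. z (\<sigma> k)) \<longlonglongrightarrow> x" "(\<lambda>k. U (r (\<sigma> k)) (z (\<sigma> k))) \<longlonglongrightarrow> t" "(x, t) \<in> limit_set U"
    by (rule subsequence_limit[where z = z, OF bd r z(1)]) (rule that)
  have xc: "x \<in> cball x1 \<rho>"
    by (rule Lim_in_closed_set[OF closed_cball _ _ s(3)]) (auto intro!: always_eventually z(2) simp del: mem_cball)
  have xO: "x \<in> closure \<Omega>" using xc \<rho>(2) closure_subset by blast
  have Qlim: "(\<lambda>k. Q (a k)) \<longlonglongrightarrow> Q b" if "a \<longlonglongrightarrow> b" for a b
    using continuous_on_tendsto_compose[OF Q that] by simp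
  have "(\<lambda>k. U (r (\<sigma> k)) (y (\<sigma> k)) - Q (y (\<sigma> k))) \<longlonglongrightarrow> upper U x1 - Q x1"
    using LIMSEQ_subseq_LIMSEQ[OF ylim(1) s(1)] LIMSEQ_subseq_LIMSEQ[OF ylim(2) s(1)]
    by (intro tendsto_diff Qlim) (simp_all add: o_def)
  moreover have "(\<lambda>k. U (r (\<sigma> k)) (z (\<sigma> k)) - Q (z (\<sigma> k))) \<longlonglongrightarrow> t - Q x"
    by (intro tendsto_diff s Qlim)
  ultimately have ge: "upper U x1 - Q x1 \<le> t - Q x"
    by (rule LIMSEQ_le) (intro exI[of _ 0] allI impI zmax y)
  have tle: "t \<le> upper U x" by (rule upper(2)[OF bd xO s(5)])
  have xx: "x = x1"
  proof (rule ccontr)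
    assume "x \<noteq> x1"
    then show False using strict[OF xc] ge tle by linarith
  qed
  have "t = upper U x1" using ge tle unfolding xx by linarith
  then show thesis
    by (intro that[of "\<lambda>k. r (\<sigma> k)" "\<lambda>k. z (\<sigma> k)"]) (use s z zmax xx in auto)
qed

text \<open>At the discrete maximisers monotonicity replaces \<open>U\<close> by the quadratic,
  consistency supplies a direction, and compactness of the unit ball a limit direction
  \<open>w'\<close>. It maximises \<open>p\<close> because the direction sets become dense.\<close>

lemma limit_visc_sub_strict:
  assumes bd: "eventually_bounded U" and sub: "\<And>j. disc_sub \<Omega> (Th j) (S j) (\<epsilon> j) F \<psi> (U j)"
    and x1: "x1 \<in> \<Omega>" and F: "continuous_on \<Omega> F" and \<psi>: "continuous_on \<Omega> \<psi>" "\<psi> x1 < upper U x1"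
    and \<rho>: "\<rho> > 0" "cball x1 \<rho> \<subseteq> \<Omega>" and H: "linear H" and \<eta>: "\<eta> > 0"
    and touch: "\<And>y. y \<in> cball x1 \<rho> \<Longrightarrow>
      upper U y + \<eta> * (norm (y - x1))\<^sup>2 \<le> upper U x1 + p \<bullet> (y - x1) + (y - x1) \<bullet> H (y - x1) / 2"
  shows "\<exists>w. norm w \<le> 1 \<and> p = norm p *\<^sub>R w \<and> - (w \<bullet> H w) \<le> F x1"
proof -
  define Q where "Q y = p \<bullet> (y - x1) + (y - x1) \<bullet> H (y - x1) / 2" for y
  have contH: "continuous_on A (\<lambda>y. H (g y))" if "continuous_on A g" for A :: "(real^'n) set" and g
    using linear_continuous_on_compose[OF that H] .
  have Qc: "continuous_on UNIV Q" unfolding Q_def by (intro continuous_intros contH) auto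
  have strict: "upper U y - Q y < upper U x1 - Q x1" if "y \<in> cball x1 \<rho>" "y \<noteq> x1" for y
  proof -
    have "\<eta> * (norm (y - x1))\<^sup>2 > 0" using \<eta> that(2) by simp
    then show ?thesis using touch[OF that(1)] by (simp add: Q_def linear_0[OF H])
  qed
  obtain r z where r: "filterlim r at_top sequentially" and z: "\<And>k. z k \<in> nodes (Th (r k))" and zlim: "z \<longlonglongrightarrow> x1"
    and Ulim: "(\<lambda>k. U (r k) (z k)) \<longlonglongrightarrow> upper U x1"
    and zmax: "\<And>k v. v \<in> nodes (Th (r k)) \<Longrightarrow> v \<in> cball x1 \<rho> \<Longrightarrow> U (r k) v - Q v \<le> U (r k) (z k) - Q (z k)"
    by (rule limit_maximizer[OF bd x1 \<rho> Qc strict]) (assumption | rule that)+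
  obtain B where B: "B > 0" "\<And>a. norm (H a) \<le> B * norm a" using linear_bounded_pos[OF H] by blast
  have HB: "\<bar>a \<bullet> H a\<bar> \<le> B * (norm a)\<^sup>2" for a
  proof -
    have "\<bar>a \<bullet> H a\<bar> \<le> norm a * norm (H a)" by (rule Cauchy_Schwarz_ineq2)
    also have "\<dots> \<le> norm a * (B * norm a)" using B(2) by (intro mult_left_mono) auto
    finally show ?thesis by (simp add: power2_eq_square mult_ac)
  qed
  \<comment> \<open>The gradient of \<open>Q\<close> at \<open>y\<close>; the adjoint appears since
    \<open>H\<close> need not be symmetric.\<close>
  define P where "P y = p + (1 / 2) *\<^sub>R (H (y - x1) + adjoint H (y - x1))" for y
  have expand: "Q (y + a) = Q y + P y \<bullet> a + a \<bullet> H a / 2" for y a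
  proof -
    define b where "b = y - x1"
    have yb: "y + a - x1 = b + a" by (simp add: b_def)
    have "adjoint H b \<bullet> a = b \<bullet> H a" using adjoint_works[OF H, of a b] by (simp add: inner_commute)
    then have Pa: "P y \<bullet> a = p \<bullet> a + (H b \<bullet> a + b \<bullet> H a) / 2"
      unfolding P_def b_def[symmetric] by (simp add: inner_add_left)
    show ?thesis unfolding Pa unfolding Q_def yb b_def[symmetric]
      by (simp add: linear_add[OF H] inner_add_left inner_add_right add_divide_distrib inner_commute)
  qed
  have epsr: "(\<lambda>k. \<epsilon> (r k)) \<longlonglongrightarrow> 0" and hepsr: "(\<lambda>k. h (r k) / \<epsilon> (r k)) \<longlonglongrightarrow> 0"
    and \<theta>r: "(\<lambda>k. \<theta> (r k)) \<longlonglongrightarrow> 0" and hr: "(\<lambda>k. h (r k)) \<longlonglongrightarrow> 0"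
    using filterlim_compose[OF eps_lim r] filterlim_compose[OF heps_lim r] filterlim_compose[OF \<theta>_lim r]
      filterlim_compose[OF h_lim r] by auto
  define good where "good k w \<longleftrightarrow> norm w \<le> 1 \<and> - (w \<bullet> H w) \<le> F (z k) + B * (h (r k) / \<epsilon> (r k))\<^sup>2 \<and>
      (\<forall>v\<in>S (r k). P (z k) \<bullet> v \<le> P (z k) \<bullet> w + 2 * B * \<epsilon> (r k))" for k w
  have "\<forall>\<^sub>F k in sequentially. \<exists>w. good k w"
  proof -
    have fr: "x1 \<notin> frontier \<Omega>" using x1 by (simp add: frontier_eq)
    then have "infdist x1 (frontier \<Omega>) > 0" using frontier_ne by (simp add: infdist_pos_not_in_closed)
    moreover have "(\<lambda>k. infdist (z k) (frontier \<Omega>) - 2 * \<epsilon> (r k)) \<longlonglongrightarrow> infdist x1 (frontier \<Omega>) - 2 * 0"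
      by (intro tendsto_intros tendsto_infdist zlim epsr)
    ultimately have e1: "\<forall>\<^sub>F k in sequentially. 0 < infdist (z k) (frontier \<Omega>) - 2 * \<epsilon> (r k)"
      by (intro order_tendstoD) auto
    have e2: "\<forall>\<^sub>F k in sequentially. z k \<in> \<Omega>" using topological_tendstoD[OF zlim open_\<Omega> x1] .
    have "(\<lambda>k. \<psi> (z k)) \<longlonglongrightarrow> \<psi> x1" by (rule continuous_on_tendsto_compose[OF \<psi>(1) zlim x1 e2])
    then have "(\<lambda>k. U (r k) (z k) - \<psi> (z k)) \<longlonglongrightarrow> upper U x1 - \<psi> x1" by (intro tendsto_diff Ulim)
    then have e3: "\<forall>\<^sub>F k in sequentially. 0 < U (r k) (z k) - \<psi> (z k)"
      using \<psi>(2) by (intro order_tendstoD) auto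
    have "(\<lambda>k. dist (z k) x1 + (\<epsilon> (r k) + h (r k))) \<longlonglongrightarrow> 0 + (0 + 0)"
      by (intro tendsto_add epsr hr iffD1[OF tendsto_dist_iff zlim])
    then have e4: "\<forall>\<^sub>F k in sequentially. dist (z k) x1 + (\<epsilon> (r k) + h (r k)) < \<rho>"
      using \<rho>(1) by (intro order_tendstoD) auto
    show ?thesis using e1 e2 e3 e4
    proof eventually_elim
      case (elim k)
      have int: "z k \<in> interior_nodes \<Omega> (Th (r k)) (\<epsilon> (r k))"
        using elim(1,2) z by (simp add: interior_nodes_def inner_set_def)
      have "minus_disc_inf_lap (Th (r k)) (S (r k)) (\<epsilon> (r k)) Q (z k)
          \<le> minus_disc_inf_lap (Th (r k)) (S (r k)) (\<epsilon> (r k)) (U (r k)) (z k)"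
      proof (rule two_scale.minus_disc_inf_lap_mono[OF two_scale int])
        fix v assume v: "v \<in> nodes (Th (r k))" "dist (z k) v \<le> \<epsilon> (r k) + h (r k)"
        have "dist x1 v \<le> \<rho>" using dist_triangle[of x1 v "z k"] v(2) elim(4) by (simp add: dist_commute)
        then show "U (r k) v - Q v \<le> U (r k) (z k) - Q (z k)" using zmax[OF v(1)] by simp
      qed
      moreover have "U (r k) (z k) \<le> \<psi> (z k) \<or>
          minus_disc_inf_lap (Th (r k)) (S (r k)) (\<epsilon> (r k)) (U (r k)) (z k) \<le> F (z k)"
        using sub[of "r k"] int unfolding disc_sub_def by blast
      ultimately have le: "minus_disc_inf_lap (Th (r k)) (S (r k)) (\<epsilon> (r k)) Q (z k) \<le> F (z k)"
        using elim(3) by linarith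
      obtain w where "norm w \<le> 1" "- (w \<bullet> H w) \<le> F (z k) + B * (h (r k) / \<epsilon> (r k))\<^sup>2"
        "\<And>v. v \<in> S (r k) \<Longrightarrow> P (z k) \<bullet> v \<le> P (z k) \<bullet> w + 2 * B * \<epsilon> (r k)"
        by (rule two_scale.quadratic_consistency[OF two_scale int H HB less_imp_le[OF B(1)] expand le]) (assumption | rule that)+
      then show ?case unfolding good_def by (intro exI[of _ w]) simp
    qed
  qed
  then obtain N where N: "\<And>k. k \<ge> N \<Longrightarrow> \<exists>w. good k w" unfolding eventually_sequentially by blast
  then have "\<forall>k. \<exists>w. good (k + N) w" by simp
  from choice[OF this] obtain w where "\<forall>k. good (k + N) (w k)" by (rule exE)
  then have w: "\<And>k. good (k + N) (w k)" by (rule spec)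
  have "\<forall>k. w k \<in> cball 0 1" using w unfolding good_def by simp
  then obtain w' \<sigma> where \<sigma>: "w' \<in> cball 0 1" "strict_mono \<sigma>" "(w \<circ> \<sigma>) \<longlonglongrightarrow> w'"
    using compact_cball[of "0 :: real^'n" 1] unfolding compact_def by blast
  define m where "m k = \<sigma> k + N" for k
  have m: "filterlim m at_top sequentially"
    unfolding m_def using filterlim_compose[OF filterlim_add_const_nat_at_top filterlim_subseq[OF \<sigma>(2)]] .
  have wlim: "(\<lambda>k. w (\<sigma> k)) \<longlonglongrightarrow> w'" using \<sigma>(3) by (simp add: o_def)
  have g: "good (m k) (w (\<sigma> k))" for k using w by (simp add: m_def)
  have zm: "(\<lambda>k. z (m k)) \<longlonglongrightarrow> x1" using filterlim_compose[OF zlim m] .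
  have contlin: "(\<lambda>k. L (a k)) \<longlonglongrightarrow> L b" if "linear L" "a \<longlonglongrightarrow> b" for L :: "real^'n \<Rightarrow> real^'n" and a b
    using bounded_linear.tendsto[OF _ that(2)] that(1) linear_conv_bounded_linear by blast
  have Fx: "- (w' \<bullet> H w') \<le> F x1"
  proof (rule LIMSEQ_le)
    show "(\<lambda>k. - (w (\<sigma> k) \<bullet> H (w (\<sigma> k)))) \<longlonglongrightarrow> - (w' \<bullet> H w')"
      by (intro tendsto_intros wlim contlin[OF H])
    have "\<forall>\<^sub>F k in sequentially. z (m k) \<in> \<Omega>" using topological_tendstoD[OF zm open_\<Omega> x1] .
    then have "(\<lambda>k. F (z (m k))) \<longlonglongrightarrow> F x1" by (intro continuous_on_tendsto_compose[OF F zm x1])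
    then have "(\<lambda>k. F (z (m k)) + B * (h (r (m k)) / \<epsilon> (r (m k)))\<^sup>2) \<longlonglongrightarrow> F x1 + B * 0\<^sup>2"
      by (intro tendsto_intros filterlim_compose[OF hepsr m])
    then show "(\<lambda>k. F (z (m k)) + B * (h (r (m k)) / \<epsilon> (r (m k)))\<^sup>2) \<longlonglongrightarrow> F x1" by simp
    show "\<exists>N. \<forall>k\<ge>N. - (w (\<sigma> k) \<bullet> H (w (\<sigma> k))) \<le> F (z (m k)) + B * (h (r (m k)) / \<epsilon> (r (m k)))\<^sup>2"
      using g unfolding good_def by blast
  qed
  have Plim: "(\<lambda>k. P (z (m k))) \<longlonglongrightarrow> p"
  proof -
    have d: "(\<lambda>k. z (m k) - x1) \<longlonglongrightarrow> 0" using tendsto_diff[OF zm tendsto_const[of x1]] by simp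
    have "(\<lambda>k. P (z (m k))) \<longlonglongrightarrow> p + (1 / 2) *\<^sub>R (H 0 + adjoint H 0)"
      unfolding P_def
      by (rule tendsto_add[OF tendsto_const tendsto_scaleR[OF tendsto_const
            tendsto_add[OF contlin[OF H d] contlin[OF adjoint_linear[OF H] d]]]])
    then show ?thesis by (simp add: linear_0[OF H] linear_0[OF adjoint_linear[OF H]])
  qed
  have dir: "p \<bullet> e \<le> p \<bullet> w'" if e: "norm e = 1" for e
  proof -
    have "\<forall>k. \<exists>v. v \<in> S (r (m k)) \<and> norm (e - v) \<le> \<theta> (r (m k))"
      using two_scale.dense_S[OF two_scale e] by blast
    from choice[OF this] obtain v where v: "\<forall>k. v k \<in> S (r (m k)) \<and> norm (e - v k) \<le> \<theta> (r (m k))" by (rule exE)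
    have vlim: "v \<longlonglongrightarrow> e"
    proof (rule metric_tendsto_imp_tendsto[OF filterlim_compose[OF \<theta>r m]])
      show "\<forall>\<^sub>F k in sequentially. dist (v k) e \<le> dist (\<theta> (r (m k))) 0"
        using v \<theta>_ge by (intro always_eventually allI) (simp add: dist_norm norm_minus_commute)
    qed
    show ?thesis
    proof (rule LIMSEQ_le)
      show "(\<lambda>k. P (z (m k)) \<bullet> v k) \<longlonglongrightarrow> p \<bullet> e" by (intro tendsto_inner Plim vlim)
      have "(\<lambda>k. P (z (m k)) \<bullet> w (\<sigma> k) + 2 * B * \<epsilon> (r (m k))) \<longlonglongrightarrow> p \<bullet> w' + 2 * B * 0"
        by (intro tendsto_intros Plim wlim filterlim_compose[OF epsr m])
      then show "(\<lambda>k. P (z (m k)) \<bullet> w (\<sigma> k) + 2 * B * \<epsilon> (r (m k))) \<longlonglongrightarrow> p \<bullet> w'" by simp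
      show "\<exists>N. \<forall>k\<ge>N. P (z (m k)) \<bullet> v k \<le> P (z (m k)) \<bullet> w (\<sigma> k) + 2 * B * \<epsilon> (r (m k))"
        using g v unfolding good_def by blast
    qed
  qed
  have nw: "norm w' \<le> 1" using \<sigma>(1) by simp
  \<comment> \<open>Equality case of the Cauchy-Schwarz inequality: \<open>w'\<close> lies in the
    unit ball and \<open>p \<bullet> w'\<close> reaches \<open>norm p\<close>.\<close>
  have "p = norm p *\<^sub>R w'"
  proof (cases "p = 0")
    case False
    have "p \<bullet> ((1 / norm p) *\<^sub>R p) \<le> p \<bullet> w'" using False by (intro dir) simp
    then have pw: "norm p \<le> p \<bullet> w'" using False by (simp add: dot_square_norm power2_eq_square)
    have "(norm (p - norm p *\<^sub>R w'))\<^sup>2 = (norm p)\<^sup>2 - 2 * norm p * (p \<bullet> w') + (norm p)\<^sup>2 * (norm w')\<^sup>2"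
      unfolding power2_norm_eq_inner
      by (simp add: inner_diff_left inner_diff_right inner_commute power2_eq_square algebra_simps del: dot_square_norm)
        (simp add: dot_square_norm power2_eq_square algebra_simps)
    also have "\<dots> \<le> (norm p)\<^sup>2 - 2 * norm p * norm p + (norm p)\<^sup>2 * 1"
      using pw nw by (intro add_mono diff_mono mult_left_mono) (auto simp: power_le_one)
    also have "\<dots> = 0" by (simp add: power2_eq_square)
    finally show ?thesis by simp
  qed simp
  then show ?thesis using nw Fx by blast
qed

text \<open>An extra \<open>\<eta> * (norm (y - x1))^2\<close> makes the contact strict. The
  directions depend on \<eta>, so the limit is taken for the minimum of
  \<open>- (w \<bullet> H w)\<close> over the compact set of admissible \<open>w\<close>.\<close>

lemma limit_visc_sub:
  assumes bd: "eventually_bounded U" and sub: "\<And>j. disc_sub \<Omega> (Th j) (S j) (\<epsilon> j) F \<psi> (U j)"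
    and x1: "x1 \<in> \<Omega>" and F: "continuous_on \<Omega> F" and \<psi>: "continuous_on \<Omega> \<psi>" "\<psi> x1 < upper U x1"
  shows "visc_sub (upper U) x1 (F x1)"
  unfolding visc_sub_def
proof (intro allI impI)
  fix p H assume H: "linear H"
    and ex: "\<exists>r>0. \<forall>y\<in>ball x1 r. upper U y \<le> upper U x1 + p \<bullet> (y - x1) + (y - x1) \<bullet> H (y - x1) / 2"
  then obtain r where r: "r > 0" "\<And>y. y \<in> ball x1 r \<Longrightarrow> upper U y \<le> upper U x1 + p \<bullet> (y - x1) + (y - x1) \<bullet> H (y - x1) / 2"
    by blast
  obtain r' where r': "r' > 0" "cball x1 r' \<subseteq> \<Omega>" using open_\<Omega> x1 open_contains_cball by blast
  define \<rho> where "\<rho> = min (r / 2) r'"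
  have \<rho>: "\<rho> > 0" "cball x1 \<rho> \<subseteq> \<Omega>" "cball x1 \<rho> \<subseteq> ball x1 r" using r r' by (auto simp: \<rho>_def)
  have weak: "\<exists>w. norm w \<le> 1 \<and> p = norm p *\<^sub>R w \<and> - (w \<bullet> H w) - 2 * \<eta> * (norm w)\<^sup>2 \<le> F x1" if e: "\<eta> > 0" for \<eta>
  proof -
    define H' where "H' v = H v + (2 * \<eta>) *\<^sub>R v" for v
    have lin: "linear H'" unfolding H'_def by (intro linear_compose_add H linear_scale_self)
    have quad: "v \<bullet> H' v = v \<bullet> H v + 2 * \<eta> * (norm v)\<^sup>2" for v
      by (simp add: H'_def inner_add_right power2_norm_eq_inner)
    have "\<exists>w. norm w \<le> 1 \<and> p = norm p *\<^sub>R w \<and> - (w \<bullet> H' w) \<le> F x1"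
    proof (rule limit_visc_sub_strict[OF bd sub x1 F \<psi> \<rho>(1,2) lin e])
      fix y assume "y \<in> cball x1 \<rho>"
      then have "upper U y \<le> upper U x1 + p \<bullet> (y - x1) + (y - x1) \<bullet> H (y - x1) / 2" using r(2) \<rho>(3) by blast
      then show "upper U y + \<eta> * (norm (y - x1))\<^sup>2 \<le> upper U x1 + p \<bullet> (y - x1) + (y - x1) \<bullet> H' (y - x1) / 2"
        unfolding quad by (simp add: add_divide_distrib)
    qed
    then show ?thesis unfolding quad by (simp add: algebra_simps)
  qed
  show "\<exists>w. norm w \<le> 1 \<and> p = norm p *\<^sub>R w \<and> - (w \<bullet> H w) \<le> F x1"
  proof -
    let ?C = "{w \<in> cball 0 1. p = norm p *\<^sub>R w}"
    have cl: "?C = cball 0 1 \<inter> {w. p = norm p *\<^sub>R w}" by blast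
    have C: "compact ?C" unfolding cl
      by (intro compact_Int_closed compact_cball closed_Collect_eq continuous_intros)
    have ne: "?C \<noteq> {}" using weak[of 1] by auto
    have "continuous_on ?C (\<lambda>w. - (w \<bullet> H w))"
      by (intro continuous_intros linear_continuous_on_compose[OF _ H])
    from continuous_attains_inf[OF C ne this]
    obtain w0 where w0: "w0 \<in> ?C" "\<And>w. w \<in> ?C \<Longrightarrow> - (w0 \<bullet> H w0) \<le> - (w \<bullet> H w)" by blast
    have "- (w0 \<bullet> H w0) \<le> F x1"
    proof (rule field_le_epsilon)
      fix e :: real assume e: "e > 0"
      obtain w where w: "norm w \<le> 1" "p = norm p *\<^sub>R w" "- (w \<bullet> H w) - 2 * (e / 2) * (norm w)\<^sup>2 \<le> F x1"
        using weak[of "e / 2"] e by auto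
      have "e * (norm w)\<^sup>2 \<le> e * 1" using e w(1) by (intro mult_left_mono) (auto simp: power_le_one)
      moreover have "- (w0 \<bullet> H w0) \<le> - (w \<bullet> H w)" using w by (intro w0(2)) simp
      ultimately show "- (w0 \<bullet> H w0) \<le> F x1 + e" using w(3) by simp
    qed
    then show ?thesis using w0(1) by (intro exI[of _ w0]) simp
  qed
qed

end

section \<open>Convergence\<close>

text \<open>If \<open>f\<close> has a sign, \<open>w\<close> is replaced by \<open>l * w\<close>,
  which makes the two right-hand sides add up to something negative while moving \<open>w\<close> by
  at most \<open>M / 16\<close>. Locally \<open>f\<close> and the obstacle are then frozen to
  constants.\<close>

lemma obstacle_comparison:
  fixes u w f ob :: "'a::euclidean_space \<Rightarrow> real"
  assumes \<Omega>: "open \<Omega>" and K: "compact K" "\<Omega> \<subseteq> K"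
    and f: "continuous_on \<Omega> f" and ob: "continuous_on \<Omega> ob"
    and sign: "(\<exists>c>0. \<forall>x\<in>\<Omega>. c \<le> f x) \<or> (\<exists>c>0. \<forall>x\<in>\<Omega>. f x \<le> - c) \<or> (\<forall>x\<in>\<Omega>. f x = 0)"
    and usc: "usc_on K u" "usc_on K w" and B: "\<And>x. x \<in> K \<Longrightarrow> \<bar>w x\<bar> \<le> B"
    and bdry: "\<And>x. x \<in> K - \<Omega> \<Longrightarrow> u x + w x \<le> 0"
    and sub_u: "\<And>x. x \<in> \<Omega> \<Longrightarrow> ob x < u x \<Longrightarrow> visc_sub u x (f x)"
    and sub_w: "\<And>x. x \<in> \<Omega> \<Longrightarrow> visc_sub w x (- f x)"
    and w_le: "\<And>x. x \<in> \<Omega> \<Longrightarrow> w x \<le> - ob x"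
    and x: "x \<in> K"
  shows "u x + w x \<le> 0"
proof (rule ccontr)
  assume neg: "\<not> ?thesis"
  define M where "M = u x + w x"
  have M: "M > 0" using neg by (simp add: M_def)
  have B0: "B \<ge> 0" using B[OF x] by linarith
  define t where "t = min (1 / 2) (M / (16 * (B + 1)))"
  have t: "0 < t" "t < 1" "t * B \<le> M / 16"
  proof -
    show "0 < t" "t < 1" using M B0 by (auto simp: t_def)
    have "t * B \<le> M / (16 * (B + 1)) * (B + 1)" using M B0 by (intro mult_mono) (auto simp: t_def)
    also have "\<dots> = M / 16" using B0 by (simp add: field_simps)
    finally show "t * B \<le> M / 16" .
  qed
  \<comment> \<open>\<open>l = 1 + t\<close> for positive \<open>f\<close>, \<open>1 - t\<close> for
    negative \<open>f\<close>, and 1 for \<open>f = 0\<close>; the gain \<kappa> is \<open>t\<close>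
    times the distance of \<open>f\<close> from 0.\<close>
  have "\<exists>l \<kappa>. l > 0 \<and> \<bar>l - 1\<bar> * B \<le> M / 16 \<and> \<kappa> \<ge> 0 \<and> (\<forall>a\<in>\<Omega>. - (l * f a) \<le> - f a - \<kappa>)
      \<and> (\<kappa> > 0 \<or> (\<forall>a\<in>\<Omega>. f a = 0))"
    using sign
  proof (elim disjE exE conjE)
    fix c assume c: "c > 0" "\<forall>x\<in>\<Omega>. c \<le> f x"
    have "- ((1 + t) * f a) \<le> - f a - t * c" if "a \<in> \<Omega>" for a
    proof -
      have "t * c \<le> t * f a" using c that t by (intro mult_left_mono) auto
      then show ?thesis by (simp add: algebra_simps)
    qed
    then show ?thesis using c t by (intro exI[of _ "1 + t"] exI[of _ "t * c"]) auto
  next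
    fix c assume c: "c > 0" "\<forall>x\<in>\<Omega>. f x \<le> - c"
    have "- ((1 - t) * f a) \<le> - f a - t * c" if "a \<in> \<Omega>" for a
    proof -
      have "t * f a \<le> t * (- c)" using c that t by (intro mult_left_mono) auto
      then show ?thesis by (simp add: algebra_simps)
    qed
    then show ?thesis using c t by (intro exI[of _ "1 - t"] exI[of _ "t * c"]) auto
  next
    assume "\<forall>x\<in>\<Omega>. f x = 0"
    then show ?thesis using M by (intro exI[of _ 1] exI[of _ 0]) auto
  qed
  then obtain l \<kappa> where l: "l > 0" "\<bar>l - 1\<bar> * B \<le> M / 16" "\<kappa> \<ge> 0"
      "\<And>a. a \<in> \<Omega> \<Longrightarrow> - (l * f a) \<le> - f a - \<kappa>" "\<kappa> > 0 \<or> (\<forall>a\<in>\<Omega>. f a = 0)" by blast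
  have lw: "\<bar>l * w a - w a\<bar> \<le> M / 16" if "a \<in> K" for a
  proof -
    have "\<bar>l * w a - w a\<bar> = \<bar>l - 1\<bar> * \<bar>w a\<bar>" by (simp add: left_diff_distrib flip: abs_mult)
    also have "\<dots> \<le> \<bar>l - 1\<bar> * B" using B[OF that] by (intro mult_left_mono) auto
    finally show ?thesis using l(2) by linarith
  qed
  have lw1: "l * w a \<le> w a + M / 16" and lw2: "w a - M / 16 \<le> l * w a" if "a \<in> K" for a
    using lw[OF that] unfolding abs_le_iff by linarith+
  \<comment> \<open>Exactly what remains of \<open>M\<close> at \<open>x\<close> after the change of
    \<open>w\<close>, so the strict bound by \<open>m\<close> is a contradiction. It exceeds
    \<open>M / 16\<close>, the most that can occur on the boundary.\<close>
  define m where "m = 15 * M / 16"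
  have "u x + l * w x < m"
  proof (rule doubled_comparison[OF K usc(1) _ _ _ _ x])
    show "usc_on K (\<lambda>x. l * w x)"
      unfolding usc_on_def
    proof (intro ballI allI impI)
      fix y a assume y: "y \<in> K" "l * w y < a"
      then have "w y < a / l" using l(1) by (simp add: less_divide_eq mult.commute)
      then have "\<forall>\<^sub>F z in at y within K. w z < a / l" using usc(2) y(1) unfolding usc_on_def by blast
      then show "\<forall>\<^sub>F z in at y within K. l * w z < a"
        by eventually_elim (use l(1) in \<open>simp add: less_divide_eq mult.commute\<close>)
    qed
    show "0 < m" using M by (simp add: m_def)
    show "u y + l * w y < m" if "y \<in> K - \<Omega>" for y
      using bdry[OF that] lw1[of y] that M unfolding m_def by simp
    show "\<exists>r>0. fits_at_scale \<Omega> u (\<lambda>x. l * w x) m y r" if y: "y \<in> K \<inter> \<Omega>" for y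
    proof -
      \<comment> \<open>Their sum is \<open>- \<kappa> / 2\<close>, and each absorbs an oscillation
        \<open>\<kappa> / 4\<close> of \<open>f\<close>; for \<open>\<kappa> = 0\<close> the
        function \<open>f\<close> vanishes and so does \<open>c1\<close>. The threshold
        \<open>k\<close> stays above the obstacle near \<open>y\<close>.\<close>
      define c1 c2 k where "c1 = f y + \<kappa> / 4" and "c2 = - f y - 3 * \<kappa> / 4" and "k = ob y + M / 16"
      have near: "\<exists>r>0. \<forall>a\<in>ball y r. \<bar>g a - g y\<bar> < e" if ng: "continuous_on \<Omega> g" "e > 0" for g :: "'a \<Rightarrow> real" and e
      proof -
        have "isCont g y" using ng(1) \<Omega> y continuous_on_eq_continuous_at by blast
        then obtain r where "r > 0" "\<And>a. dist a y < r \<Longrightarrow> dist (g a) (g y) < e"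
          using ng(2) unfolding continuous_at_eps_delta by blast
        then show ?thesis by (intro exI[of _ r]) (auto simp: dist_real_def dist_commute)
      qed
      obtain r1 where r1: "r1 > 0" "ball y r1 \<subseteq> \<Omega>" using \<Omega> y openE by blast
      obtain r2 where r2: "r2 > 0" "\<And>a. a \<in> ball y r2 \<Longrightarrow> \<bar>ob a - ob y\<bar> < M / 16"
        using near[OF ob, of "M / 16"] M by auto
      obtain r3 where r3: "r3 > 0" "\<And>a. a \<in> ball y r3 \<Longrightarrow> a \<in> \<Omega> \<Longrightarrow> \<bar>f a - f y\<bar> \<le> \<kappa> / 4"
      proof (cases "\<kappa> > 0")
        case True
        then obtain r where "r > 0" "\<forall>a\<in>ball y r. \<bar>f a - f y\<bar> < \<kappa> / 4" using near[OF f, of "\<kappa> / 4"] by auto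
        then show thesis by (intro that[of r]) (auto simp: less_imp_le)
      next
        case False
        then show thesis using that[of 1] l y by auto
      qed
      define r where "r = Min {r1, r2, r3, 1, m / (2 * (\<bar>c1\<bar> + 1))}"
      have m0: "m > 0" using M by (simp add: m_def)
      have r: "r > 0" "r \<le> r1" "r \<le> r2" "r \<le> r3" "r \<le> 1" "r \<le> m / (2 * (\<bar>c1\<bar> + 1))"
      proof -
        have rle: "r \<le> q" if "q \<in> {r1, r2, r3, 1, m / (2 * (\<bar>c1\<bar> + 1))}" for q
          unfolding r_def using that by (intro Min_le) auto
        show "r \<le> r1" "r \<le> r2" "r \<le> r3" "r \<le> 1" "r \<le> m / (2 * (\<bar>c1\<bar> + 1))" by (rule rle, simp)+
        have "m / (2 * (\<bar>c1\<bar> + 1)) > 0" using m0 by simp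
        then show "r > 0" unfolding r_def using r1(1) r2(1) r3(1) by (subst Min_gr_iff) auto
      qed
      have "fits_at_scale \<Omega> u (\<lambda>x. l * w x) m y r"
        unfolding fits_at_scale_def
      proof (rule exI[of _ c1], rule exI[of _ c2], rule exI[of _ k], intro conjI ballI)
        show "c1 + c2 \<le> 0" using l(3) by (simp add: c1_def c2_def)
        show "c1 + c2 < 0 \<or> c1 = 0" using l(3,5) y by (auto simp: c1_def c2_def)
        have "r\<^sup>2 \<le> r" using r by (simp add: power2_eq_square mult_left_le)
        then have "\<bar>c1\<bar> * r\<^sup>2 \<le> (\<bar>c1\<bar> + 1) * (m / (2 * (\<bar>c1\<bar> + 1)))"
          using r by (intro mult_mono) auto
        also have "\<dots> = m / 2" using add_pos_nonneg[of 1 "\<bar>c1\<bar>"] by (simp add: field_simps)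
        finally show "\<bar>c1\<bar> * r\<^sup>2 \<le> m / 2" .
        fix a assume a: "a \<in> ball y r"
        show aO: "a \<in> \<Omega>" using a r(2) r1(2) by (auto simp: subset_iff)
        have ka: "\<bar>ob a - ob y\<bar> < M / 16" using a r(3) by (intro r2(2)) auto
        have fa: "\<bar>f a - f y\<bar> \<le> \<kappa> / 4" using a r(4) aO by (intro r3(2)) auto
        then have fa1: "f a \<le> f y + \<kappa> / 4" and fa2: "f y - \<kappa> / 4 \<le> f a" unfolding abs_le_iff by linarith+
        show "k \<le> u a \<longrightarrow> visc_sub u a c1"
        proof
          assume "k \<le> u a"
          then have "ob a < u a" using ka unfolding k_def abs_less_iff by linarith
          then show "visc_sub u a c1" using fa1 by (intro visc_sub_mono[OF sub_u[OF aO]]) (simp_all add: c1_def)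
        qed
        have "visc_sub (\<lambda>x. l * w x) a (l * (- f a))" by (rule visc_sub_scale[OF sub_w[OF aO] l(1)])
        then show "visc_sub (\<lambda>x. l * w x) a c2"
        proof (rule visc_sub_mono)
          show "l * (- f a) \<le> c2" using l(4)[OF aO] fa2 unfolding c2_def by simp
        qed
        have "a \<in> K" using aO K(2) by blast
        then show "k + l * w a \<le> m / 2"
          using lw1[of a] w_le[OF aO] ka M unfolding k_def m_def abs_less_iff by simp
      qed
      then show ?thesis using r(1) by blast
    qed
  qed
  then show False using lw2[OF x] M unfolding m_def M_def by (simp add: field_simps)
qed

lemma visc_sub_cong:
  assumes N: "open N" "x \<in> N" and eq: "\<And>y. y \<in> N \<Longrightarrow> u y = v y" and u: "visc_sub u x c"
  shows "visc_sub v x c"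
  unfolding visc_sub_def
proof (intro allI impI)
  fix p H assume H: "linear H" and "\<exists>r>0. \<forall>y\<in>ball x r. v y \<le> v x + p \<bullet> (y - x) + (y - x) \<bullet> H (y - x) / 2"
  then obtain r where r: "r > 0" "\<And>y. y \<in> ball x r \<Longrightarrow> v y \<le> v x + p \<bullet> (y - x) + (y - x) \<bullet> H (y - x) / 2" by blast
  obtain s where s: "s > 0" "ball x s \<subseteq> N" using N openE by blast
  have "u y \<le> u x + p \<bullet> (y - x) + (y - x) \<bullet> H (y - x) / 2" if "y \<in> ball x (min r s)" for y
  proof -
    have "y \<in> ball x r" "y \<in> N" using that s(2) by (auto simp: subset_iff)
    then show ?thesis using r(2)[of y] eq[of y] eq[OF N(2)] by simp
  qed
  moreover have "min r s > 0" using r s by simp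
  ultimately show "\<exists>w. norm w \<le> 1 \<and> p = norm p *\<^sub>R w \<and> - (w \<bullet> H w) \<le> c"
    using u H unfolding visc_sub_def by blast
qed

lemma usc_on_imp_continuous_on:
  assumes u: "usc_on K u" and w: "usc_on K w" and eq: "\<And>x. x \<in> K \<Longrightarrow> w x = - u x"
  shows "continuous_on K u"
  unfolding continuous_on_def
proof
  fix x assume x: "x \<in> K"
  show "(u \<longlongrightarrow> u x) (at x within K)"
  proof (rule order_tendstoI)
    fix a assume "u x < a"
    then show "\<forall>\<^sub>F y in at x within K. u y < a" using u x unfolding usc_on_def by blast
  next
    fix a assume "a < u x"
    then have "w x < - a" using eq[OF x] by simp
    then have "\<forall>\<^sub>F y in at x within K. w y < - a" using w x unfolding usc_on_def by blast
    moreover have "\<forall>\<^sub>F y in at x within K. y \<in> K" by (simp add: eventually_at_topological) blast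
    ultimately show "\<forall>\<^sub>F y in at x within K. a < u y"
    proof eventually_elim
      case (elim y)
      then show ?case using eq[of y] by simp
    qed
  qed
qed

section \<open>Boundary values of the limits and convergence at the nodes\<close>

context convergent_scheme
begin

lemma upper_le_boundary:
  assumes bd: "eventually_bounded U" and sub: "\<And>j. disc_sub \<Omega> (Th j) (S j) (\<epsilon> j) F \<psi> (U j)"
    and bdry: "boundary_le G U"
    and F: "\<And>x. x \<in> \<Omega> \<Longrightarrow> F x \<le> CF"
    and \<psi>: "continuous_on (closure \<Omega>) \<psi>" "\<psi> x0 < G x0" and x0: "x0 \<in> frontier \<Omega>"
  shows "upper U x0 \<le> G x0"
proof (rule field_le_epsilon)
  fix e :: real assume e: "e > 0"
  obtain A where A: "A \<ge> 0" "\<forall>\<^sub>F j in sequentially. \<forall>z\<in>nodes (Th j). U j z \<le> G x0 + e + A * sqrt (dist z x0)"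
    using sqrt_barrier_bound[OF sub bdry F \<psi> x0 e] by blast
  have x0c: "x0 \<in> closure \<Omega>" using x0 by (simp add: frontier_eq)
  obtain r z where r: "filterlim r at_top sequentially" "\<And>k. z k \<in> nodes (Th (r k))"
    "z \<longlonglongrightarrow> x0" "(\<lambda>k. U (r k) (z k)) \<longlonglongrightarrow> upper U x0"
    by (rule limit_setD[OF upper(1)[OF bd x0c]]) (rule that)
  have "\<forall>\<^sub>F k in sequentially. \<forall>z\<in>nodes (Th (r k)). U (r k) z \<le> G x0 + e + A * sqrt (dist z x0)"
    by (rule eventually_compose_filterlim[OF A(2) r(1)])
  then have le: "\<forall>\<^sub>F k in sequentially. U (r k) (z k) \<le> G x0 + e + A * sqrt (dist (z k) x0)"
    by eventually_elim (use r(2) in blast)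
  have "(\<lambda>k. G x0 + e + A * sqrt (dist (z k) x0)) \<longlonglongrightarrow> G x0 + e + A * sqrt (dist x0 x0)"
    by (intro tendsto_intros r(3))
  then have "(\<lambda>k. G x0 + e + A * sqrt (dist (z k) x0)) \<longlonglongrightarrow> G x0 + e" by simp
  from tendsto_le[OF sequentially_bot this r(4) le] show "upper U x0 \<le> G x0 + e" .
qed

lemma eventually_bounded_above:
  assumes sub: "\<And>j. disc_sub \<Omega> (Th j) (S j) (\<epsilon> j) F \<psi> (U j)"
    and bdry: "boundary_le G U"
    and F: "\<And>x. x \<in> \<Omega> \<Longrightarrow> F x \<le> CF"
    and \<psi>: "continuous_on (closure \<Omega>) \<psi>" "\<psi> x0 < G x0" and x0: "x0 \<in> frontier \<Omega>"
  shows "\<exists>B. \<forall>\<^sub>F j in sequentially. \<forall>z\<in>nodes (Th j). U j z \<le> B"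
proof -
  obtain A where A: "A \<ge> 0" "\<forall>\<^sub>F j in sequentially. \<forall>z\<in>nodes (Th j). U j z \<le> G x0 + 1 + A * sqrt (dist z x0)"
    using sqrt_barrier_bound[OF sub bdry F \<psi> x0 zero_less_one] by blast
  have x0c: "x0 \<in> closure \<Omega>" using x0 by (simp add: frontier_eq)
  let ?D = "diameter (closure \<Omega>)"
  have "\<forall>\<^sub>F j in sequentially. \<forall>z\<in>nodes (Th j). U j z \<le> G x0 + 1 + A * sqrt ?D"
    using A(2)
  proof eventually_elim
    case (elim j)
    show ?case
    proof
      fix z assume z: "z \<in> nodes (Th j)"
      have "dist z x0 \<le> ?D"
        by (rule diameter_bounded_bound[OF compact_imp_bounded[OF compact_closure] nodes_in[OF z] x0c])
      then have "A * sqrt (dist z x0) \<le> A * sqrt ?D" using A(1) by (intro mult_left_mono) auto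
      then show "U j z \<le> G x0 + 1 + A * sqrt ?D" using bspec[OF elim z] by linarith
    qed
  qed
  then show ?thesis by blast
qed

text \<open>Nodes with error at least \<open>e\<close> for infinitely many \<open>j\<close> would
  accumulate at a point of the limit set off the graph of \<open>u\<close>.\<close>

lemma nodal_convergence:
  assumes bd: "eventually_bounded U" and u: "continuous_on (closure \<Omega>) u"
    and graph: "\<And>x t. (x, t) \<in> limit_set U \<Longrightarrow> t = u x" and e: "e > 0"
  shows "\<forall>\<^sub>F j in sequentially. \<forall>z\<in>nodes (Th j). \<bar>U j z - u z\<bar> < e"
proof (rule ccontr)
  assume "\<not> ?thesis"
  then have "\<forall>J. \<exists>j\<ge>J. \<exists>z\<in>nodes (Th j). e \<le> \<bar>U j z - u z\<bar>"
    unfolding eventually_sequentially by (simp add: not_less)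
  then have "\<forall>J. \<exists>p. J \<le> fst p \<and> snd p \<in> nodes (Th (fst p)) \<and> e \<le> \<bar>U (fst p) (snd p) - u (snd p)\<bar>"
    unfolding split_paired_Ex fst_conv snd_conv by blast
  from choice[OF this] obtain p where "\<forall>J. J \<le> fst (p J) \<and> snd (p J) \<in> nodes (Th (fst (p J)))
      \<and> e \<le> \<bar>U (fst (p J)) (snd (p J)) - u (snd (p J))\<bar>" by (rule exE)
  then have p: "J \<le> fst (p J)" "snd (p J) \<in> nodes (Th (fst (p J)))" "e \<le> \<bar>U (fst (p J)) (snd (p J)) - u (snd (p J))\<bar>" for J
    by auto
  have fl: "filterlim (\<lambda>n. fst (p n)) at_top sequentially"
    using filterlim_at_top_mono[OF filterlim_ident, of "\<lambda>n. fst (p n)"] p(1) by (simp add: always_eventually)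
  obtain \<sigma> x t where s: "strict_mono \<sigma>" "filterlim (\<lambda>k. fst (p (\<sigma> k))) at_top sequentially"
    "(\<lambda>k. snd (p (\<sigma> k))) \<longlonglongrightarrow> x" "(\<lambda>k. U (fst (p (\<sigma> k))) (snd (p (\<sigma> k)))) \<longlonglongrightarrow> t" "(x, t) \<in> limit_set U"
    by (rule subsequence_limit[where z = "\<lambda>n. snd (p n)", OF bd fl p(2)]) (rule that)
  have xc: "x \<in> closure \<Omega>" using s(5) compact_limit_set(2)[OF bd] by blast
  have "(\<lambda>k. u (snd (p (\<sigma> k)))) \<longlonglongrightarrow> u x"
    by (rule continuous_on_tendsto_compose[OF u s(3) xc]) (intro always_eventually allI nodes_in[OF p(2)])
  then have "(\<lambda>k. \<bar>U (fst (p (\<sigma> k))) (snd (p (\<sigma> k))) - u (snd (p (\<sigma> k)))\<bar>) \<longlonglongrightarrow> \<bar>t - u x\<bar>"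
    by (intro tendsto_rabs tendsto_diff s(4))
  then have "e \<le> \<bar>t - u x\<bar>" by (rule LIMSEQ_le_const) (use p(3) in auto)
  then show False using graph[OF s(5)] e by simp
qed

lemma obstacle_convergence:
  fixes U :: "nat \<Rightarrow> real^'n \<Rightarrow> real" and f ob g :: "real^'n \<Rightarrow> real"
  assumes f: "continuous_on \<Omega> f" "\<And>x. x \<in> \<Omega> \<Longrightarrow> \<bar>f x\<bar> \<le> CF"
    and sign: "(\<exists>c>0. \<forall>x\<in>\<Omega>. c \<le> f x) \<or> (\<exists>c>0. \<forall>x\<in>\<Omega>. f x \<le> - c) \<or> (\<forall>x\<in>\<Omega>. f x = 0)"
    and ob: "continuous_on (closure \<Omega>) ob" "\<And>x. x \<in> frontier \<Omega> \<Longrightarrow> ob x < g x"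
    and sol: "\<And>j z. z \<in> interior_nodes \<Omega> (Th j) (\<epsilon> j) \<Longrightarrow>
       min (minus_disc_inf_lap (Th j) (S j) (\<epsilon> j) (U j) z - f z) (U j z - ob z) = 0"
    and bdry: "boundary_le g U" "boundary_le (\<lambda>x. - g x) (\<lambda>j x. - U j x)"
  shows "\<exists>u. viscosity_obstacle_solution \<Omega> f ob g u \<and>
    (\<forall>e>0. \<forall>\<^sub>F j in sequentially. \<forall>z\<in>nodes (Th j). \<bar>U j z - u z\<bar> < e)"
proof -
  let ?V = "\<lambda>j x. - U j x"
  have subU: "disc_sub \<Omega> (Th j) (S j) (\<epsilon> j) f ob (U j)" for j
    unfolding disc_sub_def
  proof
    fix z assume "z \<in> interior_nodes \<Omega> (Th j) (\<epsilon> j)"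
    from sol[OF this] show "U j z \<le> ob z \<or> minus_disc_inf_lap (Th j) (S j) (\<epsilon> j) (U j) z \<le> f z"
      by (auto simp: min_def split: if_splits)
  qed
  \<comment> \<open>The threshold is arbitrary and will be placed one unit below the value in
    question, because the barrier and the limit lemma ask for strict inequality.\<close>
  have subV: "disc_sub \<Omega> (Th j) (S j) (\<epsilon> j) (\<lambda>x. - f x) (\<lambda>_. c) (?V j)" for j c
    unfolding disc_sub_def
  proof
    fix z assume "z \<in> interior_nodes \<Omega> (Th j) (\<epsilon> j)"
    from sol[OF this] have "f z \<le> minus_disc_inf_lap (Th j) (S j) (\<epsilon> j) (U j) z"
      by (auto simp: min_def split: if_splits)
    then show "- U j z \<le> c \<or> minus_disc_inf_lap (Th j) (S j) (\<epsilon> j) (?V j) z \<le> - f z"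
      using two_scale.minus_disc_inf_lap_uminus[OF two_scale, of j "U j" z] by simp
  qed
  have fle: "f x \<le> CF" "- f x \<le> CF" if "x \<in> \<Omega>" for x using f(2)[OF that] by linarith+
  obtain b where b: "b \<in> frontier \<Omega>" using frontier_ne by blast
  obtain B1 where B1: "\<forall>\<^sub>F j in sequentially. \<forall>z\<in>nodes (Th j). U j z \<le> B1"
    using eventually_bounded_above[OF subU bdry(1) fle(1) ob(1) ob(2)[OF b] b] by blast
  have "\<exists>B. \<forall>\<^sub>F j in sequentially. \<forall>z\<in>nodes (Th j). ?V j z \<le> B"
    by (rule eventually_bounded_above[OF subV[of _ "- g b - 1"] bdry(2) fle(2) continuous_on_const _ b]) auto
  then obtain B2 where B2: "\<forall>\<^sub>F j in sequentially. \<forall>z\<in>nodes (Th j). ?V j z \<le> B2" by blast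
  have ev: "\<forall>\<^sub>F j in sequentially. \<forall>z\<in>nodes (Th j). \<bar>U j z\<bar> \<le> \<bar>B1\<bar> + \<bar>B2\<bar>"
    using B1 B2
  proof eventually_elim
    case (elim j)
    show ?case
    proof
      fix z assume z: "z \<in> nodes (Th j)"
      show "\<bar>U j z\<bar> \<le> \<bar>B1\<bar> + \<bar>B2\<bar>" using bspec[OF elim(1) z] bspec[OF elim(2) z] by linarith
    qed
  qed
  then have bdU: "eventually_bounded U" unfolding eventually_bounded_def by blast
  have bdV: "eventually_bounded ?V" using ev unfolding eventually_bounded_def by auto
  define u w where "u = upper U" and "w = upper ?V"
  have uscu: "usc_on (closure \<Omega>) u" and uscw: "usc_on (closure \<Omega>) w"
    unfolding u_def w_def by (intro usc_upper bdU bdV)+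
  have LV: "(x, t) \<in> limit_set U \<Longrightarrow> - t \<le> w x" if "x \<in> closure \<Omega>" for x t
    unfolding w_def by (rule upper(2)[OF bdV that]) (simp add: limit_set_uminus)
  have LU: "(x, t) \<in> limit_set U \<Longrightarrow> t \<le> u x" if "x \<in> closure \<Omega>" for x t
    unfolding u_def by (rule upper(2)[OF bdU that])
  have ubdry: "u x \<le> g x" if "x \<in> frontier \<Omega>" for x
    unfolding u_def by (rule upper_le_boundary[OF bdU subU bdry(1) fle(1) ob(1) ob(2)[OF that] that])
  have wbdry: "w x \<le> - g x" if "x \<in> frontier \<Omega>" for x
    unfolding w_def
    by (rule upper_le_boundary[OF bdV subV[of _ "- g x - 1"] bdry(2) fle(2) continuous_on_const _ that]) auto
  have subu: "visc_sub u x (f x)" if "x \<in> \<Omega>" "ob x < u x" for x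
    using limit_visc_sub[OF bdU subU that(1) f(1) continuous_on_subset[OF ob(1) closure_subset]] that(2)
    unfolding u_def by blast
  have subw: "visc_sub w x (- f x)" if "x \<in> \<Omega>" for x
    unfolding w_def
    by (rule limit_visc_sub[OF bdV subV[of _ "upper ?V x - 1"] that]) (auto intro!: continuous_intros f(1))
  \<comment> \<open>A node sequence realising \<open>w x\<close> is eventually interior, where the
    discrete solution lies above the obstacle.\<close>
  have wle: "w x \<le> - ob x" if x: "x \<in> \<Omega>" for x
  proof -
    have xc: "x \<in> closure \<Omega>" using x closure_subset by blast
    obtain r z where r: "filterlim r at_top sequentially" "\<And>k. z k \<in> nodes (Th (r k))"
      "z \<longlonglongrightarrow> x" "(\<lambda>k. ?V (r k) (z k)) \<longlonglongrightarrow> w x"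
      by (rule limit_setD[OF upper(1)[OF bdV xc], folded w_def]) (rule that)
    have "x \<notin> frontier \<Omega>" using x by (simp add: frontier_eq)
    then have "infdist x (frontier \<Omega>) > 0" using frontier_ne by (simp add: infdist_pos_not_in_closed)
    moreover have "(\<lambda>k. infdist (z k) (frontier \<Omega>) - 2 * \<epsilon> (r k)) \<longlonglongrightarrow> infdist x (frontier \<Omega>) - 2 * 0"
      by (intro tendsto_intros tendsto_infdist r(3) filterlim_compose[OF eps_lim r(1)])
    ultimately have e1: "\<forall>\<^sub>F k in sequentially. 0 < infdist (z k) (frontier \<Omega>) - 2 * \<epsilon> (r k)"
      by (intro order_tendstoD) auto
    have e2: "\<forall>\<^sub>F k in sequentially. z k \<in> \<Omega>" using topological_tendstoD[OF r(3) open_\<Omega> x] .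
    have lim: "(\<lambda>k. - ob (z k)) \<longlonglongrightarrow> - ob x"
      by (intro tendsto_minus continuous_on_tendsto_compose[OF continuous_on_subset[OF ob(1) closure_subset] r(3) x e2])
    have "\<forall>\<^sub>F k in sequentially. ?V (r k) (z k) \<le> - ob (z k)"
      using e1 e2
    proof eventually_elim
      case (elim k)
      have "z k \<in> interior_nodes \<Omega> (Th (r k)) (\<epsilon> (r k))"
        using elim r(2) by (simp add: interior_nodes_def inner_set_def)
      from sol[OF this] show ?case by (auto simp: min_def split: if_splits)
    qed
    from tendsto_le[OF sequentially_bot lim r(4) this] show ?thesis .
  qed
  obtain B where B: "\<And>x. x \<in> closure \<Omega> \<Longrightarrow> \<bar>w x\<bar> \<le> B"
  proof -
    obtain B where B: "\<And>q. q \<in> limit_set ?V \<Longrightarrow> norm q \<le> B"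
      using compact_imp_bounded[OF compact_limit_set(1)[OF bdV]] unfolding bounded_iff by blast
    have "\<bar>w x\<bar> \<le> B" if "x \<in> closure \<Omega>" for x
    proof -
      have "norm (x, w x) \<le> B" unfolding w_def by (intro B upper(1)[OF bdV that])
      then show ?thesis using norm_snd_le[of "w x" x] by simp
    qed
    then show thesis by (rule that)
  qed
  have cmp: "u x + w x \<le> 0" if "x \<in> closure \<Omega>" for x
  proof (rule obstacle_comparison[OF open_\<Omega> compact_closure closure_subset f(1)
        continuous_on_subset[OF ob(1) closure_subset] sign uscu uscw B _ subu subw wle that])
    show "u x + w x \<le> 0" if "x \<in> closure \<Omega> - \<Omega>" for x
      using ubdry[of x] wbdry[of x] that by (simp add: frontier_eq)
  qed
  \<comment> \<open>Squeeze \<open>t \<le> u x\<close> and \<open>- t \<le> w x\<close> with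
    \<open>u x + w x \<le> 0\<close>.\<close>
  have graph: "t = u x \<and> w x = - u x" if xt: "(x, t) \<in> limit_set U" for x t
  proof -
    have xc: "x \<in> closure \<Omega>" using xt compact_limit_set(2)[OF bdU] by blast
    show ?thesis using LV[OF xc xt] LU[OF xc xt] cmp[OF xc] by linarith
  qed
  have wu: "w x = - u x" if "x \<in> closure \<Omega>" for x
    using graph upper(1)[OF bdU that] by blast
  have cont: "continuous_on (closure \<Omega>) u" by (rule usc_on_imp_continuous_on[OF uscu uscw wu])
  have contO: "continuous_on \<Omega> u" by (rule continuous_on_subset[OF cont closure_subset])
  have inO: "x \<in> closure \<Omega>" if "x \<in> \<Omega>" for x using that closure_subset by blast
  have "viscosity_obstacle_solution \<Omega> f ob g u"
    unfolding viscosity_obstacle_solution_def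
  proof (intro conjI ballI allI impI cont)
    show "u x = g x" if "x \<in> frontier \<Omega>" for x
      using ubdry[OF that] wbdry[OF that] wu[of x] that by (simp add: frontier_eq)
  next
    fix x0 \<phi> assume x0: "x0 \<in> \<Omega>" and C: "C2 \<phi>"
      and "\<exists>r>0. \<forall>y\<in>\<Omega> \<inter> ball x0 r. u y - \<phi> y \<le> u x0 - \<phi> x0"
    then obtain r where r: "r > 0" "\<And>y. y \<in> \<Omega> \<inter> ball x0 r \<Longrightarrow> u y - \<phi> y \<le> u x0 - \<phi> x0" by blast
    show "min (- inf_lap_plus \<phi> x0 - f x0) (u x0 - ob x0) \<le> 0"
    proof (cases "ob x0 < u x0")
      case True
      \<comment> \<open>The noncontact set; the viscosity inequality for \<open>u\<close> is known
        only there, and it is open since \<open>u\<close> is by now continuous.\<close>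
      define N where "N = \<Omega> \<inter> (\<lambda>x. u x - ob x) -` {0<..}"
      have N: "open N" unfolding N_def
        by (intro continuous_open_preimage continuous_on_diff contO continuous_on_subset[OF ob(1) closure_subset]
            open_\<Omega> open_greaterThan)
      have "- inf_lap_plus \<phi> x0 \<le> f x0"
      proof (rule visc_sub_inf_lap_plus[OF _ N _ _ _ C r(1)])
        show "x0 \<in> N" using True x0 by (simp add: N_def)
        show "continuous_on N u" "continuous_on N f"
          by (rule continuous_on_subset[OF contO] continuous_on_subset[OF f(1)]; force simp: N_def)+
        show "visc_sub u x (f x)" if "x \<in> N" for x using that by (intro subu) (auto simp: N_def)
        show "u y - \<phi> y \<le> u x0 - \<phi> x0" if "y \<in> N \<inter> ball x0 r" for y using that r(2)[of y] by (auto simp: N_def)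
      qed
      then show ?thesis by (simp add: min_le_iff_disj)
    qed (simp add: min_le_iff_disj)
  next
    fix x0 \<phi> assume x0: "x0 \<in> \<Omega>" and C: "C2 \<phi>"
      and "\<exists>r>0. \<forall>y\<in>\<Omega> \<inter> ball x0 r. u x0 - \<phi> x0 \<le> u y - \<phi> y"
    then obtain r where r: "r > 0" "\<And>y. y \<in> \<Omega> \<inter> ball x0 r \<Longrightarrow> u x0 - \<phi> x0 \<le> u y - \<phi> y" by blast
    have "- inf_lap_plus (\<lambda>x. - \<phi> x) x0 \<le> - f x0"
    proof (rule visc_sub_inf_lap_plus[OF x0 open_\<Omega> _ _ _ C2_uminus(1)[OF C] r(1)])
      show "continuous_on \<Omega> (\<lambda>x. - u x)" "continuous_on \<Omega> (\<lambda>x. - f x)"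
        by (intro continuous_on_minus contO f(1))+
      show "visc_sub (\<lambda>x. - u x) x (- f x)" if "x \<in> \<Omega>" for x
        by (rule visc_sub_cong[OF open_\<Omega> that _ subw[OF that]]) (intro wu inO)
      show "- u y - - \<phi> y \<le> - u x0 - - \<phi> x0" if "y \<in> \<Omega> \<inter> ball x0 r" for y using r(2)[OF that] by simp
    qed
    moreover have "ob x0 \<le> u x0" using wle[OF x0] wu[OF inO[OF x0]] by simp
    ultimately show "0 \<le> min (- inf_lap_minus \<phi> x0 - f x0) (u x0 - ob x0)"
      by (simp add: inf_lap_plus_uminus[OF C])
  qed
  moreover have "\<forall>e>0. \<forall>\<^sub>F j in sequentially. \<forall>z\<in>nodes (Th j). \<bar>U j z - u z\<bar> < e"
    using nodal_convergence[OF bdU cont] graph by blast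
  ultimately show ?thesis by blast
qed

end

section \<open>Boundary data\<close>

text \<open>A bounded \<open>g\<close> is Hoelder continuous with exponent 0, and for this exponent
  \<open>cond_BC2\<close> gives an oscillation bound that is uniform in \<epsilon>.\<close>

lemma boundary_data_bounded:
  assumes K: "compact (closure \<Omega>)" and ne: "frontier \<Omega> \<noteq> {}"
    and g: "continuous_on (frontier \<Omega>) g" and BC2: "cond_BC2 \<Omega> g gt"
  shows "\<exists>B. \<forall>\<epsilon>>0. \<forall>x\<in>closure \<Omega>. \<bar>gt \<epsilon> x\<bar> \<le> B"
proof -
  have fc: "compact (frontier \<Omega>)" "frontier \<Omega> \<subseteq> closure \<Omega>"
    using K by (auto simp: frontier_def compact_diff)
  have "bounded (g ` frontier \<Omega>)" using compact_imp_bounded[OF compact_continuous_image[OF g fc(1)]] .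
  then obtain b where b: "\<And>x. x \<in> frontier \<Omega> \<Longrightarrow> \<bar>g x\<bar> \<le> b" by (auto simp: bounded_iff)
  have "holder_on 0 (2 * b) (frontier \<Omega>) g"
    unfolding holder_on_def
  proof (intro ballI)
    fix x y assume xy: "x \<in> frontier \<Omega>" "y \<in> frontier \<Omega>"
    have "\<bar>g x - g y\<bar> \<le> 2 * b" using b[OF xy(1)] b[OF xy(2)] abs_triangle_ineq4[of "g x" "g y"] by linarith
    \<comment> \<open>Equal points are treated apart because \<open>0 powr 0\<close> is 0.\<close>
    then show "\<bar>g x - g y\<bar> \<le> 2 * b * dist x y powr 0" by (cases "x = y") auto
  qed
  then have "\<exists>C. \<forall>\<epsilon>>0. holder_on 0 C (closure \<Omega>) (gt \<epsilon>) \<and> (\<forall>x\<in>frontier \<Omega>. \<bar>g x - gt \<epsilon> x\<bar> \<le> C * \<epsilon> powr 0)"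
    using BC2 unfolding cond_BC2_def by (meson atLeastAtMost_iff order_refl zero_le_one)
  then obtain C where C: "\<And>\<epsilon>. \<epsilon> > 0 \<Longrightarrow> holder_on 0 C (closure \<Omega>) (gt \<epsilon>)"
    "\<And>\<epsilon> x. \<epsilon> > 0 \<Longrightarrow> x \<in> frontier \<Omega> \<Longrightarrow> \<bar>g x - gt \<epsilon> x\<bar> \<le> C * \<epsilon> powr 0" by blast
  obtain x0 where x0: "x0 \<in> frontier \<Omega>" using ne by blast
  have "\<bar>gt \<epsilon> x\<bar> \<le> b + 2 * \<bar>C\<bar>" if e: "\<epsilon> > 0" and x: "x \<in> closure \<Omega>" for \<epsilon> x
  proof -
    have "\<bar>gt \<epsilon> x - gt \<epsilon> x0\<bar> \<le> C * dist x x0 powr 0"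
      using C(1)[OF e] x x0 fc(2) unfolding holder_on_def by blast
    also have "\<dots> \<le> \<bar>C\<bar>" by (cases "x = x0") auto
    finally have "\<bar>gt \<epsilon> x - gt \<epsilon> x0\<bar> \<le> \<bar>C\<bar>" .
    moreover have "\<bar>g x0 - gt \<epsilon> x0\<bar> \<le> \<bar>C\<bar>" using C(2)[OF e x0] e by simp
    ultimately show ?thesis using b[OF x0] unfolding abs_le_iff by (intro conjI; linarith)
  qed
  then show ?thesis by blast
qed

text \<open>Continuity of \<open>g\<close> alone gives no positive Hoelder exponent; the common
  modulus \<omega> controls both the variation of \<open>gt \<epsilon>\<close> and its distance from
  \<open>g\<close>.\<close>

lemma boundary_data_near:
  assumes fc: "frontier \<Omega> \<subseteq> closure \<Omega>" and BC2: "cond_BC2 \<Omega> g gt" and \<eta>: "\<eta> > 0"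
  shows "\<exists>\<delta>>0. \<forall>\<epsilon> z. \<forall>x0\<in>frontier \<Omega>. 0 < \<epsilon> \<longrightarrow> \<epsilon> < \<delta> \<longrightarrow> z \<in> closure \<Omega> \<longrightarrow> dist z x0 < \<delta> \<longrightarrow> \<bar>gt \<epsilon> z - g x0\<bar> \<le> \<eta>"
proof -
  obtain \<omega> :: "real \<Rightarrow> real" where \<omega>: "(\<omega> \<longlongrightarrow> 0) (at_right 0)"
    "\<And>\<epsilon> x y. \<epsilon> > 0 \<Longrightarrow> x \<in> closure \<Omega> \<Longrightarrow> y \<in> closure \<Omega> \<Longrightarrow> \<bar>gt \<epsilon> x - gt \<epsilon> y\<bar> \<le> \<omega> (dist x y)"
    "\<And>\<epsilon> x. \<epsilon> > 0 \<Longrightarrow> x \<in> frontier \<Omega> \<Longrightarrow> \<bar>g x - gt \<epsilon> x\<bar> \<le> \<omega> \<epsilon>"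
    using BC2 unfolding cond_BC2_def by blast
  have "\<forall>\<^sub>F s in at_right 0. \<omega> s < \<eta> / 2" using \<omega>(1) \<eta> by (intro order_tendstoD) auto
  then obtain \<delta> where \<delta>: "\<delta> > 0" "\<And>s. 0 < s \<Longrightarrow> s < \<delta> \<Longrightarrow> \<omega> s < \<eta> / 2"
    unfolding eventually_at_right_field by auto
  have "\<bar>gt \<epsilon> z - g x0\<bar> \<le> \<eta>"
    if "x0 \<in> frontier \<Omega>" "0 < \<epsilon>" "\<epsilon> < \<delta>" "z \<in> closure \<Omega>" "dist z x0 < \<delta>" for \<epsilon> z x0
  proof -
    have x0c: "x0 \<in> closure \<Omega>" using that(1) fc by blast
    have "\<bar>g x0 - gt \<epsilon> x0\<bar> \<le> \<eta> / 2" using \<omega>(3)[OF that(2,1)] \<delta>(2)[OF that(2,3)] by linarith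
    \<comment> \<open>The limit of \<omega> at 0 says nothing about its value at 0, hence the case
      \<open>z = x0\<close>.\<close>
    moreover have "\<bar>gt \<epsilon> z - gt \<epsilon> x0\<bar> \<le> \<eta> / 2"
    proof (cases "z = x0")
      case False
      then show ?thesis using \<omega>(2)[OF that(2,4) x0c] \<delta>(2)[of "dist z x0"] that(5) by simp
    qed (use \<eta> in simp)
    ultimately show ?thesis unfolding abs_le_iff by (intro conjI; linarith)
  qed
  then show ?thesis using \<delta>(1) by blast
qed

theorem theorem5p7:
  fixes \<Omega> :: "(real^'n) set"
    and f obs g :: "real^'n \<Rightarrow> real"
    and gt :: "real \<Rightarrow> real^'n \<Rightarrow> real"
    and Th :: "nat \<Rightarrow> (real^'n) set set"
    and \<epsilon> \<theta> :: "nat \<Rightarrow> real"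
    and S :: "nat \<Rightarrow> (real^'n) set"
    and uh :: "nat \<Rightarrow> real^'n \<Rightarrow> real"
  assumes dom: "bounded_domain_cont_bdry \<Omega>"
    and mesh: "\<And>j. is_mesh (Th j)"
    and mesh_dom: "\<And>j. inner_set \<Omega> (meshsize (Th j)) \<subseteq> mesh_domain (Th j)
                         \<and> mesh_domain (Th j) \<subseteq> \<Omega>"
    and quasiuniform: "\<exists>\<sigma>>0. \<forall>j. \<forall>T\<in>Th j. \<exists>c. ball c (meshsize (Th j) / \<sigma>) \<subseteq> T"
    and eps: "\<And>j. meshsize (Th j) \<le> \<epsilon> j \<and> \<epsilon> j \<le> diameter \<Omega>"
    and theta: "\<And>j. 0 < \<theta> j \<and> \<theta> j \<le> 1"
    and dirs: "\<And>j. admissible_dirs (\<theta> j) (S j)"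
    and lim: "(\<lambda>j. meshsize (Th j) + \<epsilon> j + \<theta> j + meshsize (Th j) / \<epsilon> j + \<theta> j / \<epsilon> j)
               \<longlonglongrightarrow> 0"
    and RHS1: "continuous_on \<Omega> f \<and> bounded (f ` \<Omega>)"
    and RHS2: "(SUP x\<in>\<Omega>. f x) < 0 \<or> (INF x\<in>\<Omega>. f x) > 0 \<or> (\<forall>x\<in>\<Omega>. f x = 0)"
    and BC1: "continuous_on (frontier \<Omega>) g"
    and BC2: "cond_BC2 \<Omega> g gt"
    and OBS1: "continuous_on (closure \<Omega>) obs \<and> (\<forall>x\<in>frontier \<Omega>. obs x < g x)"
    and M1: "(\<forall>x\<in>\<Omega>. f x = 0) \<Longrightarrow> \<forall>j. cond_M1 \<Omega> (Th j) (S j) (\<epsilon> j)"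
    and sol: "\<And>j. discrete_obstacle_solution \<Omega> (Th j) (S j) (\<epsilon> j) f obs (gt (\<epsilon> j)) (uh j)"
  shows "\<exists>u. viscosity_obstacle_solution \<Omega> f obs g u \<and>
            (\<forall>e>0. \<exists>J. \<forall>j\<ge>J. \<forall>x\<in>\<Union>(Th j). \<bar>uh j x - u x\<bar> < e)"
proof -
  let ?h = "\<lambda>j. meshsize (Th j)"
  have \<Omega>: "open \<Omega>" "bounded \<Omega>" "\<Omega> \<noteq> {}" using dom by (auto simp: bounded_domain_cont_bdry_def)
  have h0: "?h j > 0" for j by (rule meshsize_pos[OF mesh])
  have e0: "\<epsilon> j > 0" for j using h0[of j] eps[of j] by linarith
  have ts: "two_scale \<Omega> (Th j) (S j) (\<epsilon> j) (\<theta> j) (?h j)" for j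
    by (rule two_scale.intro) (use mesh mesh_dom eps dirs in auto)
  let ?q = "\<lambda>j. ?h j + \<epsilon> j + \<theta> j + ?h j / \<epsilon> j + \<theta> j / \<epsilon> j"
  have pos: "0 \<le> ?h j" "0 \<le> \<epsilon> j" "0 \<le> \<theta> j" "0 \<le> ?h j / \<epsilon> j" "0 \<le> \<theta> j / \<epsilon> j" for j
    using h0[of j] e0[of j] theta[of j] by auto
  \<comment> \<open>All five summands are nonnegative, so each of them is dominated by the
    sum.\<close>
  have small: "a \<longlonglongrightarrow> 0" if "\<And>j. 0 \<le> a j" "\<And>j. a j \<le> ?q j" for a :: "nat \<Rightarrow> real"
    by (rule tendsto_sandwich[OF _ _ tendsto_const lim]) (use that in \<open>auto intro: always_eventually\<close>)
  have cs: "convergent_scheme \<Omega> Th S \<epsilon> \<theta> ?h"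
  proof (rule convergent_scheme.intro[OF \<Omega> ts])
    show "0 \<le> \<theta> j" for j by (rule pos)
    show "\<epsilon> \<longlonglongrightarrow> 0"
    proof (rule small)
      show "\<epsilon> j \<le> ?q j" for j using pos[of j] by linarith
    qed (rule pos)
    show "(\<lambda>j. ?h j / \<epsilon> j) \<longlonglongrightarrow> 0"
    proof (rule small)
      show "?h j / \<epsilon> j \<le> ?q j" for j using pos[of j] by linarith
    qed (rule pos)
    show "(\<lambda>j. \<theta> j / \<epsilon> j) \<longlonglongrightarrow> 0"
    proof (rule small)
      show "\<theta> j / \<epsilon> j \<le> ?q j" for j using pos[of j] by linarith
    qed (rule pos)
  qed
  interpret convergent_scheme \<Omega> Th S \<epsilon> \<theta> ?h by (rule cs)
  have fc: "frontier \<Omega> \<subseteq> closure \<Omega>" by (auto simp: frontier_eq)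
  obtain CF where CF: "\<And>x. x \<in> \<Omega> \<Longrightarrow> \<bar>f x\<bar> \<le> CF" using RHS1 by (auto simp: bounded_iff)
  have sign: "(\<exists>c>0. \<forall>x\<in>\<Omega>. c \<le> f x) \<or> (\<exists>c>0. \<forall>x\<in>\<Omega>. f x \<le> - c) \<or> (\<forall>x\<in>\<Omega>. f x = 0)"
    using RHS2
  proof (elim disjE)
    assume neg: "(SUP x\<in>\<Omega>. f x) < 0"
    have "f x \<le> (SUP x\<in>\<Omega>. f x)" if "x \<in> \<Omega>" for x
      using that RHS1 by (intro cSUP_upper bounded_imp_bdd_above) auto
    then show ?thesis using neg by (intro disjI2 disjI1 exI[of _ "- (SUP x\<in>\<Omega>. f x)"]) auto
  next
    assume p: "(INF x\<in>\<Omega>. f x) > 0"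
    have "(INF x\<in>\<Omega>. f x) \<le> f x" if "x \<in> \<Omega>" for x
      using that RHS1 by (intro cINF_lower bounded_imp_bdd_below) auto
    then show ?thesis using p by (intro disjI1 exI[of _ "INF x\<in>\<Omega>. f x"]) auto
  qed blast
  have bn: "uh j z = gt (\<epsilon> j) z" "z \<in> closure \<Omega>" if "z \<in> boundary_nodes \<Omega> (Th j) (\<epsilon> j)" for j z
    using sol[of j] that nodes_in[of z j] by (auto simp: discrete_obstacle_solution_def boundary_nodes_def)
  obtain B where B: "\<And>\<epsilon> x. \<epsilon> > 0 \<Longrightarrow> x \<in> closure \<Omega> \<Longrightarrow> \<bar>gt \<epsilon> x\<bar> \<le> B"
    using boundary_data_bounded[OF compact_closure frontier_ne BC1 BC2] by blast
  have Bb: "\<bar>uh j z\<bar> \<le> B" if "z \<in> boundary_nodes \<Omega> (Th j) (\<epsilon> j)" for j z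
    using B[OF e0 bn(2)[OF that]] by (simp add: bn(1)[OF that])
  have near: "\<exists>\<delta>>0. \<forall>\<^sub>F j in sequentially. \<forall>z\<in>boundary_nodes \<Omega> (Th j) (\<epsilon> j). dist z x0 < \<delta> \<longrightarrow> \<bar>uh j z - g x0\<bar> \<le> \<eta>"
    if x0: "x0 \<in> frontier \<Omega>" and \<eta>: "\<eta> > 0" for x0 \<eta>
  proof -
    obtain \<delta> where \<delta>: "\<delta> > 0" and gd: "\<forall>\<epsilon> z. \<forall>x0\<in>frontier \<Omega>. 0 < \<epsilon> \<longrightarrow> \<epsilon> < \<delta> \<longrightarrow> z \<in> closure \<Omega> \<longrightarrow> dist z x0 < \<delta> \<longrightarrow> \<bar>gt \<epsilon> z - g x0\<bar> \<le> \<eta>"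
      using boundary_data_near[OF fc BC2 \<eta>] by blast
    have "\<forall>\<^sub>F j in sequentially. \<epsilon> j < \<delta>" using eps_lim \<delta> by (intro order_tendstoD)
    then have "\<forall>\<^sub>F j in sequentially. \<forall>z\<in>boundary_nodes \<Omega> (Th j) (\<epsilon> j). dist z x0 < \<delta> \<longrightarrow> \<bar>uh j z - g x0\<bar> \<le> \<eta>"
    proof eventually_elim
      case (elim j)
      show ?case
      proof (intro ballI impI)
        fix z assume z: "z \<in> boundary_nodes \<Omega> (Th j) (\<epsilon> j)" and d: "dist z x0 < \<delta>"
        show "\<bar>uh j z - g x0\<bar> \<le> \<eta>"
          unfolding bn(1)[OF z] using gd x0 e0 elim bn(2)[OF z] d by blast
      qed
    qed
    then show ?thesis using \<delta> by blast
  qed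
  have bl: "boundary_le (\<lambda>x. c * g x) (\<lambda>j x. c * uh j x)" if c: "c = 1 \<or> c = - 1" for c
    unfolding boundary_le_def
  proof (intro conjI ballI allI impI)
    fix x0 \<eta> assume "x0 \<in> frontier \<Omega>" "(\<eta>::real) > 0"
    from near[OF this] obtain \<delta> where "\<delta> > 0" and ev: "\<forall>\<^sub>F j in sequentially.
        \<forall>z\<in>boundary_nodes \<Omega> (Th j) (\<epsilon> j). dist z x0 < \<delta> \<longrightarrow> \<bar>uh j z - g x0\<bar> \<le> \<eta>" by blast
    then show "\<exists>\<delta>>0. \<forall>\<^sub>F j in sequentially. \<forall>z\<in>boundary_nodes \<Omega> (Th j) (\<epsilon> j).
        dist z x0 < \<delta> \<longrightarrow> c * uh j z \<le> c * g x0 + \<eta>"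
      using c by (intro exI[of _ \<delta>] conjI eventually_mono[OF ev]) (auto simp: abs_le_iff)
  next
    show "\<exists>B. \<forall>\<^sub>F j in sequentially. \<forall>z\<in>boundary_nodes \<Omega> (Th j) (\<epsilon> j). c * uh j z \<le> B"
      using Bb c by (intro exI[of _ B] always_eventually allI ballI) (auto simp: abs_le_iff)
  qed
  have b1: "boundary_le g uh" and b2: "boundary_le (\<lambda>x. - g x) (\<lambda>j x. - uh j x)"
    using bl[of 1] bl[of "- 1"] by simp_all
  have "\<exists>u. viscosity_obstacle_solution \<Omega> f obs g u \<and>
    (\<forall>e>0. \<forall>\<^sub>F j in sequentially. \<forall>z\<in>nodes (Th j). \<bar>uh j z - u z\<bar> < e)"
  proof (rule obstacle_convergence[OF _ CF sign _ _ _ b1 b2])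
    show "continuous_on \<Omega> f" "continuous_on (closure \<Omega>) obs" using RHS1 OBS1 by auto
    show "obs x < g x" if "x \<in> frontier \<Omega>" for x using OBS1 that by blast
    show "min (minus_disc_inf_lap (Th j) (S j) (\<epsilon> j) (uh j) z - f z) (uh j z - obs z) = 0"
      if "z \<in> interior_nodes \<Omega> (Th j) (\<epsilon> j)" for j z
      using sol[of j] that unfolding discrete_obstacle_solution_def by blast
  qed
  then obtain u where u: "viscosity_obstacle_solution \<Omega> f obs g u"
    and conv: "\<And>e. e > 0 \<Longrightarrow> \<forall>\<^sub>F j in sequentially. \<forall>z\<in>nodes (Th j). \<bar>uh j z - u z\<bar> < e" by blast
  have "continuous_on (closure \<Omega>) u" using u by (simp add: viscosity_obstacle_solution_def)
  then have uc: "uniformly_continuous_on (closure \<Omega>) u"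
    using compact_closure by (rule compact_uniformly_continuous)
  \<comment> \<open>From nodes to the whole mesh: \<open>uh j x\<close> is an average of nodal
    values within one mesh size of \<open>x\<close>, each close to \<open>u\<close> at its node, and
    \<open>u\<close> is uniformly continuous.\<close>
  have "\<exists>J. \<forall>j\<ge>J. \<forall>x\<in>\<Union>(Th j). \<bar>uh j x - u x\<bar> < e" if e: "e > 0" for e
  proof -
    have "e / 3 > 0" using e by simp
    from uc[unfolded uniformly_continuous_on_def, rule_format, OF this]
    obtain d where d: "d > 0" "\<forall>x\<in>closure \<Omega>. \<forall>y\<in>closure \<Omega>. dist y x < d \<longrightarrow> dist (u y) (u x) < e / 3"
      by (elim exE conjE)
    have "\<forall>\<^sub>F j in sequentially. ?h j < d" using h_lim d(1) by (intro order_tendstoD)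
    with conv[OF \<open>e / 3 > 0\<close>] have "\<forall>\<^sub>F j in sequentially. \<forall>x\<in>\<Union>(Th j). \<bar>uh j x - u x\<bar> < e"
    proof eventually_elim
      case (elim j)
      show ?case
      proof
        fix x assume x: "x \<in> \<Union>(Th j)"
        have xc: "x \<in> closure \<Omega>" using mesh_subset_closure[OF mesh] mesh_dom x by blast
        obtain \<mu> where \<mu>: "\<And>v. v \<in> nodes (Th j) \<Longrightarrow> 0 \<le> \<mu> v"
          "\<And>v. v \<in> nodes (Th j) \<Longrightarrow> \<mu> v \<noteq> 0 \<Longrightarrow> dist x v \<le> ?h j"
          "sum \<mu> (nodes (Th j)) = 1" "(\<Sum>v\<in>nodes (Th j). \<mu> v *\<^sub>R v) = x"
          "\<And>w. interp (Th j) w x = (\<Sum>v\<in>nodes (Th j). \<mu> v * w v)"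
          "\<And>w. w \<in> Vh (Th j) \<Longrightarrow> w x = (\<Sum>v\<in>nodes (Th j). \<mu> v * w v)"
          by (rule interp_representation[OF mesh x]) (rule that)
        have "uh j \<in> Vh (Th j)" using sol[of j] by (simp add: discrete_obstacle_solution_def)
        then have "uh j x - u x = (\<Sum>v\<in>nodes (Th j). \<mu> v * uh j v) - (\<Sum>v\<in>nodes (Th j). \<mu> v * u x)"
          using \<mu>(3,6) by (simp flip: sum_distrib_right)
        also have "\<dots> = (\<Sum>v\<in>nodes (Th j). \<mu> v * (uh j v - u x))"
          by (simp add: right_diff_distrib sum_subtractf)
        finally have "\<bar>uh j x - u x\<bar> \<le> (\<Sum>v\<in>nodes (Th j). \<bar>\<mu> v * (uh j v - u x)\<bar>)" by (simp only: sum_abs)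
        also have "\<dots> \<le> (\<Sum>v\<in>nodes (Th j). \<mu> v * (2 * e / 3))"
        proof (rule sum_mono)
          fix v assume v: "v \<in> nodes (Th j)"
          show "\<bar>\<mu> v * (uh j v - u x)\<bar> \<le> \<mu> v * (2 * e / 3)"
          proof (cases "\<mu> v = 0")
            case False
            have "dist v x < d" using \<mu>(2)[OF v False] elim(2) by (simp add: dist_commute)
            then have "dist (u v) (u x) < e / 3" using d(2) xc nodes_in[OF v] by blast
            moreover have "dist (uh j v) (u v) < e / 3" using elim(1) v by (simp add: dist_real_def)
            ultimately have "dist (uh j v) (u x) \<le> 2 * e / 3" using dist_triangle[of "uh j v" "u x" "u v"] by linarith
            then have "\<bar>uh j v - u x\<bar> \<le> 2 * e / 3" by (simp add: dist_real_def)
            then have "\<mu> v * \<bar>uh j v - u x\<bar> \<le> \<mu> v * (2 * e / 3)" using \<mu>(1)[OF v] by (rule mult_left_mono)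
            then show ?thesis using \<mu>(1)[OF v] by (simp add: abs_mult)
          qed simp
        qed
        also have "\<dots> = 2 * e / 3" using \<mu>(3) by (simp only: mult_1 flip: sum_distrib_right)
        also have "\<dots> < e" using e by simp
        finally show "\<bar>uh j x - u x\<bar> < e" .
      qed
    qed
    then show ?thesis unfolding eventually_sequentially .
  qed
  then show ?thesis using u by blast
qed

end
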